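(* Let $n,d,r,s$ be positive integers with $r\le s\le \dim_{\mathbb C} S_d$. Let points $p_1,\dots,p_s\in\mathbb P^{r-1}$ and $Q_1,\dots,Q_s\in\mathbb P^n$ be chosen generally. Then $\Sigma$ has codimension $c$ in $G(r,S_d)$ if and only if there are exactly $\infty^{c-1}$ groves for $(\underline p,\underline Q)$, i.e. if and only if $\dim \mathrm{Grove}(\underline p,\underline Q)=c-1$ (with the convention that the empty set has dimension $-1$). In particular, $\Sigma$ is dense in $G(r,S_d)$ if and only if $(\underline p,\underline Q)$ do not admit a grove.
   Context: $V$ is a $\mathbb C$-vector space of dimension $n+1$, $S=\bigoplus_{d\ge0}\mathrm{Sym}^d V$, $\mathbb P^n=\mathbb P S_1$. $G(r,S_d)$ is the Grassmannian of $r$-dimensional subspaces of $S_d$. $U_s\subseteq \mathrm{Sym}^s(\mathbb P S_1)$ is the open set of unordered $s$-tuples $\{Q_1,\dots,Q_s\}$ with $Q_1^d,\dots,Q_s^d$ linearly independent over $\mathbb C$. $\Sigma\subseteq G(r,S_d)$ is the (constructible) set of all $\Lambda$ such that $\Lambda\subseteq \mathrm{span}(Q_1^d,\dots,Q_s^d)$ for some $\{Q_1,\dots,Q_s\}\in U_s$. Grove. Let $\underline Q=(Q_1,\dots,Q_s)$ be points in $\mathbb P^n$ and $\underline p=(p_1,\dots,p_s)$ points in $\mathbb P^{r-1}$. A grove for $(\underline p,\underline Q)$ is a triple $(\Gamma,L,\gamma)$ where: $\Gamma\subseteq\mathbb P H^0(\mathbb P^n,\mathcal O_{\mathbb P}(d))$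 is a linear system of some dimension $t$, $0\le t\le r-1$; $L\subseteq\mathbb P^{r-1}$ is a linear subspace of dimension $r-(t+2)$ (empty if $t=r-1$), defining the projection $\pi_L:\mathbb P^{r-1}\dashrightarrow\mathbb P^t$, where $\mathbb P^t$ is identified with the set of linear subspaces of dimension $r-(t+1)$ containing $L$ and $\pi_L(p)=\overline{Lp}$ (the identity if $L=\emptyset$); and $\gamma:\mathbb P^t\to\Gamma$ is an isomorphism of projective spaces; such that (a) all $Q_i$ belong to the base locus of $\Gamma$, and (b) for every $i$, either $p_i\in L$ or the hypersurface $\gamma\circ\pi_L(p_i)$ is singular at $Q_i$. $\mathrm{Grove}(\underline p,\underline Q)$ is the set of all groves. It is given the structure of a projective space as follows. Choose $A=(\alpha_{ij})\in\mathrm{Mat}(s,r;\mathbb C)$ whose $i$-th row represents $p_i\in\mathbb P^{r-1}=\mathbb P\,\mathrm{Mat}(1,r;\mathbb C)$; let $K$ be the vector space of $r$-tuples $[u_1,\dots,u_r]$ of degree $d$ forms on $\mathbb P^n$ vanishing at all $Q_i$ such that $\sum_j\alpha_{ij}u_j$ vanishes to order at least $2$ at $Q_i$ for every $i$. A nonzero $[u_1,\dots,u_r]\in K$ corresponds to the grove with $\Gamma=\mathbb P(\mathrm{span}(u_1,\dots,u_r))$, $L=\{X: \sum_j X_ju_j=0\}$, and $\gamma$ induced by $X\mapsto\sum_jX_ju_j$; this identifies $\mathbb P(K)$ with $\mathrm{Grove}(\underline p,\underline Q)$. "There are $\infty^m$ groves" means this variety has dimension $m$. "Generally chosen" means: for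 all $(\underline p,\underline Q)$ in some nonempty Zariski open subset of $(\mathbb P^{r-1})^s\times(\mathbb P^n)^s$. *)

theory Defs
  imports
    "HOL-Library.Poly_Mapping"
    "HOL-Library.Multiset"
    "HOL-Library.Extended_Real"
    "HOL-Analysis.Abstract_Topology"
    "Jordan_Normal_Form.Determinant"
begin

abbreviation "lookup \<equiv> Poly_Mapping.lookup"
abbreviation "keys \<equiv> Poly_Mapping.keys"
abbreviation "single \<equiv> Poly_Mapping.single"

section \<open>Complex vector spaces of finitely supported functions\<close>

definition cscale :: "complex \<Rightarrow> ('i \<Rightarrow>\<^sub>0 complex) \<Rightarrow> ('i \<Rightarrow>\<^sub>0 complex)" where
  "cscale c f = Poly_Mapping.map (\<lambda>x. c * x) f"

lemma lookup_cscale [simp]: "lookup (cscale c f) i = c * lookup f i"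
  by (simp add: cscale_def Poly_Mapping.map.rep_eq when_def)

global_interpretation cvs: vector_space "cscale :: complex \<Rightarrow> ('i \<Rightarrow>\<^sub>0 complex) \<Rightarrow> _"
  by unfold_locales (auto intro!: poly_mapping_eqI simp: lookup_add algebra_simps)

definition tscale :: "complex \<Rightarrow> (nat \<Rightarrow>\<^sub>0 ('i \<Rightarrow>\<^sub>0 complex)) \<Rightarrow> (nat \<Rightarrow>\<^sub>0 ('i \<Rightarrow>\<^sub>0 complex))" where
  "tscale c u = Poly_Mapping.map (cscale c) u"

lemma lookup_tscale [simp]: "lookup (tscale c u) j = cscale c (lookup u j)"
  by (simp add: tscale_def Poly_Mapping.map.rep_eq when_def)

global_interpretation tvs: vector_space "tscale :: complex \<Rightarrow> (nat \<Rightarrow>\<^sub>0 ('i \<Rightarrow>\<^sub>0 complex)) \<Rightarrow> _"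
  by unfold_locales
    (auto intro!: poly_mapping_eqI simp: lookup_add cvs.scale_right_distrib cvs.scale_left_distrib)

text \<open>\<open>grass k W\<close> is the Grassmannian of \<open>k\<close>-dimensional subspaces of \<open>W\<close>; projective space
  \<open>proj W\<close> is the case \<open>k = 1\<close>, so its points are lines. For \<open>k = 0\<close> and \<open>W\<close>
  finite-dimensional, \<open>{0}\<close> is the only element; it represents the empty projective subspace.\<close>

definition grass :: "nat \<Rightarrow> ('i \<Rightarrow>\<^sub>0 complex) set \<Rightarrow> ('i \<Rightarrow>\<^sub>0 complex) set set" where
  "grass k W = {\<Lambda>. cvs.subspace \<Lambda> \<and> \<Lambda> \<subseteq> W \<and> cvs.dim \<Lambda> = k}"

abbreviation proj :: "('i \<Rightarrow>\<^sub>0 complex) set \<Rightarrow> ('i \<Rightarrow>\<^sub>0 complex) set set" where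
  "proj W \<equiv> grass 1 W"

text \<open>The space \<open>Mat(1,r)\<close> of row vectors \<open>\<complex>\<^sup>r\<close>.\<close>

definition row_vecs :: "nat \<Rightarrow> (nat \<Rightarrow>\<^sub>0 complex) set" where
  "row_vecs r = {X. keys X \<subseteq> {..<r}}"


section \<open>Polynomials\<close>

type_synonym 'v cpoly = "('v \<Rightarrow>\<^sub>0 nat) \<Rightarrow>\<^sub>0 complex"

definition vars :: "'v cpoly \<Rightarrow> 'v set" where
  "vars F = (\<Union>m\<in>keys F. keys m)"

definition homogeneous_on :: "'v set \<Rightarrow> nat \<Rightarrow> 'v cpoly \<Rightarrow> bool" where
  "homogeneous_on B k F \<longleftrightarrow> (\<forall>m\<in>keys F. (\<Sum>v\<in>keys m \<inter> B. lookup m v) = k)"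

abbreviation homogeneous :: "nat \<Rightarrow> 'v cpoly \<Rightarrow> bool" where
  "homogeneous \<equiv> homogeneous_on UNIV"

definition eval_poly :: "'v cpoly \<Rightarrow> ('v \<Rightarrow> complex) \<Rightarrow> complex" where
  "eval_poly F x = (\<Sum>m\<in>keys F. lookup F m * (\<Prod>v\<in>keys m. x v ^ lookup m v))"

definition partial_deriv :: "'v \<Rightarrow> 'v cpoly \<Rightarrow> 'v cpoly" where
  "partial_deriv v F =
     (\<Sum>m\<in>keys F. single (m - single v 1) (of_nat (lookup m v) * lookup F m))"

text \<open>A basis \<open>x\<^sub>0, \<dots>, x\<^sub>n\<close> of \<open>V\<close> is fixed, so that \<open>S = Sym V\<close> is the polynomial ring in
  these variables and \<open>S\<^sub>d\<close> is \<open>forms n d\<close>. In dual coordinates, \<open>forms n d\<close> also serves as the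
  space \<open>H\<^sup>0(\<P>\<^sup>n, \<O>(d))\<close> of degree \<open>d\<close> forms on \<open>\<P>\<^sup>n = \<P> S\<^sub>1\<close>: such a form is
  evaluated at a linear form \<open>q\<close> by substituting the coefficients \<open>coords q\<close> of \<open>q\<close>.\<close>

definition forms :: "nat \<Rightarrow> nat \<Rightarrow> nat cpoly set" where
  "forms n d = {F. homogeneous d F \<and> vars F \<subseteq> {..n}}"

definition coords :: "nat cpoly \<Rightarrow> nat \<Rightarrow> complex" where
  "coords q v = lookup q (single v 1)"

definition vanishes_at :: "nat cpoly \<Rightarrow> nat cpoly set \<Rightarrow> bool" where
  "vanishes_at u Q \<longleftrightarrow> (\<forall>q\<in>Q - {0}. eval_poly u (coords q) = 0)"

text \<open>Vanishing to order at least 2 at \<open>Q\<close>; for \<open>u \<noteq> 0\<close>, this says that the hypersurface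
  \<open>u = 0\<close> is singular at \<open>Q\<close>.\<close>

definition vanishes_twice_at :: "nat cpoly \<Rightarrow> nat cpoly set \<Rightarrow> bool" where
  "vanishes_twice_at u Q \<longleftrightarrow> vanishes_at u Q \<and> (\<forall>v. vanishes_at (partial_deriv v u) Q)"


section \<open>Zariski topologies and dimension\<close>

text \<open>Plucker coordinates of the span of \<open>vs\<close> (a list of length \<open>r\<close>), indexed by
  lists of \<open>r\<close> coordinate indices.\<close>

definition plucker :: "nat \<Rightarrow> ('i \<Rightarrow>\<^sub>0 complex) list \<Rightarrow> 'i list \<Rightarrow> complex" where
  "plucker r vs I = Determinant.det (Matrix.mat r r (\<lambda>(i, j). lookup (vs ! i) (I ! j)))"

definition is_basis :: "('i \<Rightarrow>\<^sub>0 complex) list \<Rightarrow> ('i \<Rightarrow>\<^sub>0 complex) set \<Rightarrow> bool" where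
  "is_basis vs \<Lambda> \<longleftrightarrow> distinct vs \<and> cvs.independent (set vs) \<and> cvs.span (set vs) = \<Lambda>"

text \<open>Zariski topology on \<open>grass r W\<close> (for finite-dimensional \<open>W\<close>), induced by the Plucker
  embedding: the sets where a form in the Plucker coordinates does not vanish are a basis. By
  homogeneity, non-vanishing does not depend on the basis \<open>vs\<close> of \<open>\<Lambda>\<close>.\<close>

definition zariski_grass :: "nat \<Rightarrow> ('i \<Rightarrow>\<^sub>0 complex) set \<Rightarrow> ('i \<Rightarrow>\<^sub>0 complex) set topology" where
  "zariski_grass r W = topology_generated_by
     {{\<Lambda> \<in> grass r W. \<exists>vs. is_basis vs \<Lambda> \<and> eval_poly F (plucker r vs) \<noteq> 0} | F.
        (\<exists>k. homogeneous k F) \<and> vars F \<subseteq> {I. length I = r}}"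

text \<open>Zariski topology on \<open>(\<P> W)\<^sup>s \<times> (\<P> W')\<^sup>s\<close>. The variable \<open>Inl (i, j)\<close> stands for the
  \<open>j\<close>-th coordinate of the \<open>i\<close>-th point of the first factor, \<open>Inr (i, j)\<close> for that of the
  second factor; the polynomials are homogeneous in the coordinates of each point separately.\<close>

definition multihomogeneous :: "nat \<Rightarrow> (nat \<times> 'i + nat \<times> 'j) cpoly \<Rightarrow> bool" where
  "multihomogeneous s F \<longleftrightarrow>
     (\<forall>i<s. \<exists>k. homogeneous_on (range (\<lambda>j. Inl (i, j))) k F) \<and>
     (\<forall>i<s. \<exists>k. homogeneous_on (range (\<lambda>j. Inr (i, j))) k F) \<and>
     vars F \<subseteq> {..<s} \<times> UNIV <+> {..<s} \<times> UNIV"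

definition point_tuples ::
  "nat \<Rightarrow> ('i \<Rightarrow>\<^sub>0 complex) set \<Rightarrow> ('j \<Rightarrow>\<^sub>0 complex) set \<Rightarrow>
     ((nat \<Rightarrow> ('i \<Rightarrow>\<^sub>0 complex) set) \<times> (nat \<Rightarrow> ('j \<Rightarrow>\<^sub>0 complex) set)) set" where
  "point_tuples s W W' = ({..<s} \<rightarrow>\<^sub>E proj W) \<times> ({..<s} \<rightarrow>\<^sub>E proj W')"

definition zariski_points ::
  "nat \<Rightarrow> ('i \<Rightarrow>\<^sub>0 complex) set \<Rightarrow> ('j \<Rightarrow>\<^sub>0 complex) set \<Rightarrow>
     ((nat \<Rightarrow> ('i \<Rightarrow>\<^sub>0 complex) set) \<times> (nat \<Rightarrow> ('j \<Rightarrow>\<^sub>0 complex) set)) topology" where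
  "zariski_points s W W' = topology_generated_by
     {{(p, Q) \<in> point_tuples s W W'.
         \<exists>a b. (\<forall>i<s. a i \<in> p i - {0} \<and> b i \<in> Q i - {0}) \<and>
           eval_poly F (case_sum (\<lambda>(i, j). lookup (a i) j) (\<lambda>(i, j). lookup (b i) j)) \<noteq> 0} | F.
        multihomogeneous s F}"

definition irreducible_closed :: "'a topology \<Rightarrow> 'a set \<Rightarrow> bool" where
  "irreducible_closed X Z \<longleftrightarrow> closedin X Z \<and> Z \<noteq> {} \<and>
     (\<forall>A B. closedin X A \<longrightarrow> closedin X B \<longrightarrow> Z \<subseteq> A \<union> B \<longrightarrow> Z \<subseteq> A \<or> Z \<subseteq> B)"

text \<open>Krull dimension: the supremum of the lengths of chains of irreducible closed subsets
  (\<open>-\<infinity>\<close> for the empty space).\<close>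

definition krull_dim :: "'a topology \<Rightarrow> ereal" where
  "krull_dim X = (SUP k\<in>{k :: nat. \<exists>Z. (\<forall>i\<le>k. irreducible_closed X (Z i)) \<and> (\<forall>i<k. Z i \<subset> Z (Suc i))}.
     ereal (real k))"

text \<open>The dimension of a constructible set is that of its closure.\<close>

definition codim :: "'a topology \<Rightarrow> 'a set \<Rightarrow> ereal" where
  "codim X Y = krull_dim X - krull_dim (subtopology X (X closure_of Y))"

definition dense_in :: "'a topology \<Rightarrow> 'a set \<Rightarrow> bool" where
  "dense_in X Y \<longleftrightarrow> X closure_of Y = topspace X"


section \<open>The set \<open>\<Sigma>\<close>\<close>

text \<open>Unordered \<open>s\<close>-tuples of points of \<open>\<P> S\<^sub>1\<close> whose \<open>d\<close>-th powers are linearly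
  independent. The condition does not depend on the linear forms \<open>qs ! i\<close> chosen to represent the
  points.\<close>

definition Uset :: "nat \<Rightarrow> nat \<Rightarrow> nat \<Rightarrow> nat cpoly set multiset set" where
  "Uset n d s = {mset (map (\<lambda>q. cvs.span {q}) qs) | qs.
     length qs = s \<and> set qs \<subseteq> forms n 1 - {0} \<and>
     distinct (map (\<lambda>q. q ^ d) qs) \<and> cvs.independent (set (map (\<lambda>q. q ^ d) qs))}"

definition Sigma_set :: "nat \<Rightarrow> nat \<Rightarrow> nat \<Rightarrow> nat \<Rightarrow> nat cpoly set set" where
  "Sigma_set n d r s = {\<Lambda> \<in> grass r (forms n d).
     \<exists>M\<in>Uset n d s. \<Lambda> \<subseteq> cvs.span (\<Union>Q\<in>set_mset M. (\<lambda>q. q ^ d) ` Q)}"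


section \<open>Groves\<close>

text \<open>The linear system \<open>\<Gamma>\<close> and the linear subspace \<open>L\<close> are represented by the underlying
  vector subspaces, of dimension one more than the projective dimension. \<open>star_space r L\<close> is the
  projective space \<open>\<P>\<^sup>t\<close> of linear subspaces of \<open>\<P>\<^sup>r\<^sup>-\<^sup>1\<close> that contain \<open>L\<close> and have
  dimension one more than \<open>L\<close>; it is \<open>\<P>(\<complex>\<^sup>r / L)\<close>.\<close>

definition star_space :: "nat \<Rightarrow> (nat \<Rightarrow>\<^sub>0 complex) set \<Rightarrow> (nat \<Rightarrow>\<^sub>0 complex) set set" where
  "star_space r L = {M \<in> grass (Suc (cvs.dim L)) (row_vecs r). L \<subseteq> M}"

definition projection_from :: "(nat \<Rightarrow>\<^sub>0 complex) set \<Rightarrow> (nat \<Rightarrow>\<^sub>0 complex) set \<Rightarrow> (nat \<Rightarrow>\<^sub>0 complex) set" where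
  "projection_from L p = cvs.span (L \<union> p)"

text \<open>An isomorphism of projective spaces \<open>\<P>(\<complex>\<^sup>r / L) \<rightarrow> \<P> \<Gamma>\<close> is a map induced by a linear
  isomorphism \<open>\<complex>\<^sup>r / L \<rightarrow> \<Gamma>\<close>, that is, by a linear map of \<open>\<complex>\<^sup>r\<close> onto \<open>\<Gamma>\<close> with
  kernel \<open>L\<close>.\<close>

definition proj_iso ::
  "nat \<Rightarrow> (nat \<Rightarrow>\<^sub>0 complex) set \<Rightarrow> nat cpoly set \<Rightarrow> ((nat \<Rightarrow>\<^sub>0 complex) set \<Rightarrow> nat cpoly set) \<Rightarrow> bool" where
  "proj_iso r L \<Gamma> \<gamma> \<longleftrightarrow> (\<exists>\<phi>. Vector_Spaces.linear cscale cscale \<phi> \<and>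
     {X \<in> row_vecs r. \<phi> X = 0} = L \<and> \<phi> ` row_vecs r = \<Gamma> \<and> \<gamma> = restrict (\<lambda>M. \<phi> ` M) (star_space r L))"

type_synonym grove =
  "nat cpoly set \<times> (nat \<Rightarrow>\<^sub>0 complex) set \<times> ((nat \<Rightarrow>\<^sub>0 complex) set \<Rightarrow> nat cpoly set)"

definition Grove ::
  "nat \<Rightarrow> nat \<Rightarrow> nat \<Rightarrow> nat \<Rightarrow> (nat \<Rightarrow> (nat \<Rightarrow>\<^sub>0 complex) set) \<Rightarrow> (nat \<Rightarrow> nat cpoly set) \<Rightarrow> grove set" where
  "Grove n d r s p Q = {(\<Gamma>, L, \<gamma>). \<exists>t<r.
     \<Gamma> \<in> grass (t + 1) (forms n d) \<and>
     L \<in> grass (r - (t + 1)) (row_vecs r) \<and>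
     proj_iso r L \<Gamma> \<gamma> \<and>
     (\<forall>i<s. \<forall>u\<in>\<Gamma>. vanishes_at u (Q i)) \<and>
     (\<forall>i<s. p i \<subseteq> L \<or> (\<forall>u \<in> \<gamma> (projection_from L (p i)) - {0}. vanishes_twice_at u (Q i)))}"

text \<open>A tuple \<open>[u\<^sub>1, \<dots>, u\<^sub>r]\<close> of forms is a finitely supported function on indices below \<open>r\<close>;
  \<open>comb r u\<close> is the map \<open>X \<mapsto> \<Sum>\<^sub>j X\<^sub>j u\<^sub>j\<close>.\<close>

definition comb :: "nat \<Rightarrow> (nat \<Rightarrow>\<^sub>0 nat cpoly) \<Rightarrow> (nat \<Rightarrow>\<^sub>0 complex) \<Rightarrow> nat cpoly" where
  "comb r u X = (\<Sum>j<r. cscale (lookup X j) (lookup u j))"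

definition is_matrix_of :: "nat \<Rightarrow> nat \<Rightarrow> (nat \<Rightarrow> (nat \<Rightarrow>\<^sub>0 complex) set) \<Rightarrow> (nat \<Rightarrow> (nat \<Rightarrow>\<^sub>0 complex)) \<Rightarrow> bool" where
  "is_matrix_of r s p A \<longleftrightarrow> (\<forall>i<s. A i \<in> row_vecs r - {0} \<and> p i = cvs.span {A i})"

definition Kspace ::
  "nat \<Rightarrow> nat \<Rightarrow> nat \<Rightarrow> nat \<Rightarrow> (nat \<Rightarrow> (nat \<Rightarrow>\<^sub>0 complex)) \<Rightarrow> (nat \<Rightarrow> nat cpoly set) \<Rightarrow> (nat \<Rightarrow>\<^sub>0 nat cpoly) set" where
  "Kspace n d r s A Q = {u. keys u \<subseteq> {..<r} \<and>
     (\<forall>j<r. lookup u j \<in> forms n d \<and> (\<forall>i<s. vanishes_at (lookup u j) (Q i))) \<and>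
     (\<forall>i<s. vanishes_twice_at (comb r u (A i)) (Q i))}"

definition grove_of :: "nat \<Rightarrow> (nat \<Rightarrow>\<^sub>0 nat cpoly) \<Rightarrow> grove" where
  "grove_of r u =
     (let L = {X \<in> row_vecs r. comb r u X = 0}
      in (cvs.span (lookup u ` {..<r}), L, restrict (\<lambda>M. comb r u ` M) (star_space r L)))"

text \<open>The dimension of \<open>Grove(p, Q)\<close> with its structure of a projective space \<open>\<P>(K)\<close>
  (see \<open>grove_of_image\<close> and \<open>grove_of_eq_iff\<close> below); it is \<open>-1\<close> if there are no groves. By
  \<open>grove_dim_eq\<close>, the choice of \<open>A\<close> is immaterial.\<close>

definition grove_dim ::
  "nat \<Rightarrow> nat \<Rightarrow> nat \<Rightarrow> nat \<Rightarrow> (nat \<Rightarrow> (nat \<Rightarrow>\<^sub>0 complex) set) \<Rightarrow> (nat \<Rightarrow> nat cpoly set) \<Rightarrow> int" where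
  "grove_dim n d r s p Q =
     int (tvs.dim (Kspace n d r s (SOME A. is_matrix_of r s p A) Q)) - 1"

section \<open>Justification of the definitions\<close>

text \<open>The topologies live on the intended spaces, and \<open>grove_of\<close> induces a bijection of
  \<open>\<P>(K)\<close> with \<open>Grove(p, Q)\<close>.\<close>

lemma subspace_row_vecs: "cvs.subspace (row_vecs r)"
proof -
  have eq: "row_vecs r = {X. \<forall>j. \<not> j < r \<longrightarrow> lookup X j = 0}"
    by (auto simp: row_vecs_def in_keys_iff subset_iff)
  show ?thesis unfolding eq cvs.subspace_def by (simp add: lookup_add)
qed

lemma row_vecs_span: "row_vecs r = cvs.span ((\<lambda>j. single j 1) ` {..<r})"
proof
  show "row_vecs r \<subseteq> cvs.span ((\<lambda>j. single j 1) ` {..<r})"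
  proof
    fix X :: "nat \<Rightarrow>\<^sub>0 complex" assume X: "X \<in> row_vecs r"
    have "X = (\<Sum>j<r. cscale (lookup X j) (single j 1))"
      using X by (intro poly_mapping_eqI)
        (auto simp: lookup_sum lookup_single when_def row_vecs_def in_keys_iff if_distrib cong: if_cong)
    also have "\<dots> \<in> cvs.span ((\<lambda>j. single j 1) ` {..<r})"
      by (intro cvs.span_sum cvs.span_scale cvs.span_base) auto
    finally show "X \<in> cvs.span ((\<lambda>j. single j 1) ` {..<r})" .
  qed
  show "cvs.span ((\<lambda>j. single j 1) ` {..<r}) \<subseteq> row_vecs r"
    by (rule cvs.span_minimal[OF _ subspace_row_vecs]) (auto simp: row_vecs_def)
qed

lemma dim_row_vecs: "cvs.dim (row_vecs r) = r"
proof -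
  have inj: "inj_on (\<lambda>j. single j (1::complex)) {..<r}"
    by (intro inj_onI) (metis lookup_single_eq lookup_single_not_eq zero_neq_one)
  have "cvs.independent ((\<lambda>j. single j (1::complex)) ` {..<r})"
  proof (rule cvs.independent_if_scalars_zero)
    fix f x assume s: "(\<Sum>x\<in>(\<lambda>j. single j 1) ` {..<r}. cscale (f x) x) = 0" and x: "x \<in> (\<lambda>j. single j (1::complex)) ` {..<r}"
    then obtain j where j: "j < r" "x = single j 1" by auto
    have "0 = lookup (\<Sum>k<r. cscale (f (single k 1)) (single k 1)) j"
      using s by (simp add: sum.reindex[OF inj])
    also have "\<dots> = f x" using j by (simp add: lookup_sum lookup_single when_def if_distrib cong: if_cong)
    finally show "f x = 0" by simp
  qed simp
  then show ?thesis
    by (simp add: row_vecs_span cvs.dim_eq_card_independent card_image[OF inj])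
qed

lemma rank_nullity:
  fixes \<phi> :: "(nat \<Rightarrow>\<^sub>0 complex) \<Rightarrow> nat cpoly"
  assumes lin: "Vector_Spaces.linear cscale cscale \<phi>"
  shows "cvs.dim {X \<in> row_vecs r. \<phi> X = 0} + cvs.dim (\<phi> ` row_vecs r) = r"
proof -
  interpret l: Vector_Spaces.linear cscale cscale \<phi> by fact
  define N where "N = {X \<in> row_vecs r. \<phi> X = 0}"
  have subN: "cvs.subspace N" using subspace_row_vecs[of r]
    unfolding N_def cvs.subspace_def by (auto simp: l.add l.scale)
  obtain B where B: "B \<subseteq> N" "cvs.independent B" "N \<subseteq> cvs.span B"
    using cvs.maximal_independent_subset by blast
  have NR: "N \<subseteq> row_vecs r" by (auto simp: N_def)
  obtain C where C: "B \<subseteq> C" "C \<subseteq> row_vecs r" "cvs.independent C" "row_vecs r \<subseteq> cvs.span C"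
    using cvs.maximal_independent_subset_extend[of B "row_vecs r"] B NR by (metis order_trans)
  have finC: "finite C"
    by (rule conjunct1[OF cvs.independent_span_bound[of "(\<lambda>j. single j 1) ` {..<r}"]])
      (use C row_vecs_span in auto)
  have spC: "cvs.span C = row_vecs r" using C cvs.span_minimal[OF _ subspace_row_vecs] by blast
  have cC: "card C = r" using dim_row_vecs C(3) cvs.dim_eq_card_independent cvs.dim_span spC by metis
  have spB: "cvs.span B = N" using B cvs.span_minimal[OF _ subN] by blast
  have cB: "card B = cvs.dim N" using B(2) spB by (metis cvs.dim_eq_card_independent cvs.dim_span)
  have inj: "inj_on \<phi> (cvs.span (C - B))"
  proof (subst l.inj_on_iff_eq_0[OF cvs.subspace_span], intro ballI impI)
    fix x assume x: "x \<in> cvs.span (C - B)" "\<phi> x = 0"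
    have "x \<in> row_vecs r" using x(1) spC cvs.span_mono[of "C - B" C] by auto
    then have xB: "x \<in> cvs.span B" using x spB N_def by auto
    have "cvs.representation C x b = 0" for b
      using cvs.representation_extend[OF C(3) xB C(1)] cvs.representation_extend[OF C(3) x(1)]
        cvs.representation_ne_zero[of B x b] cvs.representation_ne_zero[of "C - B" x b] by fastforce
    then show "x = 0"
      using cvs.sum_nonzero_representation_eq[OF C(3), of x] spC \<open>x \<in> row_vecs r\<close> by simp
  qed
  have ind: "cvs.independent (\<phi> ` (C - B))"
    by (rule l.independent_injective_image[OF cvs.independent_mono[OF C(3)] inj]) auto
  have im: "\<phi> ` row_vecs r = cvs.span (\<phi> ` (C - B))"
  proof -
    have "\<phi> ` row_vecs r = cvs.span (\<phi> ` C)" using l.span_image[of C] spC by simp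
    also have "\<phi> ` C \<subseteq> insert 0 (\<phi> ` (C - B))" using B(1) N_def by auto
    then have "cvs.span (\<phi> ` C) \<subseteq> cvs.span (\<phi> ` (C - B))"
      using cvs.span_mono cvs.span_insert_0 by metis
    then have "cvs.span (\<phi> ` C) = cvs.span (\<phi> ` (C - B))"
      by (meson Diff_subset cvs.span_mono image_mono subset_antisym)
    finally show ?thesis .
  qed
  have "cvs.dim (\<phi> ` row_vecs r) = card (\<phi> ` (C - B))"
    using im ind by (simp add: cvs.dim_eq_card_independent)
  also have "\<dots> = card (C - B)"
    using inj by (meson card_image cvs.span_superset inj_on_subset)
  finally show ?thesis using cC cB finC C(1) card_mono[OF finC C(1)]
    unfolding N_def[symmetric] by (simp add: card_Diff_subset finite_subset)
qed

lemma linear_comb: "Vector_Spaces.linear cscale cscale (comb r u)"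
  unfolding Vector_Spaces.linear_iff
  by (auto simp: cvs.vector_space_axioms comb_def lookup_add cvs.scale_left_distrib sum.distrib cvs.scale_sum_right)


lemma comb_row_vecs:
  assumes lin: "Vector_Spaces.linear cscale cscale \<phi>" and X: "X \<in> row_vecs r"
    and u: "\<And>j. j < r \<Longrightarrow> lookup u j = \<phi> (single j 1)"
  shows "comb r u X = \<phi> X"
proof -
  interpret l: Vector_Spaces.linear cscale cscale \<phi> by fact
  have "X = (\<Sum>j<r. cscale (lookup X j) (single j 1))"
    using X by (intro poly_mapping_eqI)
      (auto simp: lookup_sum lookup_single when_def row_vecs_def in_keys_iff if_distrib cong: if_cong)
  then have "\<phi> X = \<phi> (\<Sum>j<r. cscale (lookup X j) (single j 1))" by simp
  then show ?thesis by (simp add: comb_def l.sum l.scale u)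
qed

lemma comb_single: "j < r \<Longrightarrow> comb r u (single j 1) = lookup u j"
  by (simp add: comb_def lookup_single when_def if_distrib[of "\<lambda>c. cscale c _"] cong: if_cong)

lemma comb_image: "comb r u ` row_vecs r = cvs.span (lookup u ` {..<r})"
proof -
  interpret l: Vector_Spaces.linear cscale cscale "comb r u" by (rule linear_comb)
  show ?thesis unfolding row_vecs_span l.span_image[symmetric] image_image
    by (rule arg_cong[of _ _ cvs.span], rule image_cong) (auto simp: comb_single simp del: One_nat_def)
qed

lemma subspace_forms: "cvs.subspace (forms n d)"
proof -
  define M where "M = {m :: nat \<Rightarrow>\<^sub>0 nat. (\<Sum>v\<in>keys m \<inter> UNIV. lookup m v) = d \<and> keys m \<subseteq> {..n}}"
  have eq: "forms n d = {F. \<forall>m. m \<notin> M \<longrightarrow> lookup F m = 0}"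
    unfolding forms_def homogeneous_on_def vars_def M_def UN_subset_iff
      not_in_keys_iff_lookup_eq_zero[symmetric] by blast
  show ?thesis unfolding eq cvs.subspace_def by (simp add: lookup_add)
qed

lemma eval_poly_supset:
  assumes "finite M" "keys F \<subseteq> M"
  shows "eval_poly F x = (\<Sum>m\<in>M. lookup F m * (\<Prod>v\<in>keys m. x v ^ lookup m v))"
  unfolding eval_poly_def by (rule sum.mono_neutral_left) (use assms in \<open>auto simp: in_keys_iff\<close>)

lemma eval_poly_add: "eval_poly (F + G) x = eval_poly F x + eval_poly G x"
  using eval_poly_supset[of "keys F \<union> keys G" F] eval_poly_supset[of "keys F \<union> keys G" G]
    eval_poly_supset[of "keys F \<union> keys G" "F + G"] keys_add[of F G]
  by (simp add: lookup_add ring_distribs sum.distrib)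

lemma eval_poly_cscale: "eval_poly (cscale c F) x = c * eval_poly F x"
  using eval_poly_supset[of "keys F" "cscale c F"] eval_poly_supset[of "keys F" F]
  by (simp add: sum_distrib_left mult.assoc subset_iff in_keys_iff)

lemma eval_poly_0 [simp]: "eval_poly 0 x = 0" by (simp add: eval_poly_def)

lemma partial_deriv_cscale: "partial_deriv v (cscale c F) = cscale c (partial_deriv v F)"
proof (cases "c = 0")
  case False
  then have "keys (cscale c F) = keys F" by (auto simp: in_keys_iff)
  then show ?thesis
    by (auto intro!: poly_mapping_eqI simp: partial_deriv_def cvs.scale_sum_right lookup_sum lookup_single when_def
        intro!: sum.cong)
qed (simp add: partial_deriv_def)

lemma subspace_vanishes_at: "cvs.subspace {u. vanishes_at u Q}"
  by (simp add: cvs.subspace_def vanishes_at_def eval_poly_add eval_poly_cscale)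

lemma vanishes_twice_at_0 [simp]: "vanishes_twice_at 0 Q"
  by (simp add: vanishes_twice_at_def vanishes_at_def partial_deriv_def)

lemma vanishes_twice_at_cscale: "vanishes_twice_at u Q \<Longrightarrow> vanishes_twice_at (cscale c u) Q"
  by (simp add: vanishes_twice_at_def vanishes_at_def partial_deriv_cscale eval_poly_cscale)

lemma span_insert_star_space:
  assumes L: "cvs.subspace L" "L \<subseteq> row_vecs r" and a: "a \<in> row_vecs r" "a \<notin> L"
  shows "cvs.span (insert a L) \<in> star_space r L"
proof -
  obtain B where B: "B \<subseteq> L" "cvs.independent B" "L \<subseteq> cvs.span B"
    using cvs.maximal_independent_subset by blast
  have spB: "cvs.span B = L" using B cvs.span_minimal[OF _ L(1)] by blast
  have finB: "finite B"
    by (rule conjunct1[OF cvs.independent_span_bound[of "(\<lambda>j. single j 1) ` {..<r}"]])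
      (use B L row_vecs_span in auto)
  have ind: "cvs.independent (insert a B)" using B(2) spB a(2) by (simp add: cvs.independent_insertI)
  have eq: "cvs.span (insert a L) = cvs.span (insert a B)"
    by (intro cvs.span_eq[THEN iffD2] conjI subsetI)
      (use spB B(1) in \<open>auto intro: cvs.span_base dest: subsetD[OF cvs.span_mono[OF subset_insertI]]\<close>)
  have "a \<notin> B" using a B by auto
  then have "cvs.dim (cvs.span (insert a L)) = Suc (card B)"
    unfolding eq using ind finB by (simp add: cvs.dim_eq_card_independent)
  moreover have "cvs.dim L = card B" using B(2) spB by (metis cvs.dim_eq_card_independent cvs.dim_span)
  moreover have "cvs.span (insert a L) \<subseteq> row_vecs r"
    by (rule cvs.span_minimal[OF _ subspace_row_vecs]) (use a L in auto)
  ultimately show ?thesis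
    unfolding star_space_def grass_def using cvs.span_superset[of "insert a L"] by auto
qed

lemma linear_span_insert_kernel:
  fixes \<phi> :: "(nat \<Rightarrow>\<^sub>0 complex) \<Rightarrow> nat cpoly"
  assumes lin: "Vector_Spaces.linear cscale cscale \<phi>" and L: "\<And>X. X \<in> L \<Longrightarrow> \<phi> X = 0"
  shows "\<phi> ` cvs.span (insert a L) = cvs.span {\<phi> a}"
proof -
  interpret l: Vector_Spaces.linear cscale cscale \<phi> by fact
  have "\<phi> ` insert a L = {\<phi> a} \<or> \<phi> ` insert a L = insert 0 {\<phi> a}" using L by auto
  then show ?thesis unfolding l.span_image[symmetric] by (metis cvs.span_insert_0)
qed

lemma is_grove_iff:
  fixes \<phi> :: "(nat \<Rightarrow>\<^sub>0 complex) \<Rightarrow> nat cpoly"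
  assumes A: "is_matrix_of r s p A" and lin: "Vector_Spaces.linear cscale cscale \<phi>"
    and L: "L = {X \<in> row_vecs r. \<phi> X = 0}" and \<gamma>: "\<gamma> = restrict (\<lambda>M. \<phi> ` M) (star_space r L)"
    and i: "i < s"
  shows "p i \<subseteq> L \<or> (\<forall>u \<in> \<gamma> (projection_from L (p i)) - {0}. vanishes_twice_at u (Q i)) \<longleftrightarrow>
    vanishes_twice_at (\<phi> (A i)) (Q i)"
proof -
  interpret l: Vector_Spaces.linear cscale cscale \<phi> by fact
  have Ai: "A i \<in> row_vecs r" "p i = cvs.span {A i}" using A i by (auto simp: is_matrix_of_def)
  have subL: "cvs.subspace L" using subspace_row_vecs[of r]
    unfolding L cvs.subspace_def by (auto simp: l.add l.scale)
  have pL: "p i \<subseteq> L \<longleftrightarrow> A i \<in> L"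
    unfolding Ai(2) using cvs.span_minimal[OF _ subL, of "{A i}"] cvs.span_base[of "A i" "{A i}"] by auto
  show ?thesis
  proof (cases "A i \<in> L")
    case True
    then show ?thesis using pL by (simp add: L)
  next
    case False
    have pr: "projection_from L (p i) = cvs.span (insert (A i) L)"
      unfolding projection_from_def Ai(2)
      by (intro cvs.span_eq[THEN iffD2] conjI subsetI)
        (use cvs.span_mono[of "{A i}" "insert (A i) L"] in \<open>auto intro: cvs.span_base\<close>)
    have "cvs.span (insert (A i) L) \<in> star_space r L"
      by (rule span_insert_star_space[OF subL]) (use False Ai L in auto)
    then have g: "\<gamma> (projection_from L (p i)) = cvs.span {\<phi> (A i)}"
      unfolding pr \<gamma> using linear_span_insert_kernel[OF lin, of L "A i"] L by auto
    show ?thesis unfolding g pL using False vanishes_twice_at_cscale[of "\<phi> (A i)"]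
        cvs.span_base[of "\<phi> (A i)" "{\<phi> (A i)}"]
      by (auto simp: cvs.span_singleton)
  qed
qed

lemma grove_of_image:
  assumes A: "is_matrix_of r s p A"
  shows "grove_of r ` (Kspace n d r s A Q - {0}) = Grove n d r s p Q"
proof (intro equalityI subsetI)
  fix g assume "g \<in> grove_of r ` (Kspace n d r s A Q - {0})"
  then obtain u where u: "u \<in> Kspace n d r s A Q" "u \<noteq> 0" "g = grove_of r u" by auto
  interpret l: Vector_Spaces.linear cscale cscale "comb r u" by (rule linear_comb)
  define \<Gamma> where "\<Gamma> = cvs.span (lookup u ` {..<r})"
  define L where "L = {X \<in> row_vecs r. comb r u X = 0}"
  define \<gamma> where "\<gamma> = restrict (\<lambda>M. comb r u ` M) (star_space r L)"
  have g: "g = (\<Gamma>, L, \<gamma>)" by (simp add: u(3) grove_of_def \<Gamma>_def L_def \<gamma>_def Let_def)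
  have subL: "cvs.subspace L" using subspace_row_vecs[of r]
    unfolding L_def cvs.subspace_def by (auto simp: l.add l.scale)
  have rn: "cvs.dim L + cvs.dim \<Gamma> = r"
    using rank_nullity[OF linear_comb, of r r u] by (simp add: comb_image L_def \<Gamma>_def)
  have "cvs.dim \<Gamma> \<noteq> 0"
  proof
    assume "cvs.dim \<Gamma> = 0"
    moreover obtain B where B: "B \<subseteq> lookup u ` {..<r}" "cvs.independent B" "cvs.span B = \<Gamma>"
      unfolding \<Gamma>_def by (metis cvs.maximal_independent_subset cvs.span_minimal cvs.span_span cvs.span_mono
          cvs.subspace_span subset_antisym)
    ultimately have "card B = 0" using cvs.dim_eq_card_independent cvs.dim_span by metis
    moreover have "finite B" using B(1) finite_surj by blast
    ultimately have "\<Gamma> = {0}" using B by simp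
    then have "lookup u j = 0" if "j < r" for j
      using that cvs.span_superset[of "lookup u ` {..<r}"] unfolding \<Gamma>_def by auto
    moreover have "lookup u j = 0" if "\<not> j < r" for j
      using that u(1) by (auto simp: Kspace_def in_keys_iff)
    ultimately have "u = 0" by (intro poly_mapping_eqI) (metis lookup_zero)
    then show False using u(2) by simp
  qed
  then obtain t where t: "cvs.dim \<Gamma> = t + 1" "cvs.dim L = r - (t + 1)" "t < r"
    using rn by (cases "cvs.dim \<Gamma>") auto
  have \<Gamma>f: "\<Gamma> \<subseteq> forms n d" unfolding \<Gamma>_def
    by (rule cvs.span_minimal[OF _ subspace_forms]) (use u in \<open>auto simp: Kspace_def\<close>)
  have van: "\<forall>i<s. \<forall>v\<in>\<Gamma>. vanishes_at v (Q i)"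
  proof (intro allI impI)
    fix i assume "i < s"
    then have "\<Gamma> \<subseteq> {v. vanishes_at v (Q i)}" unfolding \<Gamma>_def
      by (intro cvs.span_minimal[OF _ subspace_vanishes_at]) (use u in \<open>auto simp: Kspace_def\<close>)
    then show "\<forall>v\<in>\<Gamma>. vanishes_at v (Q i)" by auto
  qed
  have iso: "proj_iso r L \<Gamma> \<gamma>" unfolding proj_iso_def
    using linear_comb comb_image by (intro exI[of _ "comb r u"]) (auto simp: L_def \<Gamma>_def \<gamma>_def)
  have tw: "\<forall>i<s. p i \<subseteq> L \<or> (\<forall>v \<in> \<gamma> (projection_from L (p i)) - {0}. vanishes_twice_at v (Q i))"
    using is_grove_iff[OF A linear_comb L_def \<gamma>_def] u(1) by (simp add: Kspace_def)
  have "L \<in> grass (r - (t + 1)) (row_vecs r)" "\<Gamma> \<in> grass (t + 1) (forms n d)"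
    using t subL \<Gamma>f by (auto simp: grass_def L_def \<Gamma>_def)
  then show "g \<in> Grove n d r s p Q" unfolding g Grove_def using t(3) iso van tw by blast
next
  fix g assume "g \<in> Grove n d r s p Q"
  then obtain \<Gamma> L \<gamma> t where g: "g = (\<Gamma>, L, \<gamma>)" "t < r" "\<Gamma> \<in> grass (t + 1) (forms n d)"
     "L \<in> grass (r - (t + 1)) (row_vecs r)" "proj_iso r L \<Gamma> \<gamma>"
     and van: "\<forall>i<s. \<forall>u\<in>\<Gamma>. vanishes_at u (Q i)"
     and tw: "\<forall>i<s. p i \<subseteq> L \<or> (\<forall>u \<in> \<gamma> (projection_from L (p i)) - {0}. vanishes_twice_at u (Q i))"
    unfolding Grove_def by blast
  then obtain \<phi> where \<phi>: "Vector_Spaces.linear cscale cscale \<phi>"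
     "L = {X \<in> row_vecs r. \<phi> X = 0}" "\<phi> ` row_vecs r = \<Gamma>" "\<gamma> = restrict (\<lambda>M. \<phi> ` M) (star_space r L)"
    unfolding proj_iso_def by blast
  define u where "u = (\<Sum>j<r. single j (\<phi> (single j 1)))"
  have u: "lookup u j = (if j < r then \<phi> (single j 1) else 0)" for j
    by (simp add: u_def lookup_sum lookup_single when_def)
  have cu: "comb r u X = \<phi> X" if "X \<in> row_vecs r" for X
    using comb_row_vecs[OF \<phi>(1) that] u by simp
  have e: "single j 1 \<in> row_vecs r" if "j < r" for j using that by (simp add: row_vecs_def)
  have L: "L = {X \<in> row_vecs r. comb r u X = 0}" using \<phi>(2) cu by auto
  have \<Gamma>: "\<Gamma> = comb r u ` row_vecs r" using \<phi>(3) cu by auto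
  have \<gamma>: "\<gamma> = restrict (\<lambda>M. comb r u ` M) (star_space r L)"
    unfolding \<phi>(4) by (rule restrict_ext, rule image_cong) (auto simp: cu star_space_def grass_def)
  have gu: "g = grove_of r u"
    unfolding grove_of_def Let_def L[symmetric] \<gamma>[symmetric] comb_image[symmetric] \<Gamma>[symmetric] by (rule g(1))
  have "lookup u j \<in> \<Gamma>" if "j < r" for j using \<phi>(3) e[OF that] u that by auto
  then have "u \<in> Kspace n d r s A Q"
    using van tw is_grove_iff[OF A linear_comb L \<gamma>] g(3) u
    by (auto simp: Kspace_def grass_def in_keys_iff split: if_splits)
  moreover have "u \<noteq> 0"
  proof
    assume "u = 0"
    then have "\<Gamma> = {0}" using cvs.subspace_0[OF subspace_row_vecs] unfolding \<Gamma> by (auto simp: comb_def)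
    then have "cvs.dim \<Gamma> \<le> card ({} :: nat cpoly set)" by (intro cvs.dim_le_card) auto
    then show False using g(3) by (simp add: grass_def)
  qed
  ultimately show "g \<in> grove_of r ` (Kspace n d r s A Q - {0})" using gu by blast
qed

lemma grove_of_eq_iff:
  assumes "u \<in> Kspace n d r s A Q - {0}" "u' \<in> Kspace n d r s A Q - {0}"
  shows "grove_of r u = grove_of r u' \<longleftrightarrow> (\<exists>c. c \<noteq> 0 \<and> u' = tscale c u)"
proof
  interpret l: Vector_Spaces.linear cscale cscale "comb r u" by (rule linear_comb)
  interpret l': Vector_Spaces.linear cscale cscale "comb r u'" by (rule linear_comb)
  have supp: "j < r" if "lookup u j \<noteq> 0 \<or> lookup u' j \<noteq> 0" for j
    using that assms by (auto simp: Kspace_def in_keys_iff)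
  {
    assume eq: "grove_of r u = grove_of r u'"
    define L where "L = {X \<in> row_vecs r. comb r u X = 0}"
    have L': "L = {X \<in> row_vecs r. comb r u' X = 0}"
      and \<gamma>: "restrict (\<lambda>M. comb r u ` M) (star_space r L) = restrict (\<lambda>M. comb r u' ` M) (star_space r L)"
      using eq by (auto simp: grove_of_def Let_def L_def)
    have subL: "cvs.subspace L" using subspace_row_vecs[of r]
      unfolding L_def cvs.subspace_def by (auto simp: l.add l.scale)
    have ker: "comb r u X = 0 \<longleftrightarrow> comb r u' X = 0" if "X \<in> row_vecs r" for X
      using that L' L_def by auto
    have ex: "\<exists>c. comb r u' X = cscale c (comb r u X)" if X: "X \<in> row_vecs r" for X
    proof (cases "X \<in> L")
      case True
      then show ?thesis using L' L_def by auto
    next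
      case False
      have "cvs.span (insert X L) \<in> star_space r L"
        by (rule span_insert_star_space[OF subL]) (use False X L_def in auto)
      then have "comb r u ` cvs.span (insert X L) = comb r u' ` cvs.span (insert X L)"
        using fun_cong[OF \<gamma>, of "cvs.span (insert X L)"] by simp
      then have "cvs.span {comb r u X} = cvs.span {comb r u' X}"
        using linear_span_insert_kernel[OF linear_comb, of L r u X]
          linear_span_insert_kernel[OF linear_comb, of L r u' X] ker L_def by force
      then have "comb r u' X \<in> cvs.span {comb r u X}" by (simp add: cvs.span_base)
      then show ?thesis by (auto simp: cvs.span_singleton)
    qed
    obtain j where j: "lookup u j \<noteq> 0" using assms by (metis DiffD2 poly_mapping_eqI lookup_zero singletonI)
    define a where "a = single j (1::complex)"
    have a: "a \<in> row_vecs r" "comb r u a \<noteq> 0"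
      using j supp[of j] by (auto simp: a_def comb_single row_vecs_def)
    obtain c where c: "comb r u' a = cscale c (comb r u a)" using ex[OF a(1)] by auto
    have c0: "c \<noteq> 0" using c ker[OF a(1)] a(2) by auto
    have all: "comb r u' X = cscale c (comb r u X)" if X: "X \<in> row_vecs r" for X
    proof (cases "\<exists>k. comb r u X = cscale k (comb r u a)")
      case True
      then obtain k where k: "comb r u X = cscale k (comb r u a)" by auto
      have "X - cscale k a \<in> row_vecs r"
        using X a(1) subspace_row_vecs cvs.subspace_diff cvs.subspace_scale by blast
      moreover have "comb r u (X - cscale k a) = 0" by (simp add: l.diff l.scale k)
      ultimately have "comb r u' (X - cscale k a) = 0" using ker by blast
      then show ?thesis by (simp add: l'.diff l'.scale k c mult.commute)
    next
      case False
      obtain b where b: "comb r u' X = cscale b (comb r u X)" using ex[OF X] by auto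
      have "X + a \<in> row_vecs r" using X a(1) subspace_row_vecs cvs.subspace_add by blast
      then obtain e where "comb r u' (X + a) = cscale e (comb r u (X + a))" using ex by blast
      then have e: "cscale b (comb r u X) + cscale c (comb r u a) =
          cscale e (comb r u X) + cscale e (comb r u a)"
        by (simp add: l.add l'.add b c cvs.scale_right_distrib)
      then have e': "cscale (b - e) (comb r u X) = cscale (e - c) (comb r u a)"
        by (simp add: cvs.scale_left_diff_distrib algebra_simps)
      have be: "b = e"
      proof (rule ccontr)
        assume "b \<noteq> e"
        then have "comb r u X = cscale (1 / (b - e)) (cscale (b - e) (comb r u X))" by simp
        also have "\<dots> = cscale ((e - c) / (b - e)) (comb r u a)" unfolding e' by simp
        finally show False using False by blast
      qed
      then have "e = c" using e' a(2) by simp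
      then show ?thesis using b be by simp
    qed
    have "u' = tscale c u"
    proof (rule poly_mapping_eqI)
      fix k
      show "lookup u' k = lookup (tscale c u) k"
      proof (cases "k < r")
        case True
        then show ?thesis using all[of "single k 1"] by (simp add: comb_single row_vecs_def)
      next
        case False
        then show ?thesis using supp[of k] by (metis lookup_tscale cvs.scale_zero_right)
      qed
    qed
    then show "\<exists>c. c \<noteq> 0 \<and> u' = tscale c u" using c0 by blast
  }
  assume "\<exists>c. c \<noteq> 0 \<and> u' = tscale c u"
  then obtain c where c: "c \<noteq> 0" "u' = tscale c u" by auto
  have cu: "comb r u' X = cscale c (comb r u X)" for X
    by (simp add: comb_def c cvs.scale_sum_right mult.commute)
  have im: "comb r u' ` M = comb r u ` M" if "cvs.subspace M" for M
  proof -
    have "comb r u' X \<in> comb r u ` M" if "X \<in> M" for X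
      using that \<open>cvs.subspace M\<close> cu l.scale by (metis cvs.subspace_scale imageI)
    moreover have "comb r u X \<in> comb r u' ` M" if X: "X \<in> M" for X
    proof
      show "comb r u X = comb r u' (cscale (1 / c) X)" unfolding cu using c(1) by (simp add: l.scale)
      show "cscale (1 / c) X \<in> M" using X \<open>cvs.subspace M\<close> by (rule cvs.subspace_scale[rotated])
    qed
    ultimately show ?thesis by blast
  qed
  have ker: "{X \<in> row_vecs r. comb r u' X = 0} = {X \<in> row_vecs r. comb r u X = 0}"
    unfolding cu using c(1) by simp
  show "grove_of r u = grove_of r u'"
    unfolding grove_of_def Let_def ker comb_image[symmetric] im[OF subspace_row_vecs]
    by (simp, rule restrict_ext) (simp add: im star_space_def grass_def)
qed


lemma eval_poly_1 [simp]: "eval_poly 1 x = 1"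
  by (simp add: eval_poly_def)

lemma ex_basis:
  assumes "cvs.subspace \<Lambda>" "cvs.dim \<Lambda> > 0"
  shows "\<exists>vs. is_basis vs \<Lambda>"
proof -
  obtain B where B: "B \<subseteq> \<Lambda>" "cvs.independent B" "\<Lambda> \<subseteq> cvs.span B" "card B = cvs.dim \<Lambda>"
    using cvs.basis_exists by blast
  then have "cvs.span B = \<Lambda>" using cvs.span_minimal[OF _ assms(1)] by blast
  moreover obtain vs where "set vs = B" "distinct vs"
    using B(4) assms(2) finite_distinct_list by (metis card_gt_0_iff)
  ultimately show ?thesis unfolding is_basis_def using B by blast
qed

lemma topspace_zariski_grass:
  assumes "r > 0"
  shows "topspace (zariski_grass r W) = grass r W"
proof -
  have "homogeneous 0 (1 :: 'a list cpoly)" "vars (1 :: 'a list cpoly) \<subseteq> {I. length I = r}"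
    by (auto simp: homogeneous_on_def vars_def)
  then have "grass r W \<in> {{\<Lambda> \<in> grass r W. \<exists>vs. is_basis vs \<Lambda> \<and> eval_poly F (plucker r vs) \<noteq> 0} | F.
        (\<exists>k. homogeneous k F) \<and> vars F \<subseteq> {I. length I = r}}"
    using ex_basis assms by (intro CollectI exI[of _ 1]) (auto simp: grass_def)
  then show ?thesis unfolding zariski_grass_def topology_generated_by_topspace by blast
qed

lemma topspace_zariski_points: "topspace (zariski_points s W W') = point_tuples s W W'"
proof -
  have ne: "\<exists>a. a \<in> l - {0}" if "l \<in> proj V" for l V :: "('k \<Rightarrow>\<^sub>0 complex) set"
  proof (rule ccontr)
    assume "\<nexists>a. a \<in> l - {0}"
    then have "l \<subseteq> cvs.span {}" by auto
    then have "cvs.dim l \<le> card ({} :: ('k \<Rightarrow>\<^sub>0 complex) set)" by (intro cvs.dim_le_card) auto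
    then show False using that by (simp add: grass_def)
  qed
  have "multihomogeneous s (1 :: (nat \<times> 'a + nat \<times> 'b) cpoly)"
    by (auto simp: multihomogeneous_def homogeneous_on_def vars_def)
  moreover have "\<exists>a b. \<forall>i<s. a i \<in> p i - {0} \<and> b i \<in> Q i - {0}" if "(p, Q) \<in> point_tuples s W W'" for p Q
  proof -
    have "\<forall>i. \<exists>a. i < s \<longrightarrow> a \<in> p i - {0}" "\<forall>i. \<exists>b. i < s \<longrightarrow> b \<in> Q i - {0}"
      using ne PiE_mem[of p "{..<s}" "\<lambda>_. proj W"] PiE_mem[of Q "{..<s}" "\<lambda>_. proj W'"] that
      unfolding point_tuples_def mem_Times_iff fst_conv snd_conv by (metis lessThan_iff)+
    then show ?thesis by metis
  qed
  ultimately have "point_tuples s W W' \<in> {{(p, Q) \<in> point_tuples s W W'.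
         \<exists>a b. (\<forall>i<s. a i \<in> p i - {0} \<and> b i \<in> Q i - {0}) \<and>
           eval_poly F (case_sum (\<lambda>(i, j). lookup (a i) j) (\<lambda>(i, j). lookup (b i) j)) \<noteq> 0} | F.
        multihomogeneous s F}"
    by (intro CollectI exI[of _ 1]) auto
  then show ?thesis unfolding zariski_points_def topology_generated_by_topspace by blast
qed

lemma vanishes_twice_scaled:
  assumes "\<And>i. i < s \<Longrightarrow> \<exists>c. c \<noteq> 0 \<and> A' i = cscale c (A i)"
  shows "Kspace n d r s A Q \<subseteq> Kspace n d r s A' Q"
proof
  fix u assume u: "u \<in> Kspace n d r s A Q"
  have "vanishes_twice_at (comb r u (A' i)) (Q i)" if i: "i < s" for i
  proof -
    interpret l: Vector_Spaces.linear cscale cscale "comb r u" by (rule linear_comb)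
    from assms[OF i] obtain c where "A' i = cscale c (A i)" by auto
    then show ?thesis using u i by (auto simp: Kspace_def l.scale intro: vanishes_twice_at_cscale)
  qed
  then show "u \<in> Kspace n d r s A' Q" using u by (auto simp: Kspace_def)
qed

lemma is_matrix_of_scaled:
  assumes "is_matrix_of r s p A" "is_matrix_of r s p A'" "i < s"
  shows "\<exists>c. c \<noteq> 0 \<and> A' i = cscale c (A i)"
proof -
  have "cvs.span {A i} = cvs.span {A' i}" "A' i \<noteq> 0" using assms by (auto simp: is_matrix_of_def)
  then have "A' i \<in> cvs.span {A i}" by (simp add: cvs.span_base)
  then obtain c where "A' i = cscale c (A i)" by (auto simp: cvs.span_singleton)
  then show ?thesis using \<open>A' i \<noteq> 0\<close> by auto
qed

lemma grove_dim_eq: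
  assumes A: "is_matrix_of r s p A"
  shows "grove_dim n d r s p Q = int (tvs.dim (Kspace n d r s A Q)) - 1"
proof -
  have A': "is_matrix_of r s p (SOME A. is_matrix_of r s p A)" using someI[of "is_matrix_of r s p", OF A] .
  have "Kspace n d r s A Q = Kspace n d r s (SOME A. is_matrix_of r s p A) Q"
    using vanishes_twice_scaled is_matrix_of_scaled[OF A A'] is_matrix_of_scaled[OF A' A]
    by (intro equalityI) blast+
  then show ?thesis by (simp add: grove_dim_def)
qed

lemma ex_is_matrix_of:
  assumes "p \<in> {..<s} \<rightarrow>\<^sub>E proj (row_vecs r)"
  shows "\<exists>A. is_matrix_of r s p A"
proof -
  have "\<exists>a. i < s \<longrightarrow> a \<in> row_vecs r - {0} \<and> p i = cvs.span {a}" for i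
  proof (cases "i < s")
    case True
    then have pi: "cvs.subspace (p i)" "p i \<subseteq> row_vecs r" "cvs.dim (p i) = 1"
      using assms by (auto simp: grass_def dest!: PiE_mem)
    obtain B where B: "B \<subseteq> p i" "cvs.independent B" "p i \<subseteq> cvs.span B" "card B = cvs.dim (p i)"
      using cvs.basis_exists by blast
    then obtain a where a: "B = {a}" using pi(3) by (metis card_1_singletonE)
    have "p i = cvs.span {a}"
      using B(1,3) a cvs.span_minimal[OF _ pi(1), of "{a}"] by blast
    moreover have "a \<noteq> 0" "a \<in> row_vecs r"
      using B a pi cvs.dependent_zero by auto
    ultimately have "p i = cvs.span {a}" "a \<noteq> 0" "a \<in> row_vecs r" by auto
    then show ?thesis by blast
  qed simp
  then show ?thesis unfolding is_matrix_of_def by metis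
qed

end

theory Submission
  imports Defs
begin

text \<open>
  For \<open>y = (A, Q)\<close> put \<open>\<Psi>(y) = (\<Sum>\<^sub>i \<alpha>\<^sub>i\<^sub>1 Q\<^sub>i\<^sup>d, \<dots>, \<Sum>\<^sub>i \<alpha>\<^sub>i\<^sub>r Q\<^sub>i\<^sup>d)\<close>; the spans of the linearly independent tuples
  \<open>\<Psi>(y)\<close> have the same closure as \<open>\<Sigma>\<close>. Under the apolarity pairing \<open>S\<^sub>d\<close> is dual to the
  forms of degree \<open>d\<close>, with \<open>Q\<^sup>d\<close> acting as evaluation at \<open>Q\<close>; the space \<open>K\<close> is then
  the annihilator of the image of the differential of \<open>\<Psi>\<close> at \<open>y\<close>. So its dimension is
  \<open>r dim S\<^sub>d - \<rho>\<close> where that differential has its maximal rank \<open>\<rho>\<close>, and it remains to prove that the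
  closure of \<open>\<Sigma>\<close> has Krull dimension \<open>\<rho> - r\<^sup>2\<close>, the image of the differential containing the
  \<open>r\<^sup>2\<close> directions of the action of \<open>GL\<^sub>r\<close>.

  For this, restrict \<open>\<Psi>\<close> to a coordinate slice \<open>H\<close> through a general point, of dimension
  \<open>\<rho> - r\<^sup>2\<close> and transversal to the \<open>GL\<^sub>r\<close>-directions. A form in the Plucker coordinates that
  vanishes on \<open>H\<close> satisfies differential equations that force it to vanish everywhere, so \<open>H\<close> has a
  dense image. A chain of \<open>l + 1\<close> irreducible closed sets gives \<open>l + 1\<close> forms of the same degree without
  a homogeneous relation, hence polynomials on \<open>H\<close> with this property, and counting monomials gives
  \<open>l \<le> dim H\<close>. A flag of subslices of \<open>H\<close> gives a chain of this length: its inclusions are strict because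
  the differential of \<open>\<Psi>\<close> yields, on a subslice of dimension \<open>i\<close>, \<open>i + 1\<close> Plucker coordinates without a
  homogeneous relation, which is one more than a slice of dimension \<open>i - 1\<close> can have.
\<close>

section \<open>Indexed families of vectors\<close>

text \<open>Why K is the annihilator: the derivative of \<open>\<Psi>\<close> by \<alpha>_ij is
  Q_i^d in slot j, and its annihilation says u_j(Q_i) = 0. The derivative by the v-th coordinate of
  Q_i is, in every slot j, \<alpha>_ij times the v-derivative of Q_i^d, and its annihilation says
  that the v-th partial derivative of the sum of the \<alpha>_ij u_j vanishes at Q_i. The obstacle
  is that Krull dimension is defined by chains of closed sets, whereas the rank belongs to a
  differential. Homogeneous relations mediate: Plucker coordinates are defined only up to a common
  factor, so l + 1 forms without a homogeneous relation stand for l independent functions.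
  Characteristic 0 enters where a polynomial is recovered from its derivatives and where multinomial
  coefficients are inverted. The Grassmannian is the image of the parametrization by all r-tuples
  and gets its dimension from the same theorem. With N = dim S_d the r^2 cancels: (rN - r^2) -
  (\<rho> - r^2) = dim K. Independence of the powers is a nonempty open condition because s \<le> N,
  so it does not affect the closure of \<Sigma>.\<close>

lemma underdetermined_system:
  fixes M :: "'a \<Rightarrow> 's \<Rightarrow> complex"
  assumes "finite S" "finite A" "card S < card A"
  shows "\<exists>c. (\<exists>a\<in>A. c a \<noteq> 0) \<and> (\<forall>s\<in>S. (\<Sum>a\<in>A. c a * M a s) = 0)"
  using assms
proof (induction S arbitrary: A M rule: finite_induct)
  case empty
  then have "A \<noteq> {}" by auto
  then show ?case by (intro exI[of _ "\<lambda>_. 1"]) auto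
next
  case (insert s S)
  show ?case
  proof (cases "\<forall>a\<in>A. M a s = 0")
    case True
    have "card S < card A" using insert by simp
    from insert.IH[OF insert.prems(1) this, of M] True show ?thesis by auto
  next
    case False
    then obtain a0 where a0: "a0 \<in> A" "M a0 s \<noteq> 0" by auto
    define A' where "A' = A - {a0}"
    have A': "finite A'" "card S < card A'" "A = insert a0 A'" "a0 \<notin> A'"
      using insert a0 by (auto simp: A'_def)
    obtain c where c: "\<exists>a\<in>A'. c a \<noteq> 0"
      "\<forall>t\<in>S. (\<Sum>a\<in>A'. c a * (M a t - M a s / M a0 s * M a0 t)) = 0"
      using insert.IH[OF A'(1,2), of "\<lambda>a t. M a t - M a s / M a0 s * M a0 t"] by auto
    \<comment> \<open>The induction hypothesis is applied to the rows after elimination with the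
      pivot \<open>M a0 s\<close>; \<open>x\<close> is the coefficient of \<open>a0\<close> that
      satisfies equation \<open>s\<close>, and the other equations follow.\<close>
    define x where "x = - (\<Sum>a\<in>A'. c a * M a s) / M a0 s"
    define c' where "c' = c(a0 := x)"
    have sum: "(\<Sum>a\<in>A. c' a * M a t) = x * M a0 t + (\<Sum>a\<in>A'. c a * M a t)" for t
    proof -
      have "(\<Sum>a\<in>A'. c' a * M a t) = (\<Sum>a\<in>A'. c a * M a t)"
        by (rule sum.cong) (use A' in \<open>auto simp: c'_def\<close>)
      then show ?thesis using A' by (simp add: c'_def)
    qed
    have "(\<Sum>a\<in>A. c' a * M a s) = 0" unfolding sum using a0(2) by (simp add: x_def)
    moreover have "(\<Sum>a\<in>A. c' a * M a t) = 0" if "t \<in> S" for t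
    proof -
      have "(\<Sum>a\<in>A'. c a * M a t) - (\<Sum>a\<in>A'. c a * M a s) / M a0 s * M a0 t = 0"
        using c(2) that
        by (simp add: right_diff_distrib sum_subtractf sum_distrib_right sum_divide_distrib mult.assoc)
      then show ?thesis unfolding sum x_def by (simp add: algebra_simps)
    qed
    moreover have "\<exists>a\<in>A. c' a \<noteq> 0" using c(1) A' by (auto simp: c'_def)
    ultimately show ?thesis by auto
  qed
qed

text \<open>Indexed families rather than sets: the vectors will depend on a parameter, and where two
  members of the family coincide it has to count as dependent. The vectors are functions on an
  arbitrary, possibly infinite, index type.\<close>

definition fam_indep :: "'k set \<Rightarrow> ('k \<Rightarrow> 'x \<Rightarrow> complex) \<Rightarrow> bool" where
  "fam_indep K X \<longleftrightarrow> (\<forall>c. (\<forall>x. (\<Sum>k\<in>K. c k * X k x) = 0) \<longrightarrow> (\<forall>k\<in>K. c k = 0))"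

definition fam_span :: "'k set \<Rightarrow> ('k \<Rightarrow> 'x \<Rightarrow> complex) \<Rightarrow> ('x \<Rightarrow> complex) set" where
  "fam_span K X = {f. \<exists>c. \<forall>x. f x = (\<Sum>k\<in>K. c k * X k x)}"

lemma fam_indepD: "fam_indep K X \<Longrightarrow> (\<And>x. (\<Sum>k\<in>K. c k * X k x) = 0) \<Longrightarrow> k \<in> K \<Longrightarrow> c k = 0"
  unfolding fam_indep_def by blast

lemma fam_spanI: "(\<And>x. f x = (\<Sum>k\<in>K. c k * X k x)) \<Longrightarrow> f \<in> fam_span K X"
  unfolding fam_span_def by blast

lemma fam_indep_cong:
  assumes "\<And>k. k \<in> K \<Longrightarrow> X k = Y k"
  shows "fam_indep K X \<longleftrightarrow> fam_indep K Y"
proof -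
  have "(\<Sum>k\<in>K. c k * X k x) = (\<Sum>k\<in>K. c k * Y k x)" for c x
    by (rule sum.cong) (simp_all add: assms)
  then show ?thesis unfolding fam_indep_def by simp
qed

lemma fam_span_base:
  assumes "finite K" "k \<in> K"
  shows "X k \<in> fam_span K X"
  unfolding fam_span_def using assms
  by (auto intro!: exI[of _ "\<lambda>l. if l = k then 1 else 0"] simp: if_distrib[of "\<lambda>c. c * _"] cong: if_cong)

lemma fam_span_trans:
  assumes "finite K" "\<And>k. k \<in> K \<Longrightarrow> X k \<in> fam_span L Y" "f \<in> fam_span K X"
  shows "f \<in> fam_span L Y"
proof -
  obtain c where c: "\<And>x. f x = (\<Sum>k\<in>K. c k * X k x)" using assms(3) by (auto simp: fam_span_def)
  have "\<forall>k. \<exists>e. k \<in> K \<longrightarrow> (\<forall>x. X k x = (\<Sum>l\<in>L. e l * Y l x))"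
    using assms(2) by (auto simp: fam_span_def)
  then obtain e where e: "\<And>k x. k \<in> K \<Longrightarrow> X k x = (\<Sum>l\<in>L. e k l * Y l x)" by metis
  have "f x = (\<Sum>l\<in>L. (\<Sum>k\<in>K. c k * e k l) * Y l x)" for x
  proof -
    have "f x = (\<Sum>k\<in>K. \<Sum>l\<in>L. c k * e k l * Y l x)"
      unfolding c by (rule sum.cong) (simp_all add: e sum_distrib_left mult.assoc)
    also have "\<dots> = (\<Sum>l\<in>L. (\<Sum>k\<in>K. c k * e k l) * Y l x)"
      by (subst sum.swap) (simp add: sum_distrib_right)
    finally show ?thesis .
  qed
  then show ?thesis by (rule fam_spanI)
qed

text \<open>If there were more vectors than spanning ones, their coefficient vectors would satisfy a
  nontrivial linear relation, which passes to the vectors themselves.\<close>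

lemma fam_indep_card_le:
  assumes "finite L" "finite K" "fam_indep K X" "\<And>k. k \<in> K \<Longrightarrow> X k \<in> fam_span L Y"
  shows "card K \<le> card L"
proof (rule ccontr)
  assume "\<not> card K \<le> card L"
  have "\<forall>k. \<exists>e. k \<in> K \<longrightarrow> (\<forall>x. X k x = (\<Sum>l\<in>L. e l * Y l x))"
    using assms(4) by (auto simp: fam_span_def)
  then obtain e where e: "\<And>k x. k \<in> K \<Longrightarrow> X k x = (\<Sum>l\<in>L. e k l * Y l x)" by metis
  obtain c where c: "\<exists>k\<in>K. c k \<noteq> 0" "\<forall>l\<in>L. (\<Sum>k\<in>K. c k * e k l) = 0"
    using underdetermined_system[OF assms(1,2), of e] \<open>\<not> card K \<le> card L\<close> by auto
  have "(\<Sum>k\<in>K. c k * X k x) = 0" for x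
  proof -
    have "(\<Sum>k\<in>K. c k * X k x) = (\<Sum>k\<in>K. \<Sum>l\<in>L. c k * e k l * Y l x)"
      by (rule sum.cong) (simp_all add: e sum_distrib_left mult.assoc)
    also have "\<dots> = (\<Sum>l\<in>L. (\<Sum>k\<in>K. c k * e k l) * Y l x)"
      by (subst sum.swap) (simp add: sum_distrib_right)
    finally show ?thesis using c(2) by simp
  qed
  then show False using fam_indepD[OF assms(3), of c] c(1) by blast
qed

lemma fam_indep_mono:
  assumes "fam_indep K X" "L \<subseteq> K" "finite K"
  shows "fam_indep L X"
  unfolding fam_indep_def
proof (intro allI impI ballI)
  fix c l assume c: "\<forall>x. (\<Sum>k\<in>L. c k * X k x) = 0" and l: "l \<in> L"
  have "(\<Sum>k\<in>K. (if k \<in> L then c k else 0) * X k x) = (\<Sum>k\<in>L. c k * X k x)" for x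
    using assms by (simp add: if_distrib[of "\<lambda>c. c * _"] sum.inter_restrict[symmetric] Int_absorb1 cong: if_cong)
  then have "(\<Sum>k\<in>K. (if k \<in> L then c k else 0) * X k x) = 0" for x using c by simp
  from fam_indepD[OF assms(1) this, of l] l assms show "c l = 0" by auto
qed

lemma fam_indep_insert:
  assumes "finite K" "fam_indep K X" "X k \<notin> fam_span K X"
  shows "fam_indep (insert k K) X"
  unfolding fam_indep_def
proof (intro allI impI)
  have k: "k \<notin> K" using assms fam_span_base by metis
  fix c assume c: "\<forall>x. (\<Sum>k\<in>insert k K. c k * X k x) = 0"
  have ck: "c k = 0"
  proof (rule ccontr)
    assume "c k \<noteq> 0"
    have "X k x = (\<Sum>l\<in>K. (- c l / c k) * X l x)" for x
    proof -
      have "c k * X k x = - (\<Sum>l\<in>K. c l * X l x)"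
        using c assms(1) k by (simp add: eq_neg_iff_add_eq_0)
      then have "X k x = - (\<Sum>l\<in>K. c l * X l x) / c k" using \<open>c k \<noteq> 0\<close> by (simp add: field_simps)
      then show ?thesis by (simp add: sum_divide_distrib sum_negf)
    qed
    then show False using assms(3) fam_spanI[of "X k" "\<lambda>l. - c l / c k" X K] by blast
  qed
  then have "(\<Sum>k\<in>K. c k * X k x) = 0" for x using c assms(1) k by simp
  then show "\<forall>k\<in>insert k K. c k = 0" using ck fam_indepD[OF assms(2)] by blast
qed

text \<open>An independent subfamily of greatest size above \<open>K1\<close> spans, because a
  vector outside its span could be added.\<close>

lemma fam_indep_extend:
  assumes "finite K" "K1 \<subseteq> K" "fam_indep K1 X"
  shows "\<exists>K0. K1 \<subseteq> K0 \<and> K0 \<subseteq> K \<and> fam_indep K0 X \<and> (\<forall>k\<in>K. X k \<in> fam_span K0 X)"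
proof -
  define P where "P L \<longleftrightarrow> K1 \<subseteq> L \<and> L \<subseteq> K \<and> fam_indep L X" for L
  have "P K1" "\<forall>L. P L \<longrightarrow> card L < Suc (card K)"
    using assms by (auto simp: P_def card_mono less_Suc_eq_le)
  then obtain L where L: "P L" "\<forall>L'. P L' \<longrightarrow> card L' \<le> card L"
    using ex_has_greatest_nat[of P K1 card "Suc (card K)"] by auto
  have fin: "finite L" using L assms finite_subset by (auto simp: P_def)
  have "X k \<in> fam_span L X" if k: "k \<in> K" for k
  proof (rule ccontr)
    assume *: "X k \<notin> fam_span L X"
    then have "k \<notin> L" using fam_span_base[OF fin] by blast
    moreover have "P (insert k L)" using fam_indep_insert[OF fin _ *] L k by (auto simp: P_def)
    ultimately show False using L(2) fin by fastforce
  qed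
  then show ?thesis using L by (auto simp: P_def)
qed

text \<open>With the converse below, independence becomes the non-vanishing of a determinant. This
  is polynomial in the entries, so independence at one parameter spreads to an open set of
  parameters.\<close>

lemma fam_indep_if_minor:
  fixes v :: "nat \<Rightarrow> 'x \<Rightarrow> complex"
  assumes "Determinant.det (Matrix.mat r r (\<lambda>(i, j). v i (f j))) \<noteq> 0"
  shows "fam_indep {..<r} v"
  unfolding fam_indep_def
proof (intro allI impI ballI)
  fix c i assume c: "\<forall>x. (\<Sum>k<r. c k * v k x) = 0" and i: "i \<in> {..<r}"
  let ?M = "Matrix.mat r r (\<lambda>(i, j). v i (f j))"
  have "transpose_mat ?M *\<^sub>v vec r c = 0\<^sub>v r"
    by (rule eq_vecI) (use c in \<open>auto simp: scalar_prod_def mult.commute atLeast0LessThan\<close>)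
  moreover have "Determinant.det (transpose_mat ?M) \<noteq> 0"
    using assms det_transpose[of ?M r] by simp
  ultimately have "vec r c = 0\<^sub>v r"
    using det_0_iff_vec_prod_zero[of "transpose_mat ?M" r] vec_carrier[of r c]
    by (metis mat_carrier transpose_carrier_mat)
  then show "c i = 0" using i by (metis index_vec index_zero_vec(1) lessThan_iff)
qed

text \<open>Expand the minors that extend a nonzero minor \<open>J\<close> of the first
  \<open>r\<close> vectors by one column \<open>m\<close>, along that column. If all of them
  vanished, the expansions would be a linear relation in which the last vector has the minor at
  \<open>J\<close> as coefficient.\<close>

lemma ex_minor_if_fam_indep:
  fixes v :: "nat \<Rightarrow> 'x \<Rightarrow> complex"
  assumes "fam_indep {..<r} v"
  shows "\<exists>I. length I = r \<and> Determinant.det (Matrix.mat r r (\<lambda>(i, j). v i (I ! j))) \<noteq> 0"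
  using assms
proof (induction r)
  case 0
  then show ?case by (intro exI[of _ "[]"]) simp
next
  case (Suc r)
  have "fam_indep {..<r} v" by (rule fam_indep_mono[OF Suc.prems]) auto
  then obtain J where J: "length J = r" "Determinant.det (Matrix.mat r r (\<lambda>(i, j). v i (J ! j))) \<noteq> 0"
    using Suc.IH by auto
  let ?A = "\<lambda>m. Matrix.mat (Suc r) (Suc r) (\<lambda>(i, j). v i ((J @ [m]) ! j))"
  \<comment> \<open>Cofactors along the last column do not see its entries, so any index may be put
    there.\<close>
  let ?C = "\<lambda>i. cofactor (?A undefined) i r"
  have cof: "cofactor (?A m) i r = ?C i" if "i < Suc r" for m i
  proof -
    have "mat_delete (?A m) i r = mat_delete (?A undefined) i r"
      by (rule eq_matI) (use that J in \<open>auto simp: mat_delete_def nth_append\<close>)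
    then show ?thesis by (simp add: cofactor_def)
  qed
  have det: "Determinant.det (?A m) = (\<Sum>i<Suc r. ?C i * v i m)" for m
  proof -
    have "Determinant.det (?A m) = (\<Sum>i<Suc r. ?A m $$ (i, r) * cofactor (?A m) i r)"
      by (rule laplace_expansion_column) auto
    also have "\<dots> = (\<Sum>i<Suc r. ?C i * v i m)"
      by (rule sum.cong) (use J in \<open>auto simp: cof nth_append simp del: cof cong: cof\<close>)
    finally show ?thesis .
  qed
  have "mat_delete (?A undefined) r r = Matrix.mat r r (\<lambda>(i, j). v i (J ! j))"
    by (rule eq_matI) (use J in \<open>auto simp: mat_delete_def nth_append\<close>)
  then have "?C r \<noteq> 0" using J by (simp add: cofactor_def)
  then obtain m where "Determinant.det (?A m) \<noteq> 0"
    using fam_indepD[OF Suc.prems, of ?C r] unfolding det by auto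
  then show ?case using J by (intro exI[of _ "J @ [m]"]) simp
qed

section \<open>Polynomial functions\<close>

text \<open>Composites, determinants and derivatives are formed on the level of functions, where
  they need no formal counterpart. The set \<open>V\<close> records which variables may occur; it
  matters for expansions in partial derivatives and for counting coefficients.\<close>

inductive poly_fun :: "'v set \<Rightarrow> (('v \<Rightarrow> complex) \<Rightarrow> complex) \<Rightarrow> bool" for V where
  const: "poly_fun V (\<lambda>_. c)"
| var: "v \<in> V \<Longrightarrow> poly_fun V (\<lambda>x. x v)"
| add: "poly_fun V f \<Longrightarrow> poly_fun V g \<Longrightarrow> poly_fun V (\<lambda>x. f x + g x)"
| mult: "poly_fun V f \<Longrightarrow> poly_fun V g \<Longrightarrow> poly_fun V (\<lambda>x. f x * g x)"

lemma poly_fun_sum: "(\<And>a. a \<in> A \<Longrightarrow> poly_fun V (f a)) \<Longrightarrow> poly_fun V (\<lambda>x. \<Sum>a\<in>A. f a x)"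
  by (induction A rule: infinite_finite_induct) (auto intro: poly_fun.intros)

lemma poly_fun_prod: "(\<And>a. a \<in> A \<Longrightarrow> poly_fun V (f a)) \<Longrightarrow> poly_fun V (\<lambda>x. \<Prod>a\<in>A. f a x)"
  by (induction A rule: infinite_finite_induct) (auto intro: poly_fun.intros)

lemma poly_fun_power: "poly_fun V f \<Longrightarrow> poly_fun V (\<lambda>x. f x ^ k)"
  by (induction k) (auto intro: poly_fun.intros)

lemma poly_fun_if: "(P \<Longrightarrow> poly_fun V f) \<Longrightarrow> (\<not> P \<Longrightarrow> poly_fun V g) \<Longrightarrow> poly_fun V (\<lambda>x. if P then f x else g x)"
  by (cases P) simp_all

lemma poly_fun_det:
  assumes "\<And>i j. i < r \<Longrightarrow> j < r \<Longrightarrow> poly_fun V (\<lambda>x. M x i j)"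
  shows "poly_fun V (\<lambda>x. Determinant.det (Matrix.mat r r (\<lambda>(i, j). M x i j)))"
proof -
  have "Determinant.det (Matrix.mat r r (\<lambda>(i, j). M x i j)) =
      (\<Sum>p\<in>{p. p permutes {0..<r}}. signof p * (\<Prod>i = 0..<r. M x i (p i)))" for x
    unfolding det_def'[OF mat_carrier]
    by (intro sum.cong arg_cong2[of _ _ _ _ "(*)"] prod.cong refl) (auto simp: permutes_in_image)
  moreover have "poly_fun V (\<lambda>x. \<Sum>p\<in>{p. p permutes {0..<r}}. signof p * (\<Prod>i = 0..<r. M x i (p i)))"
    by (intro poly_fun_sum poly_fun.mult poly_fun.const poly_fun_prod assms) (auto simp: permutes_in_image)
  ultimately show ?thesis by presburger
qed

lemma poly_fun_compose:
  assumes "poly_fun U f" "\<And>c. c \<in> U \<Longrightarrow> poly_fun V (\<lambda>y. \<Psi> y c)"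
  shows "poly_fun V (\<lambda>y. f (\<Psi> y))"
  using assms by (induction rule: poly_fun.induct) (auto intro: poly_fun.intros)

lemma poly_fun_cong: "poly_fun V f \<Longrightarrow> (\<And>v. v \<in> V \<Longrightarrow> x v = y v) \<Longrightarrow> f x = f y"
  by (induction rule: poly_fun.induct) auto

text \<open>Restriction to lines is where univariate polynomials enter: the finiteness of their
  roots gives the irreducibility of affine spaces, and their derivatives give directional
  derivatives.\<close>

lemma poly_fun_line: "poly_fun V f \<Longrightarrow> \<exists>p. \<forall>t. f (\<lambda>v. x v + t * u v) = poly p t"
proof (induction rule: poly_fun.induct)
  case (const c)
  show ?case by (intro exI[of _ "[:c:]"]) simp
next
  case (var v)
  show ?case by (intro exI[of _ "[:x v, u v:]"]) simp
next
  case (add f g)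
  then show ?case by (metis poly_add)
next
  case (mult f g)
  then show ?case by (metis poly_mult)
qed

text \<open>Joining the two points by a line reduces this to univariate polynomials.\<close>

lemma poly_fun_nonzero2:
  assumes "poly_fun V f" "poly_fun V g" "f x \<noteq> 0" "g y \<noteq> 0"
  shows "\<exists>t. f (\<lambda>v. x v + t * (y v - x v)) \<noteq> 0 \<and> g (\<lambda>v. x v + t * (y v - x v)) \<noteq> 0"
proof -
  obtain p q where pq: "\<And>t. f (\<lambda>v. x v + t * (y v - x v)) = poly p t"
    "\<And>t. g (\<lambda>v. x v + t * (y v - x v)) = poly q t"
    using poly_fun_line[OF assms(1), of x "\<lambda>v. y v - x v"] poly_fun_line[OF assms(2), of x "\<lambda>v. y v - x v"]
    by metis
  have "p \<noteq> 0" "q \<noteq> 0" using assms(3,4) pq(1)[of 0] pq(2)[of 1] by auto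
  then have "p * q \<noteq> 0" by simp
  then have "finite {t. poly (p * q) t = 0}" by (rule poly_roots_finite)
  then have "{t. poly (p * q) t = 0} \<noteq> UNIV" using infinite_UNIV_char_0[where 'a = complex] by metis
  then obtain t where "poly (p * q) t \<noteq> 0" by blast
  then show ?thesis using pq by (intro exI[of _ t]) auto
qed

section \<open>Coordinate slices and their irreducibility\<close>

definition slice :: "'v set \<Rightarrow> ('v \<Rightarrow> complex) \<Rightarrow> ('v \<Rightarrow> complex) set" where
  "slice V0 y0 = {y. \<forall>v. v \<notin> V0 \<longrightarrow> y v = y0 v}"

lemma slice_base [simp]: "y0 \<in> slice V0 y0"
  by (simp add: slice_def)

text \<open>A slice contains the line through any two of its points. Hence it is irreducible: two
  nonempty open subsets of it meet.\<close>

lemma poly_fun_slice_nonzero2: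
  assumes "poly_fun V f" "poly_fun V g" "x \<in> slice V0 y0" "y \<in> slice V0 y0" "f x \<noteq> 0" "g y \<noteq> 0"
  shows "\<exists>z\<in>slice V0 y0. f z \<noteq> 0 \<and> g z \<noteq> 0"
proof -
  obtain t where "f (\<lambda>v. x v + t * (y v - x v)) \<noteq> 0" "g (\<lambda>v. x v + t * (y v - x v)) \<noteq> 0"
    using poly_fun_nonzero2[of V f g x y] assms by auto
  moreover have "(\<lambda>v. x v + t * (y v - x v)) \<in> slice V0 y0" using assms(3,4) by (simp add: slice_def)
  ultimately show ?thesis by blast
qed

lemma slice_UNIV [simp]: "slice UNIV y0 = UNIV"
  by (simp add: slice_def)

lemma slice_mono: "V1 \<subseteq> V2 \<Longrightarrow> slice V1 y0 \<subseteq> slice V2 y0"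
  by (auto simp: slice_def)

section \<open>Directional derivatives of polynomial functions\<close>

definition dird :: "('v \<Rightarrow> complex) \<Rightarrow> (('v \<Rightarrow> complex) \<Rightarrow> complex) \<Rightarrow> ('v \<Rightarrow> complex) \<Rightarrow> complex" where
  "dird u f x = (THE d. ((\<lambda>t. f (\<lambda>v. x v + t * u v)) has_field_derivative d) (at 0))"

lemma dirdI: "((\<lambda>t. f (\<lambda>v. x v + t * u v)) has_field_derivative d) (at 0) \<Longrightarrow> dird u f x = d"
  unfolding dird_def by (rule the_equality) (auto intro: DERIV_unique)

lemma has_dird:
  assumes "poly_fun V f"
  shows "((\<lambda>t. f (\<lambda>v. x v + t * u v)) has_field_derivative dird u f x) (at 0)"
proof -
  obtain p where "\<forall>t. f (\<lambda>v. x v + t * u v) = poly p t"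
    using poly_fun_line[OF assms] by (rule exE)
  then have "((\<lambda>t. f (\<lambda>v. x v + t * u v)) has_field_derivative poly (pderiv p) 0) (at 0)"
    by (simp add: poly_DERIV)
  then show ?thesis using dirdI by metis
qed

text \<open>Along a fixed line, differentiation acts as \<open>pderiv\<close> on the restricted
  polynomial. The degree drops, which drives the induction in
  \<open>vanishing_all_orders\<close>.\<close>

lemma dird_line:
  assumes "\<And>t. f (\<lambda>v. x v + t * u v) = poly p t"
  shows "dird u f (\<lambda>v. x v + t * u v) = poly (pderiv p) t"
proof (rule dirdI)
  have "(\<lambda>h. f (\<lambda>v. x v + t * u v + h * u v)) = (\<lambda>h. poly p (t + h))"
    using assms[of "t + _"] by (simp add: algebra_simps)
  moreover have "((\<lambda>h. poly p (t + h)) has_field_derivative poly (pderiv p) t) (at 0)"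
    using poly_DERIV[of p "0 + t"] unfolding DERIV_shift by (simp add: add.commute)
  ultimately show "((\<lambda>h. f (\<lambda>v. x v + t * u v + h * u v)) has_field_derivative poly (pderiv p) t) (at 0)"
    by simp
qed

lemma dird_const [simp]: "dird u (\<lambda>_. c) x = 0"
  by (rule dirdI) simp

lemma dird_var [simp]: "dird u (\<lambda>x. x v) x = u v"
  by (rule dirdI) (auto intro!: derivative_eq_intros)

lemma dird_add:
  assumes "poly_fun V f" "poly_fun V g"
  shows "dird u (\<lambda>x. f x + g x) x = dird u f x + dird u g x"
  by (rule dirdI) (auto intro!: derivative_eq_intros has_dird assms)

lemma dird_mult:
  assumes "poly_fun V f" "poly_fun V g"
  shows "dird u (\<lambda>x. f x * g x) x = dird u f x * g x + f x * dird u g x"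
  by (rule dirdI) (use DERIV_mult[OF has_dird[OF assms(1), of x u] has_dird[OF assms(2), of x u]] in \<open>simp add: mult.commute\<close>)

lemma dird_cmult:
  assumes "poly_fun V f"
  shows "dird u (\<lambda>x. c * f x) x = c * dird u f x"
  using dird_mult[OF poly_fun.const assms] by simp

lemma dird_sum:
  assumes "\<And>a. a \<in> A \<Longrightarrow> poly_fun V (f a)"
  shows "dird u (\<lambda>x. \<Sum>a\<in>A. f a x) x = (\<Sum>a\<in>A. dird u (f a) x)"
  using assms
proof (induction A rule: infinite_finite_induct)
  case (insert a A)
  then show ?case using dird_add[of V "f a" "\<lambda>x. \<Sum>a\<in>A. f a x"] poly_fun_sum[of A V f] by simp
qed simp_all

lemma poly_fun_dird: "poly_fun V f \<Longrightarrow> poly_fun V (dird u f)"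
proof (induction rule: poly_fun.induct)
  case (const c)
  have "dird u (\<lambda>_. c) = (\<lambda>_. 0)" by (rule ext) simp
  then show ?case by (simp add: poly_fun.const)
next
  case (var v)
  have "dird u (\<lambda>x. x v) = (\<lambda>_. u v)" by (rule ext) simp
  then show ?case by (simp add: poly_fun.const)
next
  case (add f g)
  have "dird u (\<lambda>x. f x + g x) = (\<lambda>x. dird u f x + dird u g x)" by (rule ext) (rule dird_add[OF add.hyps])
  then show ?case using add.IH by (simp add: poly_fun.add)
next
  case (mult f g)
  have "dird u (\<lambda>x. f x * g x) = (\<lambda>x. dird u f x * g x + f x * dird u g x)"
    by (rule ext) (rule dird_mult[OF mult.hyps])
  then show ?case using mult by (simp add: poly_fun.add poly_fun.mult)
qed

lemma dird_commute:
  assumes "poly_fun V f"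
  shows "dird u (dird w f) = dird w (dird u f)"
  using assms
proof (induction rule: poly_fun.induct)
  case (const c)
  have "dird u (\<lambda>_. c) = (\<lambda>_. 0)" for u :: "'a \<Rightarrow> complex" by (rule ext) simp
  then show ?case by simp
next
  case (var v)
  have "dird u (\<lambda>x. x v) = (\<lambda>_. u v)" for u :: "'a \<Rightarrow> complex" by (rule ext) simp
  then show ?case by (simp add: fun_eq_iff)
next
  case (add f g)
  have "dird u (\<lambda>x. f x + g x) = (\<lambda>x. dird u f x + dird u g x)" for u by (rule ext) (rule dird_add[OF add.hyps])
  then show ?case using add by (simp add: fun_eq_iff dird_add[OF poly_fun_dird poly_fun_dird])
next
  case (mult f g)
  have *: "dird u (\<lambda>x. f x * g x) = (\<lambda>x. dird u f x * g x + f x * dird u g x)" for u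
    by (rule ext) (rule dird_mult[OF mult.hyps])
  have "dird u (dird w (\<lambda>x. f x * g x)) x =
    dird u (dird w f) x * g x + dird w f x * dird u g x + (dird u f x * dird w g x + f x * dird u (dird w g) x)" for u w x
    unfolding * by (simp add: dird_add[OF poly_fun.mult poly_fun.mult] dird_mult mult.hyps poly_fun_dird
        dird_add[of V "\<lambda>x. dird w f x * g x" "\<lambda>x. f x * dird w g x"] dird_mult[of V "dird w f" g] dird_mult[of V f "dird w g"] poly_fun.mult)
  then show ?case using mult.IH by (auto simp: fun_eq_iff)
qed

lemma dird_linear:
  assumes "poly_fun V f"
  shows "dird (\<lambda>v. \<Sum>k\<in>K. c k * u k v) f x = (\<Sum>k\<in>K. c k * dird (u k) f x)"
  using assms
proof (induction rule: poly_fun.induct)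
  case (add f g)
  then show ?case by (simp add: dird_add[OF add.hyps] sum.distrib distrib_left)
next
  case (mult f g)
  then show ?case
    by (simp add: dird_mult[OF mult.hyps] sum.distrib distrib_left sum_distrib_left sum_distrib_right mult_ac)
qed simp_all

lemma dird_cong:
  assumes "poly_fun V f" "\<And>v. v \<in> V \<Longrightarrow> u v = w v"
  shows "dird u f x = dird w f x"
  using assms
  by (induction rule: poly_fun.induct) (simp_all add: dird_add dird_mult)

abbreviation unit_at :: "'v \<Rightarrow> 'v \<Rightarrow> complex" where
  "unit_at v \<equiv> \<lambda>w. if w = v then 1 else 0"

lemma dird_unit_expansion:
  assumes "poly_fun V f" "finite V"
  shows "dird u f x = (\<Sum>v\<in>V. u v * dird (unit_at v) f x)"
proof -
  have "dird u f x = dird (\<lambda>w. \<Sum>v\<in>V. u v * unit_at v w) f x"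
    by (rule dird_cong[OF assms(1)]) (use assms(2) in \<open>simp add: if_distrib[of "\<lambda>c. _ * c"] cong: if_cong\<close>)
  then show ?thesis by (simp only: dird_linear[OF assms(1)])
qed

lemma dird_chain:
  assumes "poly_fun U f" "\<And>c. c \<in> U \<Longrightarrow> poly_fun V (\<lambda>y. \<Psi> y c)"
  shows "dird u (\<lambda>y. f (\<Psi> y)) y = dird (\<lambda>c. dird u (\<lambda>y. \<Psi> y c) y) f (\<Psi> y)"
  using assms(1)
proof (induction rule: poly_fun.induct)
  case (add f g)
  have "poly_fun V (\<lambda>y. f (\<Psi> y))" "poly_fun V (\<lambda>y. g (\<Psi> y))"
    using poly_fun_compose assms(2) add.hyps by blast+
  from dird_add[OF this] show ?case using add by (simp add: dird_add[OF add.hyps])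
next
  case (mult f g)
  have "poly_fun V (\<lambda>y. f (\<Psi> y))" "poly_fun V (\<lambda>y. g (\<Psi> y))"
    using poly_fun_compose assms(2) mult.hyps by blast+
  from dird_mult[OF this] show ?case using mult by (simp add: dird_mult[OF mult.hyps])
qed simp_all

text \<open>The ideal of the polynomial functions all of whose derivatives of order at most
  \<open>e\<close>, in arbitrary directions, vanish on \<open>H\<close>. Adding one derivative at a
  time avoids multi-indices.\<close>

primrec vanishing :: "'v set \<Rightarrow> ('v \<Rightarrow> complex) set \<Rightarrow> nat \<Rightarrow> (('v \<Rightarrow> complex) \<Rightarrow> complex) set" where
  "vanishing V H 0 = {f. poly_fun V f \<and> (\<forall>y\<in>H. f y = 0)}"
| "vanishing V H (Suc e) = {f \<in> vanishing V H e. \<forall>u. dird u f \<in> vanishing V H e}"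

lemma vanishing_poly_fun: "f \<in> vanishing V H e \<Longrightarrow> poly_fun V f"
  by (induction e) auto

lemma vanishing_add: "f \<in> vanishing V H e \<Longrightarrow> g \<in> vanishing V H e \<Longrightarrow> (\<lambda>y. f y + g y) \<in> vanishing V H e"
proof (induction e arbitrary: f g)
  case (Suc e)
  have "dird u (\<lambda>y. f y + g y) = (\<lambda>y. dird u f y + dird u g y)" for u
    using dird_add vanishing_poly_fun Suc.prems by blast
  then show ?case using Suc by simp
qed (auto intro: poly_fun.intros)

lemma vanishing_mult: "poly_fun V g \<Longrightarrow> f \<in> vanishing V H e \<Longrightarrow> (\<lambda>y. g y * f y) \<in> vanishing V H e"
proof (induction e arbitrary: f g)
  case (Suc e)
  have "dird u (\<lambda>y. g y * f y) = (\<lambda>y. dird u g y * f y + g y * dird u f y)" for u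
    using dird_mult vanishing_poly_fun Suc.prems by blast
  then show ?case using Suc by (simp add: vanishing_add poly_fun_dird)
qed (auto intro: poly_fun.intros)

lemma vanishing_0: "(\<lambda>_. 0) \<in> vanishing V H e"
proof (induction e)
  case (Suc e)
  have "dird u (\<lambda>_. 0) = (\<lambda>_. 0)" for u :: "'a \<Rightarrow> complex" by (rule ext) simp
  then show ?case using Suc by simp
qed (auto intro: poly_fun.intros)

lemma vanishing_sum:
  "(\<And>a. a \<in> A \<Longrightarrow> f a \<in> vanishing V H e) \<Longrightarrow> (\<lambda>y. \<Sum>a\<in>A. f a y) \<in> vanishing V H e"
  by (induction A rule: infinite_finite_induct) (auto simp: vanishing_0 vanishing_add)

text \<open>A derivative along the slice costs no order: the function is zero on the slice and the
  direction does not leave it. For higher orders the tangential derivative is commuted past the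
  others.\<close>

lemma vanishing_tangential:
  assumes "w \<in> V0" "f \<in> vanishing V (slice V0 y0) e"
  shows "dird (unit_at w) f \<in> vanishing V (slice V0 y0) e"
  using assms(2)
proof (induction e arbitrary: f)
  case 0
  have "dird (unit_at w) f y = 0" if "y \<in> slice V0 y0" for y
  proof (rule dirdI)
    have "(\<lambda>v. y v + t * unit_at w v) \<in> slice V0 y0" for t using that assms(1) by (auto simp: slice_def)
    then have "(\<lambda>t. f (\<lambda>v. y v + t * unit_at w v)) = (\<lambda>_. 0)" using 0 by auto
    then show "((\<lambda>t. f (\<lambda>v. y v + t * unit_at w v)) has_field_derivative 0) (at 0)" by simp
  qed
  then show ?case using 0 by (auto intro: poly_fun_dird)
next
  case (Suc e)
  have "poly_fun V f" using Suc.prems vanishing_poly_fun by blast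
  then show ?case using Suc dird_commute[of V f _ "unit_at w"] by simp
qed

text \<open>At order 0 this is irreducibility of the slice, on which \<delta> is not identically
  zero. One order higher, the product rule writes \<delta> times the derivative of \<open>f\<close>
  as the derivative of the product minus a multiple of \<open>f\<close>, and the induction
  hypothesis cancels \<delta> there.\<close>

lemma vanishing_cancel:
  assumes "poly_fun V \<delta>" "\<delta> y0 \<noteq> 0" "poly_fun V f" "(\<lambda>y. \<delta> y * f y) \<in> vanishing V (slice V0 y0) e"
  shows "f \<in> vanishing V (slice V0 y0) e"
  using assms(3,4)
proof (induction e arbitrary: f)
  case 0
  have "f y = 0" if y: "y \<in> slice V0 y0" for y
  proof (rule ccontr)
    assume "f y \<noteq> 0"
    then obtain z where "z \<in> slice V0 y0" "\<delta> z \<noteq> 0" "f z \<noteq> 0"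
      using poly_fun_slice_nonzero2[of V \<delta> f y0 V0 y0 y] assms(1,2) 0(1) y by auto
    then show False using 0(2) by fastforce
  qed
  then show ?case using 0 by simp
next
  case (Suc e)
  have f: "f \<in> vanishing V (slice V0 y0) e" using Suc by simp
  have "dird u f \<in> vanishing V (slice V0 y0) e" for u
  proof (rule Suc.IH)
    have "dird u (\<lambda>y. \<delta> y * f y) = (\<lambda>y. dird u \<delta> y * f y + \<delta> y * dird u f y)"
      using dird_mult[OF assms(1) Suc.prems(1)] by blast
    then have "(\<lambda>y. dird u \<delta> y * f y + \<delta> y * dird u f y) \<in> vanishing V (slice V0 y0) e"
      using Suc.prems(2) by (metis (mono_tags, lifting) mem_Collect_eq vanishing.simps(2))
    moreover have "(\<lambda>y. (- dird u \<delta> y) * f y) \<in> vanishing V (slice V0 y0) e"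
    proof (rule vanishing_mult[OF _ f])
      show "poly_fun V (\<lambda>y. - dird u \<delta> y)"
        using poly_fun.mult[OF poly_fun.const[of V "-1"] poly_fun_dird[OF assms(1)]] by simp
    qed
    ultimately show "(\<lambda>y. \<delta> y * dird u f y) \<in> vanishing V (slice V0 y0) e"
      using vanishing_add by fastforce
  qed (use Suc.prems in \<open>auto intro: poly_fun_dird\<close>)
  then show ?case using f by simp
qed

text \<open>On the line from \<open>y0\<close> to \<open>y\<close> the function is a univariate
  polynomial all of whose derivatives vanish at 0; in characteristic 0 it is zero, by induction on
  the degree.\<close>

lemma vanishing_all_orders:
  assumes "\<And>e. f \<in> vanishing V H e" "y0 \<in> H"
  shows "f y = 0"
proof -
  define u where "u = (\<lambda>v. y v - y0 v)"
  have *: "p = 0" if "\<And>t. f (\<lambda>v. y0 v + t * u v) = poly p t" "\<And>e. f \<in> vanishing V H e" for p f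
    using that
  proof (induction "degree p" arbitrary: p f rule: less_induct)
    case less
    have p0: "poly p 0 = 0" using less.prems(1)[of 0] less.prems(2)[of 0] assms(2) by simp
    show ?case
    proof (cases "degree p = 0")
      case True
      then obtain a where "p = [:a:]" by (rule degree_eq_zeroE)
      then show ?thesis using p0 by simp
    next
      case False
      have "dird u f \<in> vanishing V H e" for e using less.prems(2)[of "Suc e"] by simp
      moreover have "degree (pderiv p) < degree p" using False by (simp add: degree_pderiv)
      ultimately have "pderiv p = 0"
        using less.hyps dird_line[OF less.prems(1)] by blast
      then show ?thesis using False by (simp add: pderiv_eq_0_iff)
    qed
  qed
  obtain p where p: "\<forall>t. f (\<lambda>v. y0 v + t * u v) = poly p t"
    using poly_fun_line[OF vanishing_poly_fun[OF assms(1)]] by (rule exE)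
  have "p = 0" by (rule *[OF _ assms(1)]) (use p in blast)
  then show ?thesis using spec[OF p, of 1] by (simp add: u_def)
qed

text \<open>The differential equations propagate the vanishing of \<open>f\<close> from the slice to all orders.\<close>

lemma vanishing_on_transversal_slice:
  assumes "poly_fun V f" "finite V" "poly_fun V \<delta>" "\<delta> y0 \<noteq> 0" "\<And>y. y \<in> slice V0 y0 \<Longrightarrow> f y = 0"
    and eq: "\<And>v. v \<in> V \<Longrightarrow> \<exists>a b. (\<forall>w\<in>V0. poly_fun V (a w)) \<and> poly_fun V b \<and>
      (\<forall>y. \<delta> y * dird (unit_at v) f y = (\<Sum>w\<in>V0. a w y * dird (unit_at w) f y) + b y * f y)"
  shows "f y = 0"
proof -
  let ?J = "vanishing V (slice V0 y0)"
  have "f \<in> ?J e" for e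
  proof (induction e)
    case 0
    then show ?case using assms by simp
  next
    case (Suc e)
    have unit: "dird (unit_at v) f \<in> ?J e" if v: "v \<in> V" for v
    proof -
      obtain a b where ab: "\<forall>w\<in>V0. poly_fun V (a w)" "poly_fun V b"
        "\<And>y. \<delta> y * dird (unit_at v) f y = (\<Sum>w\<in>V0. a w y * dird (unit_at w) f y) + b y * f y"
        using eq[OF v] by blast
      \<comment> \<open>The right side of the differential equation contains only tangential
        derivatives and \<open>f\<close> itself, which all have order \<open>e\<close>. So a
        transversal derivative has order \<open>e\<close> too, and \<open>f\<close> gains one
        order.\<close>
      have "(\<lambda>y. (\<Sum>w\<in>V0. a w y * dird (unit_at w) f y) + b y * f y) \<in> ?J e"
        by (intro vanishing_add vanishing_sum vanishing_mult vanishing_tangential) (use ab Suc in auto)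
      then have "(\<lambda>y. \<delta> y * dird (unit_at v) f y) \<in> ?J e" using ab(3) by simp
      then show ?thesis by (rule vanishing_cancel[OF assms(3,4) poly_fun_dird[OF assms(1)]])
    qed
    have "dird u f \<in> ?J e" for u
    proof -
      have "dird u f = (\<lambda>y. \<Sum>v\<in>V. u v * dird (unit_at v) f y)"
        using dird_unit_expansion[OF assms(1,2)] by blast
      moreover have "(\<lambda>y. \<Sum>v\<in>V. u v * dird (unit_at v) f y) \<in> ?J e"
        by (intro vanishing_sum vanishing_mult unit poly_fun.const)
      ultimately show ?thesis by simp
    qed
    then show ?case using Suc by simp
  qed
  then show ?thesis using vanishing_all_orders slice_base by metis
qed

section \<open>Evaluation of polynomials and homogeneous relations\<close>

definition mon_eval :: "('v \<Rightarrow>\<^sub>0 nat) \<Rightarrow> ('v \<Rightarrow> complex) \<Rightarrow> complex" where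
  "mon_eval m x = (\<Prod>v\<in>keys m. x v ^ lookup m v)"

lemma mon_eval_supset: "finite M \<Longrightarrow> keys m \<subseteq> M \<Longrightarrow> mon_eval m x = (\<Prod>v\<in>M. x v ^ lookup m v)"
  unfolding mon_eval_def by (rule prod.mono_neutral_left) (auto simp: in_keys_iff)

lemma mon_eval_0 [simp]: "mon_eval 0 x = 1"
  by (simp add: mon_eval_def)

lemma mon_eval_add: "mon_eval (a + b) x = mon_eval a x * mon_eval b x"
  using mon_eval_supset[of "keys a \<union> keys b" a x] mon_eval_supset[of "keys a \<union> keys b" b x]
    mon_eval_supset[of "keys a \<union> keys b" "a + b" x] keys_add[of a b]
  by (simp add: lookup_add power_add prod.distrib)

lemma mon_eval_single [simp]: "mon_eval (single v k) x = x v ^ k"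
  by (simp add: mon_eval_def)

lemma mon_eval_sum: "mon_eval (\<Sum>a\<in>A. f a) x = (\<Prod>a\<in>A. mon_eval (f a) x)"
  by (induction A rule: infinite_finite_induct) (auto simp: mon_eval_add)

lemma poly_fun_mon_eval: "keys m \<subseteq> V \<Longrightarrow> poly_fun V (mon_eval m)"
  unfolding mon_eval_def by (intro poly_fun_prod poly_fun_power poly_fun.var) auto

lemma eval_poly_alt: "eval_poly F x = (\<Sum>m\<in>keys F. lookup F m * mon_eval m x)"
  by (simp add: eval_poly_def mon_eval_def)

lemma eval_poly_single [simp]: "eval_poly (single m c) x = c * mon_eval m x"
  by (simp add: eval_poly_alt)

lemma eval_poly_sum: "eval_poly (\<Sum>a\<in>A. F a) x = (\<Sum>a\<in>A. eval_poly (F a) x)"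
  by (induction A rule: infinite_finite_induct) (auto simp: eval_poly_add)

lemma poly_mapping_expansion: "F = (\<Sum>m\<in>keys F. single m (lookup F m))"
  by (rule poly_mapping_eqI) (auto simp: lookup_sum lookup_single when_def in_keys_iff)

lemma eval_poly_mult: "eval_poly (F * G) x = eval_poly F x * eval_poly G x"
proof -
  have "F * G = (\<Sum>a\<in>keys F. \<Sum>b\<in>keys G. single (a + b) (lookup F a * lookup G b))"
    by (subst poly_mapping_expansion[of F], subst poly_mapping_expansion[of G])
      (simp add: sum_product mult_single)
  then show ?thesis
    by (simp add: eval_poly_sum mon_eval_add eval_poly_alt[of F] eval_poly_alt[of G] sum_product mult_ac)
qed

lemma eval_poly_prod: "eval_poly (\<Prod>a\<in>A. F a) x = (\<Prod>a\<in>A. eval_poly (F a) x)"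
  by (induction A rule: infinite_finite_induct) (auto simp: eval_poly_mult)

lemma eval_poly_power: "eval_poly (F ^ k) x = eval_poly F x ^ k"
  by (induction k) (auto simp: eval_poly_mult)

lemma poly_fun_eval_poly: "vars F \<subseteq> V \<Longrightarrow> poly_fun V (eval_poly F)"
  unfolding eval_poly_alt[abs_def] vars_def
  by (intro poly_fun_sum poly_fun.mult poly_fun.const poly_fun_mon_eval) auto

lemma vars_add: "vars (F + G) \<subseteq> vars F \<union> vars G"
  using keys_add[of F G] unfolding vars_def by blast

lemma vars_single: "vars (single m c) \<subseteq> keys m"
  unfolding vars_def by simp

lemma vars_sum: "vars (\<Sum>a\<in>A. F a) \<subseteq> (\<Union>a\<in>A. vars (F a))"
proof (induction A rule: infinite_finite_induct)
  case (insert a A)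
  then show ?case using vars_add[of "F a" "\<Sum>a\<in>A. F a"] by auto
qed (auto simp: vars_def)

lemma keys_add_nat: "keys (a + b :: 'v \<Rightarrow>\<^sub>0 nat) = keys a \<union> keys b"
  by (auto simp: in_keys_iff lookup_add)

lemma vars_mult: "vars (F * G) \<subseteq> vars F \<union> vars G"
proof -
  have "keys m \<subseteq> vars F \<union> vars G" if m: "m \<in> keys (F * G)" for m
  proof -
    obtain a b where "m = a + b" "a \<in> keys F" "b \<in> keys G" using keys_mult[of F G] m by blast
    then show ?thesis unfolding vars_def by (auto simp: keys_add_nat)
  qed
  then show ?thesis unfolding vars_def[of "F * G"] by blast
qed

lemma vars_1 [simp]: "vars 1 = {}"
  by (simp add: vars_def)

lemma vars_prod: "vars (\<Prod>a\<in>A. F a) \<subseteq> (\<Union>a\<in>A. vars (F a))"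
proof (induction A rule: infinite_finite_induct)
  case (insert a A)
  then show ?case using vars_mult[of "F a" "\<Prod>a\<in>A. F a"] by auto
qed auto

lemma vars_power: "vars (F ^ k) \<subseteq> vars F"
proof (induction k)
  case (Suc k)
  then show ?case using vars_mult[of F "F ^ k"] by auto
qed auto

lemma poly_fun_imp_eval_poly: "poly_fun V f \<Longrightarrow> \<exists>F. vars F \<subseteq> V \<and> f = eval_poly F"
proof (induction rule: poly_fun.induct)
  case (const c)
  show ?case by (intro exI[of _ "single 0 c"]) (auto simp: vars_def)
next
  case (var v)
  then show ?case using vars_single[of "single v 1" 1] by (intro exI[of _ "single (single v 1) 1"]) auto
next
  case (add f g)
  then obtain F G where "vars F \<subseteq> V" "f = eval_poly F" "vars G \<subseteq> V" "g = eval_poly G" by auto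
  then show ?case using vars_add[of F G] by (intro exI[of _ "F + G"]) (auto simp: eval_poly_add)
next
  case (mult f g)
  then obtain F G where "vars F \<subseteq> V" "f = eval_poly F" "vars G \<subseteq> V" "g = eval_poly G" by auto
  then show ?case using vars_mult[of F G] by (intro exI[of _ "F * G"]) (auto simp: eval_poly_mult)
qed

section \<open>Degrees, homogeneity and formal partial derivatives\<close>

definition mdeg :: "'v set \<Rightarrow> ('v \<Rightarrow>\<^sub>0 nat) \<Rightarrow> nat" where
  "mdeg B m = (\<Sum>v\<in>keys m \<inter> B. lookup m v)"

lemma homogeneous_on_alt: "homogeneous_on B k F \<longleftrightarrow> (\<forall>m\<in>keys F. mdeg B m = k)"
  by (simp add: homogeneous_on_def mdeg_def)

lemma mdeg_supset: "finite M \<Longrightarrow> keys m \<subseteq> M \<Longrightarrow> mdeg B m = (\<Sum>v\<in>M. if v \<in> B then lookup m v else 0)"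
  unfolding mdeg_def sum.inter_restrict[symmetric, OF finite_keys]
  by (subst sum.inter_restrict, simp, rule sum.mono_neutral_left) (auto simp: in_keys_iff)

lemma mdeg_add: "mdeg B (a + b) = mdeg B a + mdeg B b"
  using mdeg_supset[of "keys a \<union> keys b" a B] mdeg_supset[of "keys a \<union> keys b" b B]
    mdeg_supset[of "keys a \<union> keys b" "a + b" B] keys_add[of a b]
  by (auto simp: lookup_add sum.distrib[symmetric] intro!: sum.cong)

lemma mdeg_0 [simp]: "mdeg B 0 = 0" by (simp add: mdeg_def)

lemma mdeg_single: "mdeg B (single v k) = (if v \<in> B then k else 0)"
  using mdeg_supset[of "{v}" "single v k" B] by simp

lemma mdeg_sum: "mdeg B (\<Sum>a\<in>A. f a) = (\<Sum>a\<in>A. mdeg B (f a))"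
  by (induction A rule: infinite_finite_induct) (auto simp: mdeg_add)

lemma mdeg_UNIV_eq_0_iff: "mdeg UNIV m = 0 \<longleftrightarrow> m = 0"
  by (auto simp: mdeg_def in_keys_iff intro!: poly_mapping_eqI)

lemma homogeneous_on_add: "homogeneous_on B k F \<Longrightarrow> homogeneous_on B k G \<Longrightarrow> homogeneous_on B k (F + G)"
  using keys_add[of F G] unfolding homogeneous_on_def by blast

lemma homogeneous_on_0 [simp]: "homogeneous_on B k 0" by (simp add: homogeneous_on_def)

lemma homogeneous_on_single: "mdeg B m = k \<Longrightarrow> homogeneous_on B k (single m c)"
  by (simp add: homogeneous_on_alt)

lemma homogeneous_on_sum: "(\<And>a. a \<in> A \<Longrightarrow> homogeneous_on B k (F a)) \<Longrightarrow> homogeneous_on B k (\<Sum>a\<in>A. F a)"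
  by (induction A rule: infinite_finite_induct) (auto simp: homogeneous_on_add)

lemma homogeneous_on_mult:
  "homogeneous_on B k F \<Longrightarrow> homogeneous_on B l G \<Longrightarrow> homogeneous_on B (k + l) (F * G)"
  using keys_mult[of F G] unfolding homogeneous_on_alt by (fastforce simp: mdeg_add)

lemma homogeneous_on_1: "homogeneous_on B 0 1"
  by (simp add: homogeneous_on_alt)

lemma homogeneous_on_prod:
  "(\<And>a. a \<in> A \<Longrightarrow> homogeneous_on B (k a) (F a)) \<Longrightarrow> homogeneous_on B (\<Sum>a\<in>A. k a) (\<Prod>a\<in>A. F a)"
  by (induction A rule: infinite_finite_induct) (auto simp: homogeneous_on_mult homogeneous_on_1)

lemma homogeneous_on_power: "homogeneous_on B k F \<Longrightarrow> homogeneous_on B (j * k) (F ^ j)"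
  by (induction j) (auto simp: homogeneous_on_mult homogeneous_on_1)

lemma mon_eval_scale: "mon_eval m (\<lambda>v. c * x v) = c ^ mdeg UNIV m * mon_eval m x"
  by (simp add: mon_eval_def mdeg_def power_mult_distrib prod.distrib power_sum)

lemma eval_poly_scale:
  assumes "homogeneous k F"
  shows "eval_poly F (\<lambda>v. c * x v) = c ^ k * eval_poly F x"
  unfolding eval_poly_alt sum_distrib_left
  by (rule sum.cong) (use assms in \<open>auto simp: homogeneous_on_alt mon_eval_scale\<close>)

lemma homogeneous_0_cases:
  assumes "homogeneous 0 F"
  obtains c where "F = single 0 c"
proof (rule that[of "lookup F 0"], rule poly_mapping_eqI)
  fix m show "lookup F m = lookup (single 0 (lookup F 0)) m"
    using assms unfolding homogeneous_on_alt mdeg_UNIV_eq_0_iff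
    by (cases "m = 0") (auto simp: lookup_single in_keys_iff when_def)
qed

text \<open>Subtraction of exponents is truncated, so a monomial without \<open>v\<close> stays in
  place in \<open>partial_deriv\<close>, but with coefficient 0. Only \<open>m + single v 1\<close>
  is left to contribute to the coefficient at \<open>m\<close>.\<close>

lemma lookup_partial_deriv:
  "lookup (partial_deriv v F) m = of_nat (Suc (lookup m v)) * lookup F (m + single v 1)"
proof -
  let ?t = "\<lambda>m'. lookup (single (m' - single v 1) (of_nat (lookup m' v) * lookup F m')) m"
  have "?t m' = 0" if "m' \<noteq> m + single v 1" for m'
  proof (cases "lookup m' v = 0")
    case False
    have "m' - single v 1 \<noteq> m"
    proof
      assume "m' - single v 1 = m"
      then have "m' = m + single v 1"
        using False by (auto simp: lookup_add lookup_minus lookup_single when_def intro!: poly_mapping_eqI)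
      then show False using that by simp
    qed
    then show ?thesis by (simp add: lookup_single)
  qed (simp add: lookup_single)
  then have "(\<Sum>m'\<in>keys F. ?t m') = (\<Sum>m'\<in>keys F \<inter> {m + single v 1}. ?t m')"
    by (intro sum.mono_neutral_right) auto
  also have "\<dots> = of_nat (Suc (lookup m v)) * lookup F (m + single v 1)"
    by (cases "m + single v 1 \<in> keys F") (auto simp: lookup_add in_keys_iff)
  finally show ?thesis unfolding partial_deriv_def lookup_sum .
qed

lemma homogeneous_partial_deriv: "homogeneous (Suc k) F \<Longrightarrow> homogeneous k (partial_deriv v F)"
  unfolding homogeneous_on_alt
proof
  fix m assume F: "\<forall>m\<in>keys F. mdeg UNIV m = Suc k" and "m \<in> keys (partial_deriv v F)"
  then have "m + single v 1 \<in> keys F" by (simp add: in_keys_iff lookup_partial_deriv)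
  then show "mdeg UNIV m = k" using F by (fastforce simp: mdeg_add mdeg_single)
qed

lemma vars_partial_deriv: "vars (partial_deriv v F) \<subseteq> vars F"
proof -
  have "keys m \<subseteq> vars F" if "m \<in> keys (partial_deriv v F)" for m
  proof -
    have "m + single v 1 \<in> keys F" using that by (simp add: in_keys_iff lookup_partial_deriv)
    moreover have "keys m \<subseteq> keys (m + single v 1)" by (auto simp: keys_add_nat)
    ultimately show ?thesis unfolding vars_def by blast
  qed
  then show ?thesis unfolding vars_def[of "partial_deriv v F"] by blast
qed

lemma partial_deriv_eq_0:
  assumes "v \<notin> vars F"
  shows "partial_deriv v F = 0"
proof (rule poly_mapping_eqI)
  fix m
  have "m + single v 1 \<notin> keys F" using assms keys_add_nat[of m "single v 1"] unfolding vars_def by fastforce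
  then show "lookup (partial_deriv v F) m = lookup 0 m" by (simp add: lookup_partial_deriv in_keys_iff)
qed

text \<open>A monomial of positive degree contains some variable, and its coefficient survives
  differentiation by that variable up to a positive integer factor.\<close>

lemma eq_0_if_partial_derivs_0:
  assumes "homogeneous (Suc k) F" "\<And>v. partial_deriv v F = 0"
  shows "F = 0"
proof (rule ccontr)
  assume "F \<noteq> 0"
  then obtain m where m: "m \<in> keys F" unfolding in_keys_iff by (metis poly_mapping_eqI lookup_zero)
  then have "mdeg UNIV m = Suc k" using assms by (simp add: homogeneous_on_alt)
  then have "m \<noteq> 0" by auto
  then obtain v where v: "lookup m v \<noteq> 0" by (metis poly_mapping_eqI lookup_zero)
  then have "m - single v 1 + single v 1 = m"
    by (auto simp: lookup_add lookup_minus lookup_single when_def intro!: poly_mapping_eqI)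
  then have "lookup (partial_deriv v F) (m - single v 1) \<noteq> 0"
    unfolding lookup_partial_deriv using m by (simp add: in_keys_iff del: of_nat_Suc)
  then show False using assms(2) by simp
qed

lemma dird_mon_eval: "dird (unit_at v) (mon_eval m) x = of_nat (lookup m v) * mon_eval (m - single v 1) x"
proof -
  have "mon_eval m (\<lambda>w. x w + t * unit_at v w) = (x v + t) ^ lookup m v * (\<Prod>w\<in>keys m - {v}. x w ^ lookup m w)" for t
  proof -
    have "mon_eval m (\<lambda>w. x w + t * unit_at v w) = (\<Prod>w\<in>insert v (keys m - {v}). (x w + t * unit_at v w) ^ lookup m w)"
      by (rule mon_eval_supset) auto
    also have "\<dots> = (x v + t) ^ lookup m v * (\<Prod>w\<in>keys m - {v}. (x w + t * unit_at v w) ^ lookup m w)"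
      by (simp del: insert_Diff_single)
    also have "(\<Prod>w\<in>keys m - {v}. (x w + t * unit_at v w) ^ lookup m w) = (\<Prod>w\<in>keys m - {v}. x w ^ lookup m w)"
      by (rule prod.cong) auto
    finally show ?thesis .
  qed
  then have "dird (unit_at v) (mon_eval m) x =
      of_nat (lookup m v) * x v ^ (lookup m v - 1) * (\<Prod>w\<in>keys m - {v}. x w ^ lookup m w)"
    by (intro dirdI) (auto intro!: derivative_eq_intros)
  also have "\<dots> = of_nat (lookup m v) * mon_eval (m - single v 1) x"
  proof (cases "lookup m v = 0")
    case False
    have "mon_eval (m - single v 1) x = (\<Prod>w\<in>insert v (keys m - {v}). x w ^ lookup (m - single v 1) w)"
      by (rule mon_eval_supset) (auto simp: in_keys_iff lookup_minus)
    also have "\<dots> = x v ^ (lookup m v - 1) * (\<Prod>w\<in>keys m - {v}. x w ^ lookup (m - single v 1) w)"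
      by (simp add: lookup_minus del: insert_Diff_single)
    also have "(\<Prod>w\<in>keys m - {v}. x w ^ lookup (m - single v 1) w) = (\<Prod>w\<in>keys m - {v}. x w ^ lookup m w)"
      by (rule prod.cong) (auto simp: lookup_minus lookup_single when_def)
    finally show ?thesis by simp
  qed simp
  finally show ?thesis .
qed

lemma eval_partial_deriv: "eval_poly (partial_deriv v F) x = dird (unit_at v) (eval_poly F) x"
proof -
  have pf: "poly_fun UNIV (mon_eval m)" for m :: "'a \<Rightarrow>\<^sub>0 nat" by (rule poly_fun_mon_eval) simp
  have "dird (unit_at v) (eval_poly F) x = (\<Sum>m\<in>keys F. lookup F m * dird (unit_at v) (mon_eval m) x)"
    unfolding eval_poly_alt[abs_def]
    by (subst dird_sum[of _ UNIV]) (auto intro!: poly_fun.mult poly_fun.const pf sum.cong dird_cmult)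
  then show ?thesis by (simp add: partial_deriv_def eval_poly_sum dird_mon_eval mult_ac)
qed

text \<open>Both sides are the derivative at t = 0 of F((1 + t) x) = (1 + t)^k F(x).\<close>

lemma euler_homogeneous:
  assumes "homogeneous k F" "vars F \<subseteq> V" "finite V"
  shows "(\<Sum>v\<in>V. x v * eval_poly (partial_deriv v F) x) = of_nat k * eval_poly F x"
proof -
  have "dird x (eval_poly F) x = of_nat k * eval_poly F x"
  proof (rule dirdI)
    have "eval_poly F (\<lambda>v. x v + t * x v) = (1 + t) ^ k * eval_poly F x" for t
      using eval_poly_scale[OF assms(1), of "1 + t" x] by (simp add: ring_distribs)
    then show "((\<lambda>t. eval_poly F (\<lambda>v. x v + t * x v)) has_field_derivative of_nat k * eval_poly F x) (at 0)"
      by (auto intro!: derivative_eq_intros)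
  qed
  then show ?thesis
    unfolding eval_partial_deriv
    by (rule trans[OF dird_unit_expansion[OF poly_fun_eval_poly[OF assms(2)] assms(3), symmetric]])
qed

lemma homogeneous_eval_eq_0:
  assumes "homogeneous k F" "\<And>x. eval_poly F x = 0"
  shows "F = 0"
  using assms
proof (induction k arbitrary: F)
  case 0
  then obtain c where "F = single 0 c" by (elim homogeneous_0_cases)
  then show ?case using 0(2)[of "\<lambda>_. 0"] by simp
next
  case (Suc k)
  have "eval_poly F = (\<lambda>_. 0)" using Suc.prems by auto
  then have "partial_deriv v F = 0" for v
    by (intro Suc.IH homogeneous_partial_deriv Suc.prems) (simp add: eval_partial_deriv)
  then show ?case using eq_0_if_partial_derivs_0[OF Suc.prems(1)] by blast
qed

definition poly_subst :: "'v cpoly \<Rightarrow> ('v \<Rightarrow> 'w cpoly) \<Rightarrow> 'w cpoly" where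
  "poly_subst P F = (\<Sum>m\<in>keys P. single 0 (lookup P m) * (\<Prod>v\<in>keys m. F v ^ lookup m v))"

lemma eval_poly_subst: "eval_poly (poly_subst P F) x = eval_poly P (\<lambda>v. eval_poly (F v) x)"
  by (simp add: poly_subst_def eval_poly_sum eval_poly_mult eval_poly_prod eval_poly_power eval_poly_def[of P])

lemma homogeneous_poly_subst:
  assumes "homogeneous k P" "\<And>v. v \<in> vars P \<Longrightarrow> homogeneous e (F v)"
  shows "homogeneous (k * e) (poly_subst P F)"
  unfolding poly_subst_def
proof (rule homogeneous_on_sum)
  fix m assume m: "m \<in> keys P"
  have "homogeneous (\<Sum>v\<in>keys m. lookup m v * e) (\<Prod>v\<in>keys m. F v ^ lookup m v)"
    by (intro homogeneous_on_prod homogeneous_on_power assms(2)) (use m in \<open>auto simp: vars_def\<close>)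
  also have "(\<Sum>v\<in>keys m. lookup m v * e) = k * e"
    using assms(1) m by (simp add: homogeneous_on_def sum_distrib_right[symmetric])
  finally have "homogeneous (0 + k * e) (single 0 (lookup P m) * (\<Prod>v\<in>keys m. F v ^ lookup m v))"
    by (intro homogeneous_on_mult homogeneous_on_single) auto
  then show "homogeneous (k * e) (single 0 (lookup P m) * (\<Prod>v\<in>keys m. F v ^ lookup m v))" by simp
qed

lemma vars_poly_subst:
  fixes P :: "'v cpoly" and F :: "'v \<Rightarrow> 'w cpoly"
  assumes "\<And>v. v \<in> vars P \<Longrightarrow> vars (F v) \<subseteq> A"
  shows "vars (poly_subst P F) \<subseteq> A"
proof -
  have "vars (single 0 (lookup P m) * (\<Prod>v\<in>keys m. F v ^ lookup m v)) \<subseteq> A" if "m \<in> keys P" for m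
  proof -
    have "vars (F v ^ lookup m v) \<subseteq> A" if "v \<in> keys m" for v
      using vars_power[of "F v"] assms[of v] that \<open>m \<in> keys P\<close> by (fastforce simp: vars_def)
    then have "(\<Union>v\<in>keys m. vars (F v ^ lookup m v)) \<subseteq> A" by (rule UN_least)
    then have "vars (\<Prod>v\<in>keys m. F v ^ lookup m v) \<subseteq> A" by (rule order_trans[OF vars_prod])
    then show ?thesis
      by (intro order_trans[OF vars_mult] Un_least order_trans[OF vars_single]) simp_all
  qed
  then show ?thesis unfolding poly_subst_def
    using vars_sum[of "\<lambda>m. single 0 (lookup P m) * (\<Prod>v\<in>keys m. F v ^ lookup m v)" "keys P"] by blast
qed

text \<open>Division with remainder by the variable \<open>v\<close>. The clause for
  \<open>k = 0\<close> makes up for the truncation of \<open>k - 1\<close>.\<close>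

lemma split_off_variable:
  assumes "homogeneous k P"
  obtains P0 P1 where "P = P0 + single (single v 1) 1 * P1" "homogeneous k P0" "vars P0 \<subseteq> vars P - {v}"
    "k = 0 \<longrightarrow> P1 = 0" "homogeneous (k - 1) P1" "vars P1 \<subseteq> vars P"
proof -
  define A where "A = {m \<in> keys P. lookup m v = 0}"
  define B where "B = {m \<in> keys P. lookup m v \<noteq> 0}"
  define P0 where "P0 = (\<Sum>m\<in>A. single m (lookup P m))"
  define P1 where "P1 = (\<Sum>m\<in>B. single (m - single v 1) (lookup P m))"
  have AB: "keys P = A \<union> B" "A \<inter> B = {}" "finite A" "finite B" by (auto simp: A_def B_def)
  have B: "single v 1 + (m - single v 1) = m" if "m \<in> B" for m
    using that by (auto simp: B_def lookup_add lookup_minus lookup_single when_def intro!: poly_mapping_eqI)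
  have "single (single v 1) 1 * P1 = (\<Sum>m\<in>B. single m (lookup P m))"
    unfolding P1_def sum_distrib_left mult_single by (rule sum.cong) (simp_all add: B del: One_nat_def)
  then have "P = P0 + single (single v 1) 1 * P1"
    using poly_mapping_expansion[of P] AB by (simp add: P0_def sum.union_disjoint)
  moreover have "homogeneous k P0" unfolding P0_def
    by (intro homogeneous_on_sum homogeneous_on_single) (use assms in \<open>auto simp: A_def homogeneous_on_alt\<close>)
  moreover have deg: "mdeg UNIV (m - single v 1) = k - 1 \<and> k \<noteq> 0" if m: "m \<in> B" for m
  proof -
    have "k = mdeg UNIV (single v 1 + (m - single v 1))" using assms m B[OF m] by (auto simp: B_def homogeneous_on_alt)
    then show ?thesis by (simp add: mdeg_add mdeg_single)
  qed
  then have "homogeneous (k - 1) P1" unfolding P1_def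
    by (intro homogeneous_on_sum homogeneous_on_single) auto
  moreover have "k = 0 \<longrightarrow> P1 = 0" using deg unfolding P1_def by (metis sum.empty equals0I)
  moreover have "vars P0 \<subseteq> vars P - {v}"
  proof -
    have "vars (single m (lookup P m)) \<subseteq> vars P - {v}" if "m \<in> A" for m
      using that vars_single[of m "lookup P m"] by (auto simp: A_def vars_def in_keys_iff)
    then show ?thesis unfolding P0_def using vars_sum[of "\<lambda>m. single m (lookup P m)" A] by blast
  qed
  moreover have "vars P1 \<subseteq> vars P"
  proof -
    have "vars (single (m - single v 1) (lookup P m)) \<subseteq> vars P" if m: "m \<in> B" for m
    proof -
      have "keys (m - single v 1) \<subseteq> keys m" by (auto simp: in_keys_iff lookup_minus)
      then show ?thesis using m vars_single[of "m - single v 1" "lookup P m"] by (auto simp: B_def vars_def)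
    qed
    then show ?thesis unfolding P1_def using vars_sum[of "\<lambda>m. single (m - single v 1) (lookup P m)" B] by blast
  qed
  ultimately show ?thesis using that by blast
qed

text \<open>Geometrically, the points [g_0 : ... : g_l] lie on no hypersurface of projective
  l-space, so the functions map \<open>Y\<close> onto a dense subset. There are \<open>l + 1\<close>
  functions, and \<open>l\<close> is the dimension that they detect.\<close>

definition hom_indep :: "'y set \<Rightarrow> nat \<Rightarrow> (nat \<Rightarrow> 'y \<Rightarrow> complex) \<Rightarrow> bool" where
  "hom_indep Y l g \<longleftrightarrow> (\<forall>k P. homogeneous k P \<longrightarrow> vars P \<subseteq> {..l} \<longrightarrow>
     (\<forall>y\<in>Y. eval_poly P (\<lambda>i. g i y) = 0) \<longrightarrow> P = 0)"

lemma hom_indepD: "hom_indep Y l g \<Longrightarrow> homogeneous k P \<Longrightarrow> vars P \<subseteq> {..l} \<Longrightarrow>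
     (\<And>y. y \<in> Y \<Longrightarrow> eval_poly P (\<lambda>i. g i y) = 0) \<Longrightarrow> P = 0"
  unfolding hom_indep_def by blast

lemma finite_box:
  assumes "finite V"
  shows "finite {m :: 'v \<Rightarrow>\<^sub>0 nat. keys m \<subseteq> V \<and> (\<forall>v. lookup m v \<le> e)}"
    and "card {m :: 'v \<Rightarrow>\<^sub>0 nat. keys m \<subseteq> V \<and> (\<forall>v. lookup m v \<le> e)} \<le> Suc e ^ card V"
proof -
  let ?S = "{m :: 'v \<Rightarrow>\<^sub>0 nat. keys m \<subseteq> V \<and> (\<forall>v. lookup m v \<le> e)}"
  have inj: "inj_on (\<lambda>m. restrict (lookup m) V) ?S"
  proof (rule inj_onI)
    fix m m' assume m: "m \<in> ?S" "m' \<in> ?S" "restrict (lookup m) V = restrict (lookup m') V"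
    show "m = m'"
    proof (rule poly_mapping_eqI)
      fix v show "lookup m v = lookup m' v"
        using m(1,2) fun_cong[OF m(3), of v]
        by (cases "v \<in> V") (simp_all add: in_keys_iff subset_iff, metis neq0_conv)
    qed
  qed
  have sub: "(\<lambda>m. restrict (lookup m) V) ` ?S \<subseteq> V \<rightarrow>\<^sub>E {..e}" by auto
  have fin: "finite (V \<rightarrow>\<^sub>E {..e})" using assms by (intro finite_PiE) auto
  show "finite ?S" using inj_on_finite[OF inj sub fin] .
  show "card ?S \<le> Suc e ^ card V" using card_inj_on_le[OF inj sub fin] assms by (simp add: card_PiE)
qed

text \<open>In \<open>K\<close> the left side has degree \<open>D\<close> with leading coefficient
  \<open>(e * Suc D) ^ D\<close>, the right side has degree \<open>D + 1\<close>. Taking that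
  coefficient for \<open>K\<close> is already enough.\<close>

lemma box_count:
  fixes D e :: nat
  assumes "e > 0"
  shows "\<exists>K. Suc (e * (Suc D * K)) ^ D < Suc K ^ Suc D"
proof (intro exI)
  let ?K = "(e * Suc D) ^ D"
  have "Suc (e * (Suc D * ?K)) \<le> (e * Suc D) * Suc ?K" using assms by (simp add: algebra_simps)
  then have "Suc (e * (Suc D * ?K)) ^ D \<le> ((e * Suc D) * Suc ?K) ^ D" by (rule power_mono) simp
  also have "\<dots> = ?K * Suc ?K ^ D" by (rule power_mult_distrib)
  also have "\<dots> < Suc ?K ^ Suc D" by simp
  finally show "Suc (e * (Suc D * ?K)) ^ D < Suc ?K ^ Suc D" .
qed

text \<open>There are more monomials of a large degree in \<open>D + 2\<close> quantities than coefficients of the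
  polynomials in \<open>D\<close> variables that they expand to.\<close>

lemma hom_indep_le_card:
  assumes "finite V" "\<And>i. i \<le> l \<Longrightarrow> poly_fun V (g i)" "hom_indep UNIV l g"
  shows "l \<le> card V"
proof (rule ccontr)
  assume "\<not> l \<le> card V"
  define D where "D = card V"
  have Dl: "Suc D \<le> l" using \<open>\<not> l \<le> card V\<close> by (simp add: D_def)
  have "\<forall>i. \<exists>G. i \<le> l \<longrightarrow> vars G \<subseteq> V \<and> g i = eval_poly G"
    using assms(2) poly_fun_imp_eval_poly by blast
  then obtain G where G: "\<And>i. i \<le> l \<Longrightarrow> vars (G i) \<subseteq> V" "\<And>i. i \<le> l \<Longrightarrow> g i = eval_poly (G i)" by metis
  \<comment> \<open>A common bound for all exponents in all \<open>G i\<close>; the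
    \<open>Suc\<close> makes it positive, as \<open>box_count\<close> requires.\<close>
  define e where "e = Suc (\<Sum>i\<le>l. \<Sum>m\<in>keys (G i). \<Sum>v\<in>keys m. lookup m v)"
  have e: "lookup m v \<le> e" if "i \<le> l" "m \<in> keys (G i)" for i m v
  proof (cases "v \<in> keys m")
    case True
    have "lookup m v \<le> (\<Sum>v\<in>keys m. lookup m v)" by (rule member_le_sum) (use True in auto)
    also have "\<dots> \<le> (\<Sum>m\<in>keys (G i). \<Sum>v\<in>keys m. lookup m v)"
      by (rule member_le_sum) (use that in auto)
    also have "\<dots> \<le> (\<Sum>i\<le>l. \<Sum>m\<in>keys (G i). \<Sum>v\<in>keys m. lookup m v)"
      by (rule member_le_sum[of i "{..l}" "\<lambda>i. \<Sum>m\<in>keys (G i). \<Sum>v\<in>keys m. lookup m v"]) (use that in auto)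
    finally show ?thesis by (simp add: e_def)
  qed (simp add: in_keys_iff)
  obtain K where K: "Suc (e * (Suc D * K)) ^ D < Suc K ^ Suc D" using box_count[of e D] by (auto simp: e_def)
  define N where "N = Suc D * K"
  define box where "box = (\<lambda>k. {m :: 'a \<Rightarrow>\<^sub>0 nat. keys m \<subseteq> V \<and> (\<forall>v. lookup m v \<le> e * k)})"
  have box1: "keys 1 \<subseteq> box 0" by (simp add: box_def)
  have boxm: "keys (F * F') \<subseteq> box (k + k')" if "keys F \<subseteq> box k" "keys F' \<subseteq> box k'" for F F' :: "'a cpoly" and k k'
  proof
    fix m assume "m \<in> keys (F * F')"
    then obtain a b where ab: "m = a + b" "a \<in> keys F" "b \<in> keys F'" using keys_mult[of F F'] by blast
    then have "a \<in> box k" "b \<in> box k'" using that by auto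
    then show "m \<in> box (k + k')" unfolding ab(1) box_def
      by (auto simp: keys_add_nat lookup_add distrib_left intro: add_mono)
  qed
  have boxp: "keys (G i ^ j) \<subseteq> box j" if "i \<le> l" for i j
  proof (induction j)
    case (Suc j)
    have "keys (G i) \<subseteq> box 1" using G(1)[OF that] e[OF that] by (auto simp: box_def vars_def)
    from boxm[OF this Suc] show ?case by simp
  qed (use box1 in simp)
  \<comment> \<open>Only the functions with indices up to \<open>Suc D\<close> are used. An element
    of \<open>A\<close> gives the exponents of all of them except \<open>G 0\<close>.\<close>
  define A where "A = {1..Suc D} \<rightarrow>\<^sub>E {..K}"
  have A: "finite A" "card A = Suc K ^ Suc D" unfolding A_def by (auto simp: card_PiE intro!: finite_PiE)
  have sumA: "(\<Sum>i = 1..Suc D. a i) \<le> N" if "a \<in> A" for a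
  proof -
    have "(\<Sum>i = 1..Suc D. a i) \<le> (\<Sum>i = 1..Suc D. K)"
      by (rule sum_mono) (use that in \<open>auto simp: A_def dest!: PiE_mem\<close>)
    then show ?thesis by (simp add: N_def)
  qed
  \<comment> \<open>The exponent of \<open>G 0\<close> fills up the total degree to
    \<open>N\<close>, so that the resulting relation is homogeneous.\<close>
  define b where "b = (\<lambda>(a :: nat \<Rightarrow> nat) i. if i = 0 then N - (\<Sum>i = 1..Suc D. a i) else a i)"
  define ma where "ma = (\<lambda>a. \<Sum>i\<le>Suc D. single i (b a i))"
  define Ga where "Ga = (\<lambda>a. \<Prod>i\<le>Suc D. G i ^ b a i)"
  have bsum: "(\<Sum>i\<le>Suc D. b a i) = N" if "a \<in> A" for a
  proof -
    have "{..Suc D} = insert 0 {1..Suc D}" by auto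
    then have "(\<Sum>i\<le>Suc D. b a i) = b a 0 + (\<Sum>i\<in>{1..Suc D}. b a i)" by simp
    also have "(\<Sum>i\<in>{1..Suc D}. b a i) = (\<Sum>i = 1..Suc D. a i)" by (rule sum.cong) (auto simp: b_def)
    finally show ?thesis using sumA[OF that] by (simp add: b_def)
  qed
  have "keys (\<Prod>i\<in>I. G i ^ b a i) \<subseteq> box (\<Sum>i\<in>I. b a i)" if "finite I" "I \<subseteq> {..l}" for a I
    using that by (induction I rule: finite_induct) (use box1 boxm boxp in auto)
  then have Gbox: "keys (Ga a) \<subseteq> box N" if "a \<in> A" for a
    using Dl bsum[OF that] unfolding Ga_def by (metis atMost_subset_iff finite_atMost)
  have card: "finite (box N)" "card (box N) < card A"
    using finite_box[OF assms(1), of "e * N"] K unfolding A(2) box_def N_def D_def by auto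
  obtain c where c: "\<exists>a\<in>A. c a \<noteq> 0" "\<forall>m\<in>box N. (\<Sum>a\<in>A. c a * lookup (Ga a) m) = 0"
    using underdetermined_system[OF card(1) A(1) card(2), of "\<lambda>a. lookup (Ga a)"] by blast
  define P where "P = (\<Sum>a\<in>A. single (ma a) (c a))"
  have lma: "lookup (ma a) i = (if i \<le> Suc D then b a i else 0)" for a i
    by (auto simp: ma_def lookup_sum lookup_single when_def simp del: sum.atMost_Suc)
  have inj: "a = a'" if "a \<in> A" "a' \<in> A" "ma a = ma a'" for a a'
  proof (rule PiE_ext[OF that(1,2)[unfolded A_def]])
    fix i assume i: "i \<in> {1..Suc D}"
    show "a i = a' i" using arg_cong[OF that(3), of "\<lambda>m. lookup m i"] i by (auto simp: lma b_def split: if_splits)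
  qed
  have "P = 0"
  proof (rule hom_indepD[OF assms(3)])
    show "homogeneous N P" unfolding P_def
      by (intro homogeneous_on_sum homogeneous_on_single) (simp add: ma_def mdeg_sum mdeg_single bsum del: sum.atMost_Suc)
    show "vars P \<subseteq> {..l}"
    proof -
      have "keys (ma a) \<subseteq> {..l}" for a using Dl by (auto simp: in_keys_iff lma split: if_splits)
      then show ?thesis unfolding P_def using vars_sum[of "\<lambda>a. single (ma a) (c a)" A] vars_single by fastforce
    qed
    fix y
    have "mon_eval (ma a) (\<lambda>i. g i y) = eval_poly (Ga a) y" for a
    proof -
      have "mon_eval (ma a) (\<lambda>i. g i y) = (\<Prod>i\<le>Suc D. g i y ^ b a i)"
        unfolding ma_def mon_eval_sum by simp
      also have "\<dots> = (\<Prod>i\<le>Suc D. eval_poly (G i) y ^ b a i)"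
        by (rule prod.cong) (use G(2) Dl in auto)
      finally show ?thesis by (simp add: Ga_def eval_poly_prod eval_poly_power del: sum.atMost_Suc prod.atMost_Suc)
    qed
    then have "eval_poly P (\<lambda>i. g i y) = (\<Sum>a\<in>A. c a * eval_poly (Ga a) y)"
      by (simp add: P_def eval_poly_sum)
    also have "\<dots> = (\<Sum>a\<in>A. \<Sum>m\<in>box N. c a * lookup (Ga a) m * mon_eval m y)"
      by (rule sum.cong)
        (simp_all add: eval_poly_supset[OF card(1) Gbox] mon_eval_def sum_distrib_left mult_ac)
    also have "\<dots> = (\<Sum>m\<in>box N. (\<Sum>a\<in>A. c a * lookup (Ga a) m) * mon_eval m y)"
      by (subst sum.swap) (simp add: sum_distrib_right)
    finally show "eval_poly P (\<lambda>i. g i y) = 0" using c(2) by simp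
  qed
  moreover obtain a where a: "a \<in> A" "c a \<noteq> 0" using c(1) by blast
  have "lookup P (ma a) = (\<Sum>a'\<in>A. if a' = a then c a' else 0)"
    unfolding P_def lookup_sum lookup_single by (rule sum.cong) (use inj a in \<open>auto simp: when_def\<close>)
  then have "lookup P (ma a) = c a" using a A by simp
  ultimately show False using a by simp
qed

lemma hom_indep_slice_le_card:
  assumes "finite V0" "\<And>i. i \<le> l \<Longrightarrow> poly_fun V (g i)" "hom_indep (slice V0 y0) l g"
  shows "l \<le> card V0"
proof (rule hom_indep_le_card[OF assms(1)])
  \<comment> \<open>The slice is an affine space with the coordinates \<open>V0\<close>;
    \<open>?o t\<close> is its point with coordinates \<open>t\<close>.\<close>
  let ?o = "\<lambda>t v. if v \<in> V0 then t v else y0 v"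
  show "poly_fun V0 (\<lambda>t. g i (?o t))" if "i \<le> l" for i
    by (rule poly_fun_compose[OF assms(2)[OF that]]) (auto intro!: poly_fun_if poly_fun.intros)
  show "hom_indep UNIV l (\<lambda>i t. g i (?o t))"
    unfolding hom_indep_def
  proof (intro allI impI)
    fix k P assume P: "homogeneous k P" "vars P \<subseteq> {..l}" "\<forall>t\<in>UNIV. eval_poly P (\<lambda>i. g i (?o t)) = 0"
    show "P = 0"
    proof (rule hom_indepD[OF assms(3) P(1,2)])
      fix y assume "y \<in> slice V0 y0"
      then have "?o y = y" by (auto simp: slice_def)
      then show "eval_poly P (\<lambda>i. g i y) = 0" using P(3) by (metis UNIV_I)
    qed
  qed
qed

text \<open>A relation of minimal degree is excluded by differentiating it along the slice.\<close>

lemma hom_indep_if_jacobian: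
  assumes g: "\<And>i. i \<le> l \<Longrightarrow> poly_fun V (g i)" and w: "\<And>j. 0 < j \<Longrightarrow> j \<le> l \<Longrightarrow> w j \<in> V0"
    and J: "Determinant.det (Matrix.mat (Suc l) (Suc l)
      (\<lambda>(j, i). if j = 0 then g i y0 else dird (unit_at (w j)) (g i) y0)) \<noteq> 0"
  shows "hom_indep (slice V0 y0) l g"
proof -
  define M where "M = (\<lambda>y j i. if j = 0 then g i y else dird (unit_at (w j)) (g i) y)"
  define \<delta> where "\<delta> = (\<lambda>y. Determinant.det (Matrix.mat (Suc l) (Suc l) (\<lambda>(j, i). M y j i)))"
  have \<delta>: "poly_fun V \<delta>" unfolding \<delta>_def
    by (rule poly_fun_det) (auto simp: M_def g intro!: poly_fun_if poly_fun_dird)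
  have \<delta>0: "\<delta> y0 \<noteq> 0" using J by (simp add: \<delta>_def M_def)
  have "P = 0" if "homogeneous k P" "vars P \<subseteq> {..l}" "\<And>y. y \<in> slice V0 y0 \<Longrightarrow> eval_poly P (\<lambda>i. g i y) = 0" for k P
    using that
  proof (induction k arbitrary: P)
    case 0
    then obtain c where "P = single 0 c" by (elim homogeneous_0_cases)
    then show ?case using 0(3)[of y0] by simp
  next
    case (Suc k)
    define h where "h = (\<lambda>i y. eval_poly (partial_deriv i P) (\<lambda>i. g i y))"
    have pfP: "poly_fun {..l} (eval_poly P)" by (rule poly_fun_eval_poly) (use Suc in auto)
    have pfPg: "poly_fun V (\<lambda>y. eval_poly P (\<lambda>i. g i y))"
      by (rule poly_fun_compose[OF pfP]) (use g in auto)
    have pfh: "poly_fun V (h i)" for i unfolding h_def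
      by (rule poly_fun_compose[OF poly_fun_eval_poly[of _ "{..l}"]])
        (use g vars_partial_deriv[of i P] Suc in auto)
    \<comment> \<open>Row 0 is Euler's identity for the relation, and row \<open>j\<close> is the
      derivative of the relation along \<open>w j\<close>. So the partial derivatives of
      \<open>P\<close>, evaluated at the functions, form a kernel vector of the matrix
      \<open>M y\<close>.\<close>
    have row: "(\<Sum>i<Suc l. M y j i * h i y) = 0" if y: "y \<in> slice V0 y0" and j: "j < Suc l" for y j
    proof (cases "j = 0")
      case True
      then have "(\<Sum>i<Suc l. M y j i * h i y) = (\<Sum>i\<le>l. g i y * eval_poly (partial_deriv i P) (\<lambda>i. g i y))"
        by (simp add: M_def h_def lessThan_Suc_atMost)
      also have "\<dots> = of_nat (Suc k) * eval_poly P (\<lambda>i. g i y)"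
        by (rule euler_homogeneous) (use Suc in auto)
      finally show ?thesis using Suc.prems(3)[OF y] by simp
    next
      case False
      have "(\<lambda>y. eval_poly P (\<lambda>i. g i y)) \<in> vanishing V (slice V0 y0) 0" using pfPg Suc.prems(3) by simp
      from vanishing_tangential[OF _ this, of "w j"]
      have "0 = dird (unit_at (w j)) (\<lambda>y. eval_poly P (\<lambda>i. g i y)) y" using w[of j] False j y by auto
      also have "\<dots> = dird (\<lambda>i. dird (unit_at (w j)) (g i) y) (eval_poly P) (\<lambda>i. g i y)"
        by (rule dird_chain[OF pfP, of V]) (use g in auto)
      also have "\<dots> = (\<Sum>i\<le>l. dird (unit_at (w j)) (g i) y * dird (unit_at i) (eval_poly P) (\<lambda>i. g i y))"
        by (rule dird_unit_expansion[OF pfP]) simp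
      finally show ?thesis using False by (simp add: M_def h_def eval_partial_deriv lessThan_Suc_atMost)
    qed
    have zero: "h i y = 0" if y: "y \<in> slice V0 y0" and i: "i \<le> l" for i y
    proof (rule ccontr)
      assume "h i y \<noteq> 0"
      \<comment> \<open>Only \<delta> y0 is known to be nonzero; irreducibility of the slice moves
        to a point where the matrix is invertible and \<open>h i\<close> is still nonzero.\<close>
      then obtain z where z: "z \<in> slice V0 y0" "\<delta> z \<noteq> 0" "h i z \<noteq> 0"
        using poly_fun_slice_nonzero2[of V \<delta> "h i" y0 V0 y0 y] \<delta> \<delta>0 y pfh by auto
      let ?M = "Matrix.mat (Suc l) (Suc l) (\<lambda>(j, i). M z j i)"
      have "?M *\<^sub>v vec (Suc l) (\<lambda>i. h i z) = 0\<^sub>v (Suc l)"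
        by (rule eq_vecI) (use row[OF z(1)] in \<open>auto simp: scalar_prod_def atLeast0LessThan\<close>)
      then have "vec (Suc l) (\<lambda>i. h i z) = 0\<^sub>v (Suc l)"
        using det_0_iff_vec_prod_zero[of ?M "Suc l"] z(2) vec_carrier[of "Suc l" "\<lambda>i. h i z"]
        unfolding \<delta>_def by (metis mat_carrier)
      then have "vec (Suc l) (\<lambda>i. h i z) $ i = 0\<^sub>v (Suc l) $ i" by simp
      then show False using z(3) i by simp
    qed
    have "partial_deriv i P = 0" for i
    proof (cases "i \<le> l")
      case True
      show ?thesis
        by (rule Suc.IH) (use zero True Suc.prems vars_partial_deriv[of i P] in
            \<open>auto simp: h_def homogeneous_partial_deriv\<close>)
    qed (use Suc.prems in \<open>auto intro: partial_deriv_eq_0\<close>)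
    then show ?case using eq_0_if_partial_derivs_0[OF Suc.prems(1)] by blast
  qed
  then show ?thesis unfolding hom_indep_def by blast
qed

section \<open>Forms in the Plucker coordinates\<close>

text \<open>Plucker coordinates as functions of the coordinates \<open>z (i, m)\<close> of a tuple
  of vectors, so that they can be differentiated.\<close>

definition pl :: "nat \<Rightarrow> (nat \<times> 'i \<Rightarrow> complex) \<Rightarrow> 'i list \<Rightarrow> complex" where
  "pl r z I = Determinant.det (Matrix.mat r r (\<lambda>(i, j). z (i, I ! j)))"

text \<open>The bridge between families, in which repetitions count, and the sets of vectors in
  \<open>is_basis\<close>.\<close>

lemma fam_indep_list:
  fixes vs :: "('i \<Rightarrow>\<^sub>0 complex) list"
  shows "fam_indep {..<length vs} (\<lambda>i. lookup (vs ! i)) \<longleftrightarrow> distinct vs \<and> cvs.independent (set vs)"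
proof
  assume *: "distinct vs \<and> cvs.independent (set vs)"
  show "fam_indep {..<length vs} (\<lambda>i. lookup (vs ! i))"
    unfolding fam_indep_def
  proof (intro allI impI ballI)
    fix c i assume c: "\<forall>x. (\<Sum>k<length vs. c k * lookup (vs ! k) x) = 0" and i: "i \<in> {..<length vs}"
    have inj: "inj_on ((!) vs) {..<length vs}" using * by (auto simp: inj_on_def nth_eq_iff_index_eq)
    have im: "(!) vs ` {..<length vs} = set vs" by (auto simp: set_conv_nth)
    define g where "g = c \<circ> the_inv_into {..<length vs} ((!) vs)"
    have g: "g (vs ! k) = c k" if "k < length vs" for k
      using the_inv_into_f_f[OF inj, of k] that by (simp add: g_def)
    have "(\<Sum>v\<in>set vs. cscale (g v) v) = (\<Sum>k<length vs. cscale (c k) (vs ! k))"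
      unfolding im[symmetric] by (simp add: sum.reindex[OF inj] g)
    also have "\<dots> = 0" by (rule poly_mapping_eqI) (use c in \<open>simp add: lookup_sum\<close>)
    finally have "(\<Sum>v\<in>set vs. cscale (g v) v) = 0" .
    then have "g (vs ! i) = 0" using * i unfolding cvs.dependent_finite[OF finite_set] by (metis lessThan_iff nth_mem)
    then show "c i = 0" using g i by simp
  qed
next
  assume f: "fam_indep {..<length vs} (\<lambda>i. lookup (vs ! i))"
  have d: "distinct vs"
  proof (rule ccontr)
    assume "\<not> distinct vs"
    then obtain i j where ij: "i < length vs" "j < length vs" "i \<noteq> j" "vs ! i = vs ! j"
      by (auto simp: distinct_conv_nth)
    define c where "c = (\<lambda>k. if k = i then 1 else if k = j then - 1 else (0::complex))"
    have "(\<Sum>k<length vs. c k * lookup (vs ! k) x) = (\<Sum>k\<in>{i, j}. c k * lookup (vs ! k) x)" for x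
      by (rule sum.mono_neutral_right) (use ij in \<open>auto simp: c_def\<close>)
    then have "(\<Sum>k<length vs. c k * lookup (vs ! k) x) = 0" for x using ij by (simp add: c_def)
    from fam_indepD[OF f this, of i] ij show False by (simp add: c_def)
  qed
  have inj: "inj_on ((!) vs) {..<length vs}" using d by (auto simp: inj_on_def nth_eq_iff_index_eq)
  have im: "(!) vs ` {..<length vs} = set vs" by (auto simp: set_conv_nth)
  have "cvs.independent (set vs)"
  proof (rule cvs.independent_if_scalars_zero)
    fix g x assume g: "(\<Sum>v\<in>set vs. cscale (g v) v) = 0" and x: "x \<in> set vs"
    then have "(\<Sum>k<length vs. cscale (g (vs ! k)) (vs ! k)) = 0"
      unfolding im[symmetric] by (simp add: sum.reindex[OF inj])
    then have "lookup (\<Sum>k<length vs. cscale (g (vs ! k)) (vs ! k)) m = 0" for m by simp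
    then have "(\<Sum>k<length vs. g (vs ! k) * lookup (vs ! k) m) = 0" for m by (simp add: lookup_sum)
    from fam_indepD[OF f this] x show "g x = 0" by (auto simp: set_conv_nth)
  qed simp
  then show "distinct vs \<and> cvs.independent (set vs)" using d by simp
qed

lemma is_basis_length:
  assumes "is_basis vs \<Lambda>" "\<Lambda> \<in> grass r W"
  shows "length vs = r"
proof -
  have "cvs.dim \<Lambda> = card (set vs)" using assms(1) unfolding is_basis_def
    by (metis cvs.dim_eq_card_independent cvs.dim_span)
  then show ?thesis using assms by (simp add: grass_def is_basis_def distinct_card)
qed

lemma plucker_nonzero_if_basis:
  assumes "is_basis vs \<Lambda>" "\<Lambda> \<in> grass r W"
  shows "\<exists>I. length I = r \<and> plucker r vs I \<noteq> 0"
  using ex_minor_if_fam_indep[of r "\<lambda>i. lookup (vs ! i)"] fam_indep_list[of vs] is_basis_length[OF assms] assms(1)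
  unfolding is_basis_def plucker_def by auto

lemma is_basis_if_plucker_nonzero:
  assumes "length vs = r" "plucker r vs I \<noteq> 0" "set vs \<subseteq> W" "cvs.subspace W"
  shows "is_basis vs (cvs.span (set vs))" "cvs.span (set vs) \<in> grass r W"
proof -
  have *: "distinct vs" "cvs.independent (set vs)"
    using fam_indep_if_minor[of r "\<lambda>i. lookup (vs ! i)" "(!) I"] assms(1,2) fam_indep_list[of vs]
    by (auto simp: plucker_def)
  then show "is_basis vs (cvs.span (set vs))" by (simp add: is_basis_def)
  show "cvs.span (set vs) \<in> grass r W"
    using * assms cvs.span_minimal[of "set vs" W]
    by (auto simp: grass_def cvs.dim_eq_card_independent distinct_card)
qed

lemma plucker_change_basis:
  assumes "is_basis vs \<Lambda>" "is_basis vs' \<Lambda>" "\<Lambda> \<in> grass r W"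
  shows "\<exists>c. \<forall>I. plucker r vs' I = c * plucker r vs I"
proof -
  have l: "length vs = r" "length vs' = r" using is_basis_length assms by blast+
  have d: "distinct vs" using assms by (simp add: is_basis_def)
  have inj: "inj_on ((!) vs) {..<r}" using d l by (auto simp: inj_on_def nth_eq_iff_index_eq)
  have im: "set vs = (!) vs ` {..<r}" using l by (auto simp: set_conv_nth)
  have "\<exists>g. i < r \<longrightarrow> vs' ! i = (\<Sum>k<r. cscale (g k) (vs ! k))" for i
  proof (cases "i < r")
    case True
    then have "vs' ! i \<in> cvs.span (set vs)"
      using assms l by (metis cvs.span_base is_basis_def nth_mem)
    then obtain u where "vs' ! i = (\<Sum>v\<in>set vs. cscale (u v) v)"
      using cvs.span_finite[of "set vs"] by auto
    then show ?thesis unfolding im by (auto simp: sum.reindex[OF inj])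
  qed simp
  then obtain g where g: "\<And>i. i < r \<Longrightarrow> vs' ! i = (\<Sum>k<r. cscale (g i k) (vs ! k))" by metis
  have "plucker r vs' I = Determinant.det (Matrix.mat r r (\<lambda>(i, k). g i k)) * plucker r vs I" for I
  proof -
    have "Matrix.mat r r (\<lambda>(i, j). lookup (vs' ! i) (I ! j)) =
        Matrix.mat r r (\<lambda>(i, k). g i k) * Matrix.mat r r (\<lambda>(i, j). lookup (vs ! i) (I ! j))"
      by (rule eq_matI) (simp_all add: g lookup_sum scalar_prod_def atLeast0LessThan)
    then show ?thesis unfolding plucker_def
      using det_mult[of "Matrix.mat r r (\<lambda>(i, k). g i k)" r "Matrix.mat r r (\<lambda>(i, j). lookup (vs ! i) (I ! j))"]
      by simp
  qed
  then show ?thesis by blast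
qed

section \<open>The Zariski topology of the Grassmannian in terms of forms\<close>

definition pforms :: "nat \<Rightarrow> nat \<Rightarrow> 'i list cpoly set" where
  "pforms r e = {F. homogeneous e F \<and> vars F \<subseteq> {I. length I = r}}"

lemma pforms_mult: "F \<in> pforms r e \<Longrightarrow> G \<in> pforms r e' \<Longrightarrow> F * G \<in> pforms r (e + e')"
  using vars_mult[of F G] by (auto simp: pforms_def homogeneous_on_mult)

lemma pforms_power: "F \<in> pforms r e \<Longrightarrow> F ^ k \<in> pforms r (k * e)"
  using vars_power[of F k] by (auto simp: pforms_def homogeneous_on_power)

lemma pforms_subst:
  assumes "homogeneous k P" "\<And>i. i \<in> vars P \<Longrightarrow> F i \<in> pforms r e"
  shows "poly_subst P F \<in> pforms r (k * e)"
  using assms homogeneous_poly_subst[of k P e F] vars_poly_subst[of P F "{I. length I = r}"]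
  by (auto simp: pforms_def)

lemma pforms_coordinate: "length I = r \<Longrightarrow> single (single I 1) 1 \<in> pforms r 1"
  using vars_single[of "single I 1" 1] by (auto simp: pforms_def homogeneous_on_single mdeg_single)

definition nonvanishing :: "nat \<Rightarrow> 'i list cpoly \<Rightarrow> ('i \<Rightarrow>\<^sub>0 complex) set \<Rightarrow> bool" where
  "nonvanishing r F \<Lambda> \<longleftrightarrow> (\<exists>vs. is_basis vs \<Lambda> \<and> eval_poly F (plucker r vs) \<noteq> 0)"

lemma nonvanishing_iff:
  assumes "is_basis vs \<Lambda>" "\<Lambda> \<in> grass r W" "F \<in> pforms r e"
  shows "nonvanishing r F \<Lambda> \<longleftrightarrow> eval_poly F (plucker r vs) \<noteq> 0"
proof
  assume "nonvanishing r F \<Lambda>"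
  then obtain vs' where vs': "is_basis vs' \<Lambda>" "eval_poly F (plucker r vs') \<noteq> 0" by (auto simp: nonvanishing_def)
  obtain c where "\<forall>I. plucker r vs' I = c * plucker r vs I"
    using plucker_change_basis[OF assms(1) vs'(1) assms(2)] by blast
  then have "plucker r vs' = (\<lambda>I. c * plucker r vs I)" by blast
  then show "eval_poly F (plucker r vs) \<noteq> 0"
    using vs'(2) assms(3) eval_poly_scale[of e F c "plucker r vs"] by (auto simp: pforms_def)
qed (use assms in \<open>auto simp: nonvanishing_def\<close>)

lemma ex_basis_grass:
  assumes "\<Lambda> \<in> grass r W" "r > 0"
  shows "\<exists>vs. is_basis vs \<Lambda>"
  using ex_basis[of \<Lambda>] assms by (auto simp: grass_def)

lemma nonvanishing_mult:
  assumes "\<Lambda> \<in> grass r W" "r > 0" "F \<in> pforms r e" "G \<in> pforms r e'"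
  shows "nonvanishing r (F * G) \<Lambda> \<longleftrightarrow> nonvanishing r F \<Lambda> \<and> nonvanishing r G \<Lambda>"
proof -
  obtain vs where vs: "is_basis vs \<Lambda>" using ex_basis_grass assms by blast
  show ?thesis
    using nonvanishing_iff[OF vs assms(1,3)] nonvanishing_iff[OF vs assms(1,4)] nonvanishing_iff[OF vs assms(1) pforms_mult[OF assms(3,4)]]
    by (simp add: eval_poly_mult)
qed

lemma nonvanishing_power:
  assumes "\<Lambda> \<in> grass r W" "r > 0" "F \<in> pforms r e" "nonvanishing r F \<Lambda>"
  shows "nonvanishing r (F ^ k) \<Lambda>"
proof -
  obtain vs where vs: "is_basis vs \<Lambda>" using ex_basis_grass assms by blast
  show ?thesis
    using nonvanishing_iff[OF vs assms(1,3)] nonvanishing_iff[OF vs assms(1) pforms_power[OF assms(3)]] assms(4)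
    by (simp add: eval_poly_power)
qed

lemma openin_zariski_basic:
  assumes "F \<in> pforms r e"
  shows "openin (zariski_grass r W) {\<Lambda> \<in> grass r W. nonvanishing r F \<Lambda>}"
  unfolding zariski_grass_def
  by (rule topology_generated_by_Basis) (use assms in \<open>auto simp: pforms_def nonvanishing_def\<close>)

text \<open>The product of two forms defines the intersection of their non-vanishing sets; so the
  generating sets are a base and not just a subbase.\<close>

lemma zariski_base:
  assumes "openin (zariski_grass r W) U" "\<Lambda> \<in> U" "r > 0"
  shows "\<exists>e. \<exists>F\<in>pforms r e. nonvanishing r F \<Lambda> \<and> {\<Lambda> \<in> grass r W. nonvanishing r F \<Lambda>} \<subseteq> U"
proof -
  have top: "U \<subseteq> grass r W" if "openin (zariski_grass r W) U" for U
    using openin_subset[OF that] topspace_zariski_grass[OF assms(3)] by blast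
  have "generate_topology_on {{\<Lambda> \<in> grass r W. \<exists>vs. is_basis vs \<Lambda> \<and> eval_poly F (plucker r vs) \<noteq> 0} | F.
        (\<exists>k. homogeneous k F) \<and> vars F \<subseteq> {I. length I = r}} U"
    using assms(1) by (simp add: zariski_grass_def openin_topology_generated_by_iff)
  then show ?thesis using assms(2)
  proof (induction arbitrary: \<Lambda> rule: generate_topology_on.induct)
    case (Int a b)
    obtain e F where F: "F \<in> pforms r e" "nonvanishing r F \<Lambda>" "{\<Lambda> \<in> grass r W. nonvanishing r F \<Lambda>} \<subseteq> a" using Int by blast
    obtain e' G where G: "G \<in> pforms r e'" "nonvanishing r G \<Lambda>" "{\<Lambda> \<in> grass r W. nonvanishing r G \<Lambda>} \<subseteq> b" using Int by blast
    have "openin (zariski_grass r W) a"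
      using Int.hyps by (simp add: zariski_grass_def openin_topology_generated_by_iff)
    then have "\<Lambda> \<in> grass r W" using top Int.prems by blast
    then show ?case using F G nonvanishing_mult[OF _ assms(3) F(1) G(1)] pforms_mult[OF F(1) G(1)]
      by (intro exI[of _ "e + e'"] bexI[of _ "F * G"]) auto
  next
    case (UN K)
    then obtain k where k: "k \<in> K" "\<Lambda> \<in> k" by blast
    then show ?case using UN.IH[OF k] by blast
  next
    case (Basis U)
    then obtain F k where F: "U = {\<Lambda> \<in> grass r W. nonvanishing r F \<Lambda>}" "F \<in> pforms r k"
      unfolding pforms_def nonvanishing_def by auto
    then show ?case using Basis by blast
  qed simp
qed

lemma in_closure_zariski_iff:
  assumes "r > 0" "Y \<subseteq> grass r W"
  shows "\<Lambda> \<in> zariski_grass r W closure_of Y \<longleftrightarrow>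
    \<Lambda> \<in> grass r W \<and> (\<forall>e. \<forall>F\<in>pforms r e. nonvanishing r F \<Lambda> \<longrightarrow> (\<exists>\<Lambda>'\<in>Y. nonvanishing r F \<Lambda>'))"
proof
  assume *: "\<Lambda> \<in> zariski_grass r W closure_of Y"
  then have "\<Lambda> \<in> grass r W" by (auto simp: in_closure_of topspace_zariski_grass[OF assms(1)])
  moreover have "\<exists>\<Lambda>'\<in>Y. nonvanishing r F \<Lambda>'" if "F \<in> pforms r e" "nonvanishing r F \<Lambda>" for F e
    using * openin_zariski_basic[OF that(1), of W] that \<open>\<Lambda> \<in> grass r W\<close>
    unfolding in_closure_of by (metis (mono_tags, lifting) mem_Collect_eq)
  ultimately show "\<Lambda> \<in> grass r W \<and> (\<forall>e. \<forall>F\<in>pforms r e. nonvanishing r F \<Lambda> \<longrightarrow> (\<exists>\<Lambda>'\<in>Y. nonvanishing r F \<Lambda>'))" by blast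
next
  assume *: "\<Lambda> \<in> grass r W \<and> (\<forall>e. \<forall>F\<in>pforms r e. nonvanishing r F \<Lambda> \<longrightarrow> (\<exists>\<Lambda>'\<in>Y. nonvanishing r F \<Lambda>'))"
  show "\<Lambda> \<in> zariski_grass r W closure_of Y"
    unfolding in_closure_of
  proof (intro conjI allI impI)
    show "\<Lambda> \<in> topspace (zariski_grass r W)" using * topspace_zariski_grass[OF assms(1)] by blast
    fix T assume T: "\<Lambda> \<in> T \<and> openin (zariski_grass r W) T"
    then obtain e F where F: "F \<in> pforms r e" "nonvanishing r F \<Lambda>" "{\<Lambda> \<in> grass r W. nonvanishing r F \<Lambda>} \<subseteq> T"
      using zariski_base[of r W T \<Lambda>] assms(1) by blast
    then show "\<exists>y. y \<in> Y \<and> y \<in> T" using * assms(2) by blast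
  qed
qed

lemma separating_form:
  assumes "closedin (zariski_grass r W) Z" "\<Lambda> \<in> grass r W" "\<Lambda> \<notin> Z" "r > 0"
  shows "\<exists>e. \<exists>F\<in>pforms r e. nonvanishing r F \<Lambda> \<and> (\<forall>\<Lambda>'\<in>Z. \<not> nonvanishing r F \<Lambda>')"
proof -
  have top: "topspace (zariski_grass r W) = grass r W" by (rule topspace_zariski_grass[OF assms(4)])
  have "openin (zariski_grass r W) (grass r W - Z)" "Z \<subseteq> grass r W"
    using assms(1) unfolding closedin_def top by auto
  from zariski_base[OF this(1), of \<Lambda>] this(2) assms show ?thesis by blast
qed

text \<open>Otherwise the zero loci of \<open>F\<close> and \<open>G\<close> would be closed sets
  that cover \<open>Z\<close>, neither of which contains it.\<close>

lemma irreducible_closed_nz: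
  assumes Z: "irreducible_closed (zariski_grass r W) Z" and "r > 0" "F \<in> pforms r e" "G \<in> pforms r e'"
    and "\<exists>\<Lambda>\<in>Z. nonvanishing r F \<Lambda>" "\<exists>\<Lambda>\<in>Z. nonvanishing r G \<Lambda>"
  shows "\<exists>\<Lambda>\<in>Z. nonvanishing r F \<Lambda> \<and> nonvanishing r G \<Lambda>"
proof (rule ccontr)
  assume *: "\<not> (\<exists>\<Lambda>\<in>Z. nonvanishing r F \<Lambda> \<and> nonvanishing r G \<Lambda>)"
  have top: "topspace (zariski_grass r W) = grass r W" by (rule topspace_zariski_grass[OF assms(2)])
  have cl: "closedin (zariski_grass r W) {\<Lambda> \<in> grass r W. \<not> nonvanishing r F \<Lambda>}" if "F \<in> pforms r e" for F e
  proof -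
    have "grass r W - {\<Lambda> \<in> grass r W. \<not> nonvanishing r F \<Lambda>} = {\<Lambda> \<in> grass r W. nonvanishing r F \<Lambda>}" by auto
    then show ?thesis unfolding closedin_def top using openin_zariski_basic[OF that, of W] by auto
  qed
  have "Z \<subseteq> grass r W" using Z closedin_subset top unfolding irreducible_closed_def by blast
  then have "Z \<subseteq> {\<Lambda> \<in> grass r W. \<not> nonvanishing r F \<Lambda>} \<union> {\<Lambda> \<in> grass r W. \<not> nonvanishing r G \<Lambda>}" using * by blast
  then have "Z \<subseteq> {\<Lambda> \<in> grass r W. \<not> nonvanishing r F \<Lambda>} \<or> Z \<subseteq> {\<Lambda> \<in> grass r W. \<not> nonvanishing r G \<Lambda>}"
    using Z cl[OF assms(3)] cl[OF assms(4)] unfolding irreducible_closed_def by blast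
  then show False using assms(5,6) by blast
qed

text \<open>A chain of irreducible closed sets yields forms without a homogeneous relation: \<open>F i\<close> vanishes on
  \<open>Z (i - 1)\<close> but not on \<open>Z i\<close>. Splitting a relation as \<open>P = P\<^sub>0 + x\<^sub>l P\<^sub>1\<close>, the part \<open>P\<^sub>0\<close> is a relation on
  the smaller set, and \<open>P\<^sub>1\<close> is one of smaller degree.\<close>

lemma hom_indep_forms_of_chain:
  fixes W :: "('i \<Rightarrow>\<^sub>0 complex) set"
  assumes r: "r > 0" and Z: "\<And>i. i \<le> l \<Longrightarrow> irreducible_closed (zariski_grass r W) (Z i)"
    and chain: "\<And>i. i < l \<Longrightarrow> Z i \<subset> Z (Suc i)"
  shows "\<exists>e F. (\<forall>i\<le>l. F i \<in> pforms r e) \<and> (\<forall>k P. homogeneous k P \<longrightarrow> vars P \<subseteq> {..l} \<longrightarrow>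
    (\<forall>\<Lambda>\<in>Z l. \<not> nonvanishing r (poly_subst P F) \<Lambda>) \<longrightarrow> P = 0)"
proof -
  have top: "topspace (zariski_grass r W) = grass r W" by (rule topspace_zariski_grass[OF r])
  have sub: "Z i \<subseteq> grass r W" if "i \<le> l" for i
    using Z[OF that] closedin_subset top unfolding irreducible_closed_def by blast
  obtain \<Lambda>0 where \<Lambda>0: "\<Lambda>0 \<in> Z 0" using Z[of 0] unfolding irreducible_closed_def by blast
  have mono: "Z i \<subseteq> Z j" if "i \<le> j" "j \<le> l" for i j
    using that
  proof (induction rule: dec_induct)
    case (step n)
    then show ?case using chain[of n] by auto
  qed simp
  obtain vs0 where vs0: "is_basis vs0 \<Lambda>0" using ex_basis_grass[of \<Lambda>0 r W] r sub[of 0] \<Lambda>0 by blast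
  obtain I where I: "length I = r" "plucker r vs0 I \<noteq> 0"
    using plucker_nonzero_if_basis[OF vs0, of r W] sub[of 0] \<Lambda>0 by blast
  \<comment> \<open>A coordinate that is nonzero at a point of the smallest set, hence of all sets
    of the chain. Powers of it bring the forms to a common degree, and by irreducibility a product
    with them still does not vanish identically.\<close>
  define p :: "'i list cpoly" where "p = single (single I 1) 1"
  have p: "p \<in> pforms r 1" unfolding p_def by (rule pforms_coordinate[OF I(1)])
  have "nonvanishing r p \<Lambda>0" using vs0 I unfolding nonvanishing_def p_def by (intro exI[of _ vs0]) simp
  then have pk: "nonvanishing r (p ^ k) \<Lambda>0" for k using nonvanishing_power[OF _ r p, of \<Lambda>0 W] sub[of 0] \<Lambda>0 by blast
  have pk': "p ^ k \<in> pforms r k" for k using pforms_power[OF p, of k] by simp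
  have "\<exists>e G. i < l \<longrightarrow> G \<in> pforms r e \<and> (\<exists>\<Lambda>\<in>Z (Suc i). nonvanishing r G \<Lambda>) \<and> (\<forall>\<Lambda>\<in>Z i. \<not> nonvanishing r G \<Lambda>)" for i
  proof (cases "i < l")
    case True
    then obtain \<Lambda> where "\<Lambda> \<in> Z (Suc i)" "\<Lambda> \<notin> Z i" using chain by blast
    moreover have "closedin (zariski_grass r W) (Z i)" using Z[of i] True unfolding irreducible_closed_def by auto
    ultimately show ?thesis using separating_form[of r W "Z i" \<Lambda>] sub[of "Suc i"] True r by fastforce
  qed simp
  then obtain d G where G: "\<And>i. i < l \<Longrightarrow> G i \<in> pforms r (d i)"
    "\<And>i. i < l \<Longrightarrow> \<exists>\<Lambda>\<in>Z (Suc i). nonvanishing r (G i) \<Lambda>" "\<And>i \<Lambda>. i < l \<Longrightarrow> \<Lambda> \<in> Z i \<Longrightarrow> \<not> nonvanishing r (G i) \<Lambda>"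
    by metis
  define e where "e = (\<Sum>i<l. d i)"
  have de: "d i \<le> e" if "i < l" for i unfolding e_def by (rule member_le_sum) (use that in auto)
  define F where "F i = (case i of 0 \<Rightarrow> p ^ e | Suc j \<Rightarrow> G j * p ^ (e - d j))" for i
  have F: "F i \<in> pforms r e" if "i \<le> l" for i
  proof (cases i)
    case (Suc j)
    then show ?thesis using pforms_mult[OF G(1)[of j] pk'[of "e - d j"]] de[of j] that by (simp add: F_def)
  qed (simp add: F_def pk')
  have FSuc: "\<exists>\<Lambda>\<in>Z (Suc i). nonvanishing r (F (Suc i)) \<Lambda>" "\<And>\<Lambda>. \<Lambda> \<in> Z i \<Longrightarrow> \<not> nonvanishing r (F (Suc i)) \<Lambda>" if i: "i < l" for i
  proof -
    have eq: "nonvanishing r (F (Suc i)) \<Lambda> \<longleftrightarrow> nonvanishing r (G i) \<Lambda> \<and> nonvanishing r (p ^ (e - d i)) \<Lambda>" if "\<Lambda> \<in> Z (Suc i)" for \<Lambda>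
      using nonvanishing_mult[OF _ r G(1)[OF i] pk', of \<Lambda> W "e - d i"] sub[of "Suc i"] that i by (auto simp: F_def)
    have "\<exists>\<Lambda>\<in>Z (Suc i). nonvanishing r (p ^ (e - d i)) \<Lambda>" using pk \<Lambda>0 mono[of 0 "Suc i"] i by auto
    from irreducible_closed_nz[OF Z[of "Suc i"] r G(1)[OF i] pk' G(2)[OF i] this]
    show "\<exists>\<Lambda>\<in>Z (Suc i). nonvanishing r (F (Suc i)) \<Lambda>" using eq i by auto
    show "\<not> nonvanishing r (F (Suc i)) \<Lambda>" if "\<Lambda> \<in> Z i" for \<Lambda>
      using eq[of \<Lambda>] G(3)[OF i that] chain[OF i] that by blast
  qed
  have nonvanishing: "nonvanishing r (poly_subst P F) \<Lambda> \<longleftrightarrow> eval_poly P (\<lambda>i. eval_poly (F i) (plucker r vs)) \<noteq> 0"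
    if "is_basis vs \<Lambda>" "\<Lambda> \<in> grass r W" "homogeneous k P" "vars P \<subseteq> {..l}" for P k \<Lambda> vs
    using nonvanishing_iff[OF that(1,2) pforms_subst[OF that(3), of F r e]] F that(4) by (auto simp: eval_poly_subst)
  have "P = 0" if "j \<le> l" "homogeneous k P" "vars P \<subseteq> {..j}" "\<And>\<Lambda>. \<Lambda> \<in> Z j \<Longrightarrow> \<not> nonvanishing r (poly_subst P F) \<Lambda>" for j k P
    using that
  proof (induction j arbitrary: k P)
    case 0
    have "eval_poly P (\<lambda>i. eval_poly (F i) (plucker r vs0)) = 0"
      using nonvanishing[OF vs0 _ 0(2)] 0(3,4) \<Lambda>0 sub[of 0] by auto
    moreover have F0: "eval_poly (F 0) (plucker r vs0) \<noteq> 0" using I by (simp add: F_def p_def eval_poly_power)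
    moreover have P: "P = single (single 0 k) (lookup P (single 0 k))"
    proof (rule poly_mapping_eqI)
      fix m show "lookup P m = lookup (single (single 0 k) (lookup P (single 0 k))) m"
      proof (cases "m \<in> keys P")
        case True
        then have "keys m \<subseteq> {0}" "mdeg UNIV m = k" using 0 by (auto simp: vars_def homogeneous_on_alt)
        then have "m = single 0 k"
          using mdeg_supset[of "{0}" m UNIV]
          by (intro poly_mapping_eqI) (auto simp: lookup_single when_def in_keys_iff subset_iff)
        then show ?thesis by simp
      qed (auto simp: in_keys_iff lookup_single when_def)
    qed
    have "eval_poly P (\<lambda>i. eval_poly (F i) (plucker r vs0)) = lookup P (single 0 k) * eval_poly (F 0) (plucker r vs0) ^ k"
      by (subst P) simp
    ultimately have "lookup P (single 0 k) = 0" by simp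
    then show ?case using P by simp
  next
    case (Suc j)
    from Suc.prems(2-4) show ?case
    proof (induction k arbitrary: P rule: less_induct)
      case (less k)
      obtain P0 P1 where P: "P = P0 + single (single (Suc j) 1) 1 * P1" "homogeneous k P0"
        "vars P0 \<subseteq> vars P - {Suc j}" "k = 0 \<longrightarrow> P1 = 0" "homogeneous (k - 1) P1" "vars P1 \<subseteq> vars P"
        using split_off_variable[OF less.prems(1)] by metis
      have v: "vars P \<subseteq> {..l}" "vars P0 \<subseteq> {..l}" "vars P1 \<subseteq> {..l}" using P less.prems(2) Suc.prems(1) by auto
      have ev: "eval_poly P0 (\<lambda>i. eval_poly (F i) (plucker r vs)) + eval_poly (F (Suc j)) (plucker r vs) *
          eval_poly P1 (\<lambda>i. eval_poly (F i) (plucker r vs)) = 0"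
        if "\<Lambda> \<in> Z (Suc j)" "is_basis vs \<Lambda>" for \<Lambda> vs
        using nonvanishing[OF that(2) _ less.prems(1) v(1)] less.prems(3)[OF that(1)] sub[of "Suc j"] that(1) Suc.prems(1)
        unfolding P(1) by (auto simp: eval_poly_add eval_poly_mult)
      have "P0 = 0"
      proof (rule Suc.IH[OF _ P(2)])
        show "j \<le> l" using Suc.prems by simp
        show "vars P0 \<subseteq> {..j}" using P(3) less.prems(2) by (auto simp: atMost_Suc)
        fix \<Lambda> assume \<Lambda>: "\<Lambda> \<in> Z j"
        then have g: "\<Lambda> \<in> grass r W" "\<Lambda> \<in> Z (Suc j)" using sub[of j] chain[of j] Suc.prems by auto
        obtain vs where vs: "is_basis vs \<Lambda>" using ex_basis_grass[OF g(1) r] by blast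
        have "eval_poly (F (Suc j)) (plucker r vs) = 0"
          using FSuc(2)[of j \<Lambda>] \<Lambda> vs Suc.prems(1) unfolding nonvanishing_def by auto
        then show "\<not> nonvanishing r (poly_subst P0 F) \<Lambda>" using ev[OF g(2) vs] nonvanishing[OF vs g(1) P(2) v(2)] by simp
      qed
      have "P1 = 0"
      proof (cases "k = 0")
        case False
        show ?thesis
        proof (rule less.IH[OF _ P(5)])
          show "k - 1 < k" using False by simp
          show "vars P1 \<subseteq> {..Suc j}" using P less.prems by auto
          fix \<Lambda> assume "\<Lambda> \<in> Z (Suc j)"
          show "\<not> nonvanishing r (poly_subst P1 F) \<Lambda>"
          proof
            assume "nonvanishing r (poly_subst P1 F) \<Lambda>"
            moreover have "poly_subst P1 F \<in> pforms r ((k - 1) * e)"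
              by (rule pforms_subst[OF P(5)]) (use F v in auto)
            moreover have "irreducible_closed (zariski_grass r W) (Z (Suc j))" using Z Suc.prems by blast
            \<comment> \<open>As \<open>P0\<close> is zero, the relation says that the product of
              \<open>F (Suc j)\<close> and the value of \<open>P1\<close> vanishes on
              \<open>Z (Suc j)\<close>. Neither factor vanishes identically there, so irreducibility
              yields a contradiction.\<close>
            ultimately obtain \<Lambda>' where \<Lambda>': "\<Lambda>' \<in> Z (Suc j)" "nonvanishing r (F (Suc j)) \<Lambda>'" "nonvanishing r (poly_subst P1 F) \<Lambda>'"
              using irreducible_closed_nz[OF _ r F[of "Suc j"], of W "Z (Suc j)" "poly_subst P1 F" "(k - 1) * e"]
                FSuc(1)[of j] \<open>\<Lambda> \<in> Z (Suc j)\<close> Suc.prems(1) by auto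
            have g: "\<Lambda>' \<in> grass r W" using \<Lambda>'(1) sub[of "Suc j"] Suc.prems(1) by auto
            obtain vs where vs: "is_basis vs \<Lambda>'" using ex_basis_grass[OF g r] by blast
            show False
              using ev[OF \<Lambda>'(1) vs] \<Lambda>'(2,3) nonvanishing_iff[OF vs g F[of "Suc j"]] nonvanishing[OF vs g P(5) v(3)]
                \<open>P0 = 0\<close> Suc.prems(1) by auto
          qed
        qed
      qed (use P in simp)
      then show ?case using P(1) \<open>P0 = 0\<close> by simp
    qed
  qed
  then have "\<forall>k P. homogeneous k P \<longrightarrow> vars P \<subseteq> {..l} \<longrightarrow>
    (\<forall>\<Lambda>\<in>Z l. \<not> nonvanishing r (poly_subst P F) \<Lambda>) \<longrightarrow> P = 0" by blast
  then show ?thesis using F by blast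
qed

lemma subspace_keys: "cvs.subspace {f. keys f \<subseteq> B}"
proof -
  have eq: "{f. keys f \<subseteq> B} = {f. \<forall>m. m \<notin> B \<longrightarrow> lookup f m = 0}" by (auto simp: in_keys_iff)
  show ?thesis unfolding eq cvs.subspace_def by (simp add: lookup_add)
qed

text \<open>A polynomial map from an affine space to r-tuples of vectors, regarded as a rational map
  to the Grassmannian. It is instantiated twice: with all tuples, for the dimension of the
  Grassmannian, and with the sums of powers that parametrize \<Sigma>.\<close>

locale grass_param =
  fixes r :: nat and B :: "'i set" and V :: "'v set" and \<Psi> :: "('v \<Rightarrow> complex) \<Rightarrow> nat \<times> 'i \<Rightarrow> complex"
  assumes r: "r > 0" and finB: "finite B" and finV: "finite V"
    and \<Psi>_poly: "\<And>c. poly_fun V (\<lambda>y. \<Psi> y c)"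
    and \<Psi>_supp: "\<And>c y. c \<notin> {..<r} \<times> B \<Longrightarrow> \<Psi> y c = 0"
begin

abbreviation W :: "('i \<Rightarrow>\<^sub>0 complex) set" where "W \<equiv> {f. keys f \<subseteq> B}"

abbreviation X :: "('i \<Rightarrow>\<^sub>0 complex) set topology" where "X \<equiv> zariski_grass r W"

definition vecs :: "('v \<Rightarrow> complex) \<Rightarrow> ('i \<Rightarrow>\<^sub>0 complex) list" where
  "vecs y = map (\<lambda>i. \<Sum>m\<in>B. single m (\<Psi> y (i, m))) [0..<r]"

definition pt :: "('v \<Rightarrow> complex) \<Rightarrow> ('i \<Rightarrow>\<^sub>0 complex) set" where
  "pt y = cvs.span (set (vecs y))"

definition nondeg :: "('v \<Rightarrow> complex) \<Rightarrow> bool" where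
  "nondeg y \<longleftrightarrow> (\<exists>I. length I = r \<and> pl r (\<Psi> y) I \<noteq> 0)"

definition image :: "('v \<Rightarrow> complex) set \<Rightarrow> ('i \<Rightarrow>\<^sub>0 complex) set set" where
  "image H = pt ` {y \<in> H. nondeg y}"

lemma lookup_vecs: "i < r \<Longrightarrow> lookup (vecs y ! i) m = \<Psi> y (i, m)"
  using \<Psi>_supp[of "(i, m)" y] finB by (auto simp: vecs_def lookup_sum lookup_single when_def)

lemma plucker_vecs: "plucker r (vecs y) = pl r (\<Psi> y)"
  unfolding plucker_def pl_def
  by (rule ext, rule arg_cong[of _ _ Determinant.det], rule eq_matI) (simp_all add: lookup_vecs)

lemma vecs_W: "set (vecs y) \<subseteq> W"
proof -
  have "lookup (vecs y ! i) m = 0" if "m \<notin> B" "i < r" for i m using that lookup_vecs \<Psi>_supp by simp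
  moreover have "length (vecs y) = r" by (simp add: vecs_def)
  ultimately show ?thesis by (fastforce simp: in_set_conv_nth in_keys_iff)
qed

lemma pt_basis:
  assumes "nondeg y"
  shows "is_basis (vecs y) (pt y)" "pt y \<in> grass r W"
proof -
  obtain I where "plucker r (vecs y) I \<noteq> 0" using assms by (auto simp: nondeg_def plucker_vecs)
  from is_basis_if_plucker_nonzero[OF _ this vecs_W subspace_keys]
  show "is_basis (vecs y) (pt y)" "pt y \<in> grass r W" by (simp_all add: pt_def vecs_def)
qed

lemma nonvanishing_pt:
  assumes "nondeg y" "F \<in> pforms r e"
  shows "nonvanishing r F (pt y) \<longleftrightarrow> eval_poly F (pl r (\<Psi> y)) \<noteq> 0"
  using nonvanishing_iff[OF pt_basis[OF assms(1)] assms(2)] by (simp add: plucker_vecs)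

lemma image_grass: "image H \<subseteq> grass r W"
  using pt_basis(2) by (auto simp: image_def)

lemma poly_fun_pl: "poly_fun V (\<lambda>y. pl r (\<Psi> y) I)"
  unfolding pl_def by (rule poly_fun_det) (rule \<Psi>_poly)

lemma poly_fun_form: "poly_fun V (\<lambda>y. eval_poly F (pl r (\<Psi> y)))"
  by (rule poly_fun_compose[OF poly_fun_eval_poly[of F UNIV]]) (auto intro: poly_fun_pl)

text \<open>A degenerate tuple defines no point of \<open>image\<close>, so the assumption says
  nothing about it directly. But the nondegenerate tuples are dense in the slice.\<close>

lemma form_vanishes_on_slice:
  assumes "y0 \<in> slice V0 y1" "nondeg y0" "F \<in> pforms r e" "\<And>\<Lambda>. \<Lambda> \<in> image (slice V0 y1) \<Longrightarrow> \<not> nonvanishing r F \<Lambda>"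
    "y \<in> slice V0 y1"
  shows "eval_poly F (pl r (\<Psi> y)) = 0"
proof (rule ccontr)
  assume "eval_poly F (pl r (\<Psi> y)) \<noteq> 0"
  moreover obtain I where I: "length I = r" "pl r (\<Psi> y0) I \<noteq> 0" using assms(2) by (auto simp: nondeg_def)
  ultimately obtain z where "z \<in> slice V0 y1" "eval_poly F (pl r (\<Psi> z)) \<noteq> 0" "pl r (\<Psi> z) I \<noteq> 0"
    using poly_fun_slice_nonzero2[of V "\<lambda>y. eval_poly F (pl r (\<Psi> y))" "\<lambda>y. pl r (\<Psi> y) I" y V0 y1 y0]
      poly_fun_form poly_fun_pl assms by blast
  then show False using nonvanishing_pt[of z F e] assms(3,4) I by (auto simp: image_def nondeg_def)
qed

lemma closure_vanishing:
  assumes "F \<in> pforms r e" "\<And>\<Lambda>. \<Lambda> \<in> image H \<Longrightarrow> \<not> nonvanishing r F \<Lambda>" "\<Lambda> \<in> X closure_of (image H)"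
  shows "\<not> nonvanishing r F \<Lambda>"
  using assms in_closure_zariski_iff[OF r image_grass] by blast

text \<open>Irreducibility passes from the slice to its image. If neither \<open>A\<close> nor
  \<open>C\<close> contains the image, there are forms that vanish on them but not identically on
  the slice; at a nondegenerate point where both are nonzero the image leaves the union of
  \<open>A\<close> and \<open>C\<close>.\<close>

lemma irreducible_closure_image:
  assumes "nondeg y0"
  shows "irreducible_closed X (X closure_of (image (slice V0 y0)))"
  unfolding irreducible_closed_def
proof (intro conjI allI impI)
  let ?Y = "image (slice V0 y0)"
  have sub: "?Y \<subseteq> X closure_of ?Y"
    using closure_of_subset[of ?Y X] image_grass topspace_zariski_grass[OF r] by metis
  show "closedin X (X closure_of ?Y)" by simp
  show "X closure_of ?Y \<noteq> {}" using sub assms by (auto simp: image_def)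
  fix A C assume AC: "closedin X A" "closedin X C" "X closure_of ?Y \<subseteq> A \<union> C"
  show "X closure_of ?Y \<subseteq> A \<or> X closure_of ?Y \<subseteq> C"
  proof (rule ccontr)
    assume *: "\<not> (X closure_of ?Y \<subseteq> A \<or> X closure_of ?Y \<subseteq> C)"
    have ex: "\<exists>e F y. F \<in> pforms r e \<and> y \<in> slice V0 y0 \<and> eval_poly F (pl r (\<Psi> y)) \<noteq> 0 \<and> (\<forall>\<Lambda>\<in>A. \<not> nonvanishing r F \<Lambda>)"
      if A: "closedin X A" "\<not> X closure_of ?Y \<subseteq> A" for A
    proof -
      obtain y where y: "y \<in> slice V0 y0" "nondeg y" "pt y \<notin> A"
        using closure_of_minimal[of ?Y A X] A by (auto simp: image_def)
      then obtain e F where "F \<in> pforms r e" "nonvanishing r F (pt y)" "\<forall>\<Lambda>\<in>A. \<not> nonvanishing r F \<Lambda>"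
        using separating_form[OF A(1) pt_basis(2) _ r] by blast
      then show ?thesis using y nonvanishing_pt by blast
    qed
    obtain e F y where F: "F \<in> pforms r e" "y \<in> slice V0 y0" "eval_poly F (pl r (\<Psi> y)) \<noteq> 0" "\<forall>\<Lambda>\<in>A. \<not> nonvanishing r F \<Lambda>"
      using ex[OF AC(1)] * by blast
    obtain e' G y' where G: "G \<in> pforms r e'" "y' \<in> slice V0 y0" "eval_poly G (pl r (\<Psi> y')) \<noteq> 0" "\<forall>\<Lambda>\<in>C. \<not> nonvanishing r G \<Lambda>"
      using ex[OF AC(2)] * by blast
    obtain z where z: "z \<in> slice V0 y0" "eval_poly F (pl r (\<Psi> z)) \<noteq> 0" "eval_poly G (pl r (\<Psi> z)) \<noteq> 0"
      using poly_fun_slice_nonzero2[of V "\<lambda>y. eval_poly F (pl r (\<Psi> y))" "\<lambda>y. eval_poly G (pl r (\<Psi> y))" y V0 y0 y']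
        poly_fun_form F G by blast
    obtain \<Lambda> where \<Lambda>: "\<Lambda> \<in> ?Y" "nonvanishing r (F * G) \<Lambda>"
      using form_vanishes_on_slice[OF slice_base assms pforms_mult[OF F(1) G(1)], of V0 z] z
      by (auto simp: eval_poly_mult)
    then have "nonvanishing r F \<Lambda>" "nonvanishing r G \<Lambda>"
      using nonvanishing_mult[OF _ r F(1) G(1)] image_grass by blast+
    moreover have "\<Lambda> \<in> A \<union> C" using \<Lambda> sub AC(3) by blast
    ultimately show False using F(4) G(4) by blast
  qed
qed

text \<open>A form that is nonzero at some nondegenerate tuple is also nonzero at one with \<eta> y
  \<noteq> 0, again by irreducibility. This allows generic conditions to be imposed on the
  parameters without changing the closure.\<close>

lemma image_subset_closure_generic:
  assumes "poly_fun V \<eta>" "\<eta> y1 \<noteq> 0"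
  shows "image UNIV \<subseteq> X closure_of (image {y. \<eta> y \<noteq> 0})"
proof
  fix \<Lambda> assume "\<Lambda> \<in> image UNIV"
  then obtain y where y: "nondeg y" "\<Lambda> = pt y" by (auto simp: image_def)
  show "\<Lambda> \<in> X closure_of (image {y. \<eta> y \<noteq> 0})"
    unfolding in_closure_zariski_iff[OF r image_grass]
  proof (intro conjI allI ballI impI)
    show "\<Lambda> \<in> grass r W" using y pt_basis by simp
    fix e F assume F: "F \<in> pforms r e" "nonvanishing r F \<Lambda>"
    obtain I where I: "length I = r" "pl r (\<Psi> y) I \<noteq> 0" using y by (auto simp: nondeg_def)
    have "poly_fun V (\<lambda>y. eval_poly F (pl r (\<Psi> y)) * pl r (\<Psi> y) I)"
      by (intro poly_fun.mult poly_fun_form poly_fun_pl)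
    moreover have "eval_poly F (pl r (\<Psi> y)) * pl r (\<Psi> y) I \<noteq> 0" using I F y nonvanishing_pt by auto
    ultimately obtain z where "eval_poly F (pl r (\<Psi> z)) * pl r (\<Psi> z) I \<noteq> 0" "\<eta> z \<noteq> 0"
      using poly_fun_slice_nonzero2[of V "\<lambda>y. eval_poly F (pl r (\<Psi> y)) * pl r (\<Psi> y) I" \<eta> y UNIV y y1] assms by auto
    then show "\<exists>\<Lambda>'\<in>image {y. \<eta> y \<noteq> 0}. nonvanishing r F \<Lambda>'"
      using I F nonvanishing_pt[of z F e] by (intro bexI[of _ "pt z"]) (auto simp: image_def nondeg_def)
  qed
qed

end

section \<open>The dimension of a parametrized set of subspaces\<close>

lemma fam_indep_reindex:
  assumes "bij_betw h L K"
  shows "fam_indep L (\<lambda>i. X (h i)) \<longleftrightarrow> fam_indep K X"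
proof
  assume *: "fam_indep L (\<lambda>i. X (h i))"
  show "fam_indep K X"
    unfolding fam_indep_def
  proof (intro allI impI ballI)
    fix c k assume c: "\<forall>x. (\<Sum>k\<in>K. c k * X k x) = 0" and "k \<in> K"
    then obtain i where i: "i \<in> L" "k = h i" using assms by (auto simp: bij_betw_def)
    have "(\<Sum>i\<in>L. c (h i) * X (h i) x) = 0" for x
      using c sum.reindex_bij_betw[OF assms, of "\<lambda>k. c k * X k x"] by simp
    from fam_indepD[OF * this i(1)] show "c k = 0" by (simp add: i)
  qed
next
  assume *: "fam_indep K X"
  have inv: "the_inv_into L h (h i) = i" if "i \<in> L" for i
    using assms that by (simp add: bij_betw_def the_inv_into_f_f)
  show "fam_indep L (\<lambda>i. X (h i))"
    unfolding fam_indep_def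
  proof (intro allI impI ballI)
    fix c i assume c: "\<forall>x. (\<Sum>i\<in>L. c i * X (h i) x) = 0" and i: "i \<in> L"
    have "(\<Sum>k\<in>K. c (the_inv_into L h k) * X k x) = 0" for x
    proof -
      have "(\<Sum>k\<in>K. c (the_inv_into L h k) * X k x) = (\<Sum>i\<in>L. c (the_inv_into L h (h i)) * X (h i) x)"
        by (rule sum.reindex_bij_betw[OF assms, symmetric])
      then show ?thesis using c inv by simp
    qed
    moreover have "h i \<in> K" using assms i by (auto simp: bij_betw_def)
    ultimately have "c (the_inv_into L h (h i)) = 0" by (rule fam_indepD[OF *])
    then show "c i = 0" using inv i by simp
  qed
qed

text \<open>Independence is an open condition on the parameter; \<delta> is a minor of the family
  chosen to be nonzero at \<open>y0\<close>.\<close>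

lemma generic_minor:
  assumes "finite K" "fam_indep K (T y0)" "\<And>k c. k \<in> K \<Longrightarrow> poly_fun V (\<lambda>y. T y k c)"
  obtains \<delta> where "poly_fun V \<delta>" "\<delta> y0 \<noteq> 0" "\<And>y. \<delta> y \<noteq> 0 \<Longrightarrow> fam_indep K (T y)"
proof -
  obtain h where h: "bij_betw h {..<card K} K"
    using ex_bij_betw_nat_finite[OF assms(1)] by (auto simp: atLeast0LessThan)
  let ?n = "card K"
  obtain I where I: "Determinant.det (Matrix.mat ?n ?n (\<lambda>(i, j). T y0 (h i) (I ! j))) \<noteq> 0"
    using ex_minor_if_fam_indep[of ?n "\<lambda>i. T y0 (h i)"] fam_indep_reindex[OF h, of "T y0"] assms(2) by blast
  show ?thesis
  proof (rule that)
    show "poly_fun V (\<lambda>y. Determinant.det (Matrix.mat ?n ?n (\<lambda>(i, j). T y (h i) (I ! j))))"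
      by (rule poly_fun_det) (use h assms(3) in \<open>auto simp: bij_betw_def\<close>)
    show "Determinant.det (Matrix.mat ?n ?n (\<lambda>(i, j). T y0 (h i) (I ! j))) \<noteq> 0" by (rule I)
    show "fam_indep K (T y)" if "Determinant.det (Matrix.mat ?n ?n (\<lambda>(i, j). T y (h i) (I ! j))) \<noteq> 0" for y
      using fam_indep_if_minor[of ?n "\<lambda>i. T y (h i)" "(!) I"] that fam_indep_reindex[OF h, of "T y"] by blast
  qed
qed

lemma mat_adjugate:
  fixes M :: "nat \<Rightarrow> nat \<Rightarrow> complex"
  assumes "i < n" "k < n"
  shows "(\<Sum>j<n. M i j * cofactor (Matrix.mat n n (\<lambda>(i, j). M i j)) k j) =
    (if i = k then Determinant.det (Matrix.mat n n (\<lambda>(i, j). M i j)) else 0)"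
proof -
  let ?A = "Matrix.mat n n (\<lambda>(i, j). M i j)"
  have "(?A * adj_mat ?A) $$ (i, k) = (Determinant.det ?A \<cdot>\<^sub>m 1\<^sub>m n) $$ (i, k)"
    using adj_mat(2)[of ?A n] by simp
  then show ?thesis using assms by (simp add: adj_mat_def scalar_prod_def atLeast0LessThan)
qed

lemma poly_fun_cofactor:
  assumes "\<And>i j. i < n \<Longrightarrow> j < n \<Longrightarrow> poly_fun V (\<lambda>y. M y i j)" "k < n" "l < n"
  shows "poly_fun V (\<lambda>y. cofactor (Matrix.mat n n (\<lambda>(i, j). M y i j)) k l)"
proof -
  have "mat_delete (Matrix.mat n n (\<lambda>(i, j). M y i j)) k l = Matrix.mat (n - 1) (n - 1)
      (\<lambda>(i, j). M y (if i < k then i else Suc i) (if j < l then j else Suc j))" for y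
    by (rule eq_matI) (auto simp: mat_delete_def)
  then show ?thesis unfolding cofactor_def
    by (auto intro!: poly_fun.mult poly_fun.const poly_fun_det assms)
qed

text \<open>Cramer's rule with polynomial coefficients, at the points of maximal rank.\<close>

lemma generic_expansion:
  assumes K: "finite K" "K0 \<subseteq> K" "fam_indep K0 (T y0)"
    and poly: "\<And>k c. k \<in> K \<Longrightarrow> poly_fun V (\<lambda>y. T y k c)"
    and max: "\<And>y K1. K1 \<subseteq> K \<Longrightarrow> fam_indep K1 (T y) \<Longrightarrow> card K1 \<le> card K0"
  obtains \<delta> N where "poly_fun V \<delta>" "\<delta> y0 \<noteq> 0" "\<And>k \<kappa>. k \<in> K \<Longrightarrow> \<kappa> \<in> K0 \<Longrightarrow> poly_fun V (N k \<kappa>)"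
    "\<And>y k c. k \<in> K \<Longrightarrow> \<delta> y * T y k c = (\<Sum>\<kappa>\<in>K0. N k \<kappa> y * T y \<kappa> c)"
proof -
  have fin: "finite K0" using K finite_subset by blast
  let ?n = "card K0"
  obtain h where h: "bij_betw h {..<?n} K0"
    using ex_bij_betw_nat_finite[OF fin] by (auto simp: atLeast0LessThan)
  have hK: "h i \<in> K" if "i < ?n" for i using h K that by (auto simp: bij_betw_def)
  obtain I where I: "Determinant.det (Matrix.mat ?n ?n (\<lambda>(i, j). T y0 (h i) (I ! j))) \<noteq> 0"
    using ex_minor_if_fam_indep[of ?n "\<lambda>i. T y0 (h i)"] fam_indep_reindex[OF h, of "T y0"] K(3) by blast
  define g where "g = the_inv_into {..<?n} h"
  have gh: "g (h i) = i" if "i < ?n" for i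
    using h that by (simp add: g_def bij_betw_def the_inv_into_f_f)
  have g: "g \<kappa> < ?n" if \<kappa>: "\<kappa> \<in> K0" for \<kappa>
  proof -
    obtain i where "i < ?n" "\<kappa> = h i" using h \<kappa> by (auto simp: bij_betw_def)
    then show ?thesis by (simp add: gh)
  qed
  define M where "M = (\<lambda>y i j. T y (h i) (I ! j))"
  define C where "C = (\<lambda>y k j. cofactor (Matrix.mat ?n ?n (\<lambda>(i, j). M y i j)) k j)"
  define d where "d = (\<lambda>y. Determinant.det (Matrix.mat ?n ?n (\<lambda>(i, j). M y i j)))"
  \<comment> \<open>The extra factor \<open>d y\<close>, matched by the square of \<open>d y\<close>
    on the other side, makes both sides zero where the minor vanishes. So the identity holds at
    every \<open>y\<close>.\<close>
  define N where "N = (\<lambda>k \<kappa> y. d y * (\<Sum>j<?n. T y k (I ! j) * C y (g \<kappa>) j))"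
  have pM: "poly_fun V (\<lambda>y. M y i j)" if "i < ?n" "j < ?n" for i j
    unfolding M_def using poly hK that by blast
  have pd: "poly_fun V d" unfolding d_def by (rule poly_fun_det) (rule pM)
  have pC: "poly_fun V (\<lambda>y. C y k j)" if "k < ?n" "j < ?n" for k j
    unfolding C_def by (rule poly_fun_cofactor) (use pM that in auto)
  show ?thesis
  proof (rule that)
    show "poly_fun V (\<lambda>y. d y * d y)" by (intro poly_fun.mult pd)
    show "d y0 * d y0 \<noteq> 0" using I by (simp add: d_def M_def)
    show "poly_fun V (N k \<kappa>)" if "k \<in> K" "\<kappa> \<in> K0" for k \<kappa>
      unfolding N_def by (intro poly_fun.mult poly_fun_sum pd poly pC) (use that g in auto)
    fix y k c assume k: "k \<in> K"
    show "d y * d y * T y k c = (\<Sum>\<kappa>\<in>K0. N k \<kappa> y * T y \<kappa> c)"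
    proof (cases "d y = 0")
      case False
      have ind: "fam_indep K0 (T y)"
        using fam_indep_if_minor[of ?n "\<lambda>i. T y (h i)" "(!) I"] False fam_indep_reindex[OF h]
        by (auto simp: d_def M_def)
      have "T y k \<in> fam_span K0 (T y)"
      proof (rule ccontr)
        assume *: "T y k \<notin> fam_span K0 (T y)"
        then have "k \<notin> K0" using fam_span_base[OF fin] by blast
        moreover have "card (insert k K0) \<le> card K0"
          by (rule max[OF _ fam_indep_insert[OF fin ind *]]) (use k K in auto)
        ultimately show False using fin by simp
      qed
      then obtain a where "\<And>x. T y k x = (\<Sum>\<kappa>\<in>K0. a \<kappa> * T y \<kappa> x)" by (auto simp: fam_span_def)
      then have a: "T y k x = (\<Sum>i<?n. a (h i) * T y (h i) x)" for x
        using sum.reindex_bij_betw[OF h, of "\<lambda>\<kappa>. a \<kappa> * T y \<kappa> x"] by simp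
      have Cramer: "(\<Sum>j<?n. T y k (I ! j) * C y l j) = a (h l) * d y" if l: "l < ?n" for l
      proof -
        have "(\<Sum>j<?n. T y k (I ! j) * C y l j) = (\<Sum>j<?n. \<Sum>i<?n. a (h i) * (M y i j * C y l j))"
          unfolding a M_def by (simp add: sum_distrib_right mult.assoc)
        also have "\<dots> = (\<Sum>i<?n. a (h i) * (\<Sum>j<?n. M y i j * C y l j))"
          by (subst sum.swap) (simp add: sum_distrib_left)
        also have "\<dots> = (\<Sum>i<?n. a (h i) * (if i = l then d y else 0))"
          by (rule sum.cong) (use mat_adjugate[of _ ?n l "M y"] l in \<open>auto simp: C_def d_def\<close>)
        finally show ?thesis using l by (simp add: if_distrib[of "\<lambda>c. _ * c"] cong: if_cong)
      qed
      have "(\<Sum>\<kappa>\<in>K0. N k \<kappa> y * T y \<kappa> c) = (\<Sum>i<?n. N k (h i) y * T y (h i) c)"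
        by (rule sum.reindex_bij_betw[OF h, symmetric])
      also have "\<dots> = (\<Sum>i<?n. d y * d y * (a (h i) * T y (h i) c))"
        by (rule sum.cong) (auto simp: N_def gh Cramer)
      finally show ?thesis unfolding a by (simp add: sum_distrib_left)
    qed (simp add: N_def)
  qed
qed

lemma poly_fun_pl_UNIV: "poly_fun UNIV (\<lambda>z. pl r z I)"
  unfolding pl_def by (rule poly_fun_det) (auto intro: poly_fun.var)

lemma poly_fun_form_UNIV: "poly_fun UNIV (\<lambda>z. eval_poly F (pl r z))"
  by (rule poly_fun_compose[OF poly_fun_eval_poly[of F UNIV]]) (auto intro: poly_fun_pl_UNIV)

text \<open>The infinitesimal action of the elementary matrix \<open>E\<^sub>a\<^sub>b\<close> of \<open>gl\<^sub>r\<close> on an \<open>r\<close>-tuple of vectors.\<close>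

definition row_shift :: "nat \<Rightarrow> nat \<Rightarrow> (nat \<times> 'i \<Rightarrow> complex) \<Rightarrow> nat \<times> 'i \<Rightarrow> complex" where
  "row_shift a b z = (\<lambda>(i, m). if i = a then z (b, m) else 0)"

text \<open>Moving in the direction of an elementary matrix is a row operation: scaling row
  \<open>a\<close> by 1 + t if \<open>a = b\<close>, and otherwise adding t times row
  \<open>b\<close> to row \<open>a\<close>.\<close>

lemma pl_add_row_shift:
  assumes "a < r" "b < r"
  shows "pl r (\<lambda>c. z c + t * row_shift a b z c) I = (if a = b then 1 + t else 1) * pl r z I"
proof -
  let ?A = "Matrix.mat r r (\<lambda>(i, j). z (i, I ! j))"
  show ?thesis
  proof (cases "a = b")
    case True
    have "Matrix.mat r r (\<lambda>(i, j). z (i, I ! j) + t * row_shift a b z (i, I ! j)) = multrow a (1 + t) ?A"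
      by (rule eq_matI) (use True in \<open>auto simp: row_shift_def ring_distribs\<close>)
    then show ?thesis using det_multrow[OF assms(1), of ?A "1 + t"] True by (simp add: pl_def)
  next
    case False
    have "Matrix.mat r r (\<lambda>(i, j). z (i, I ! j) + t * row_shift a b z (i, I ! j)) = addrow t a b ?A"
      by (rule eq_matI) (use assms in \<open>auto simp: row_shift_def\<close>)
    then show ?thesis using det_addrow[OF assms(2) False, of ?A t] False by (simp add: pl_def)
  qed
qed

text \<open>A form of degree \<open>e\<close> in the Plucker coordinates is multiplied by the e-th
  power of the determinant under \<open>GL\<^sub>r\<close>, hence infinitesimally by
  \<open>e\<close> times the trace. This supplies the zeroth-order term of the differential
  equations.\<close>

lemma dird_row_shift:
  assumes "a < r" "b < r" "homogeneous e F"
  shows "dird (row_shift a b z) (\<lambda>z. eval_poly F (pl r z)) z = (if a = b then of_nat e else 0) * eval_poly F (pl r z)"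
proof (rule dirdI)
  have "eval_poly F (pl r (\<lambda>c. z c + t * row_shift a b z c)) = (if a = b then 1 + t else 1) ^ e * eval_poly F (pl r z)" for t
  proof -
    have "pl r (\<lambda>c. z c + t * row_shift a b z c) = (\<lambda>I. (if a = b then 1 + t else 1) * pl r z I)"
      by (rule ext) (rule pl_add_row_shift[OF assms(1,2)])
    then show ?thesis using eval_poly_scale[OF assms(3)] by simp
  qed
  then show "((\<lambda>t. eval_poly F (pl r (\<lambda>c. z c + t * row_shift a b z c))) has_field_derivative
      (if a = b then of_nat e else 0) * eval_poly F (pl r z)) (at 0)"
    by (cases "a = b") (auto intro!: derivative_eq_intros)
qed

lemma pl_update:
  assumes "length I = r" "j < r"
  shows "pl r z (I[j := m]) = (\<Sum>b<r. z (b, m) * cofactor (Matrix.mat r r (\<lambda>(i, j). z (i, I ! j))) b j)"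
proof -
  let ?A = "Matrix.mat r r (\<lambda>(i, k). z (i, I[j := m] ! k))"
  have "mat_delete ?A b j = mat_delete (Matrix.mat r r (\<lambda>(i, j). z (i, I ! j))) b j" for b
    by (rule eq_matI) (use assms in \<open>auto simp: mat_delete_def nth_list_update\<close>)
  then have "cofactor ?A b j = cofactor (Matrix.mat r r (\<lambda>(i, j). z (i, I ! j))) b j" for b
    by (simp add: cofactor_def)
  moreover have "pl r z (I[j := m]) = (\<Sum>b<r. ?A $$ (b, j) * cofactor ?A b j)"
    unfolding pl_def by (rule laplace_expansion_column) (use assms in auto)
  ultimately show ?thesis using assms by simp
qed

text \<open>Cramer's rule without denominators: column \<open>m\<close> of \<open>z\<close> is a
  combination of the columns in \<open>I\<close>, with coefficients obtained by exchanging one index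
  of \<open>I\<close> for \<open>m\<close>.\<close>

lemma pl_exchange:
  assumes "length I = r" "a < r"
  shows "(\<Sum>j<r. z (a, I ! j) * pl r z (I[j := m])) = pl r z I * z (a, m)"
proof -
  let ?C = "\<lambda>b j. cofactor (Matrix.mat r r (\<lambda>(i, j). z (i, I ! j))) b j"
  have "(\<Sum>j<r. z (a, I ! j) * pl r z (I[j := m])) = (\<Sum>j<r. \<Sum>b<r. z (b, m) * (z (a, I ! j) * ?C b j))"
    by (rule sum.cong) (simp_all add: pl_update[OF assms(1)] sum_distrib_left mult_ac)
  also have "\<dots> = (\<Sum>b<r. z (b, m) * (\<Sum>j<r. z (a, I ! j) * ?C b j))"
    by (subst sum.swap) (simp add: sum_distrib_left)
  also have "\<dots> = (\<Sum>b<r. z (b, m) * (if a = b then pl r z I else 0))"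
    by (rule sum.cong) (use mat_adjugate[of a r _ "\<lambda>i j. z (i, I ! j)"] assms in \<open>auto simp: pl_def\<close>)
  finally show ?thesis using assms by (simp add: if_distrib[of "\<lambda>c. _ * c"] cong: if_cong)
qed

text \<open>The differential of the projective Plucker map has no kernel besides the changes of basis.\<close>

lemma plucker_differential_kernel:
  assumes I: "length I = r" "pl r z I \<noteq> 0"
    and X: "\<And>J. length J = r \<Longrightarrow> dird X (\<lambda>z. pl r z J) z = c * pl r z J"
  shows "\<exists>Y. \<forall>a<r. \<forall>m. X (a, m) = (\<Sum>b<r. Y a b * z (b, m))"
proof -
  let ?C = "\<lambda>b j. cofactor (Matrix.mat r r (\<lambda>(i, j). z (i, I ! j))) b j"
  have pf: "poly_fun UNIV (\<lambda>z :: nat \<times> 'a \<Rightarrow> complex. z v)" for v by (rule poly_fun.var) simp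
  have "X (a, m) = (\<Sum>b<r. ((\<Sum>j<r. X (a, I ! j) * ?C b j) / pl r z I) * z (b, m))" if a: "a < r" for a m
  proof -
    have eq: "(\<lambda>z. \<Sum>j<r. z (a, I ! j) * pl r z (I[j := m])) = (\<lambda>z. pl r z I * z (a, m))"
      by (rule ext) (rule pl_exchange[OF I(1) a])
    \<comment> \<open>The exchange identity is differentiated along \<open>X\<close>. By assumption
      the Plucker coordinates are only multiplied by \<open>c\<close>, and these terms cancel
      between the two sides; what remains expresses \<open>X (a, m)\<close> by the entries
      \<open>z (b, m)\<close>.\<close>
    have "dird X (\<lambda>z. \<Sum>j<r. z (a, I ! j) * pl r z (I[j := m])) z =
        (\<Sum>j<r. dird X (\<lambda>z. z (a, I ! j) * pl r z (I[j := m])) z)"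
      by (rule dird_sum[of _ UNIV]) (intro poly_fun.mult pf poly_fun_pl_UNIV)
    also have "\<dots> = (\<Sum>j<r. X (a, I ! j) * pl r z (I[j := m]) + z (a, I ! j) * (c * pl r z (I[j := m])))"
      by (rule sum.cong) (simp_all add: dird_mult[OF pf poly_fun_pl_UNIV] X I)
    also have "\<dots> = (\<Sum>j<r. X (a, I ! j) * pl r z (I[j := m])) + c * (\<Sum>j<r. z (a, I ! j) * pl r z (I[j := m]))"
      by (simp add: sum.distrib sum_distrib_left mult_ac)
    finally have "(\<Sum>j<r. X (a, I ! j) * pl r z (I[j := m])) + c * (pl r z I * z (a, m)) =
        dird X (\<lambda>z. pl r z I * z (a, m)) z"
      unfolding eq pl_exchange[OF I(1) a] by simp
    also have "\<dots> = c * pl r z I * z (a, m) + pl r z I * X (a, m)"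
      by (simp add: dird_mult[OF poly_fun_pl_UNIV pf] X I)
    finally have "pl r z I * X (a, m) = (\<Sum>j<r. X (a, I ! j) * pl r z (I[j := m]))" by simp
    also have "\<dots> = (\<Sum>j<r. \<Sum>b<r. X (a, I ! j) * ?C b j * z (b, m))"
      by (rule sum.cong) (simp_all add: pl_update[OF I(1)] sum_distrib_left mult_ac)
    also have "\<dots> = (\<Sum>b<r. (\<Sum>j<r. X (a, I ! j) * ?C b j) * z (b, m))"
      by (subst sum.swap) (simp add: sum_distrib_right)
    finally have "X (a, m) = (\<Sum>b<r. (\<Sum>j<r. X (a, I ! j) * ?C b j) * z (b, m)) / pl r z I"
      using I(2) by (simp add: field_simps)
    then show ?thesis by (subst (asm) sum_divide_distrib) (simp only: times_divide_eq_left)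
  qed
  then show ?thesis by (intro exI allI impI)
qed

lemma irreducible_closed_subtopology:
  assumes "closedin X C"
  shows "irreducible_closed (subtopology X C) Z \<longleftrightarrow> irreducible_closed X Z \<and> Z \<subseteq> C"
proof
  assume *: "irreducible_closed (subtopology X C) Z"
  then have Z: "closedin X Z" "Z \<subseteq> C"
    using closedin_closed_subtopology[OF assms] unfolding irreducible_closed_def by auto
  moreover have "Z \<subseteq> A \<or> Z \<subseteq> D" if "closedin X A" "closedin X D" "Z \<subseteq> A \<union> D" for A D
  proof -
    have "closedin (subtopology X C) (A \<inter> C)" "closedin (subtopology X C) (D \<inter> C)"
      using that assms closedin_closed_subtopology[OF assms] by auto
    moreover have "Z \<subseteq> (A \<inter> C) \<union> (D \<inter> C)" using that Z by blast
    ultimately show ?thesis using * unfolding irreducible_closed_def by (metis le_inf_iff)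
  qed
  ultimately show "irreducible_closed X Z \<and> Z \<subseteq> C" using * unfolding irreducible_closed_def by blast
next
  assume "irreducible_closed X Z \<and> Z \<subseteq> C"
  then show "irreducible_closed (subtopology X C) Z"
    using closedin_closed_subtopology[OF assms] unfolding irreducible_closed_def by blast
qed

lemma krull_dim_eqI:
  assumes "closedin X C"
    and "\<And>i. i \<le> m \<Longrightarrow> irreducible_closed X (Z i)" "\<And>i. i \<le> m \<Longrightarrow> Z i \<subseteq> C" "\<And>i. i < m \<Longrightarrow> Z i \<subset> Z (Suc i)"
    and up: "\<And>k Z. (\<And>i. i \<le> k \<Longrightarrow> irreducible_closed X (Z i)) \<Longrightarrow> (\<And>i. i < k \<Longrightarrow> Z i \<subset> Z (Suc i)) \<Longrightarrow> Z k \<subseteq> C \<Longrightarrow> k \<le> m"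
  shows "krull_dim (subtopology X C) = ereal (real m)"
  unfolding krull_dim_def irreducible_closed_subtopology[OF assms(1)]
proof (rule antisym)
  show "(SUP k\<in>{k. \<exists>Z. (\<forall>i\<le>k. irreducible_closed X (Z i) \<and> Z i \<subseteq> C) \<and> (\<forall>i<k. Z i \<subset> Z (Suc i))}. ereal (real k)) \<le> ereal (real m)"
  proof (rule SUP_least)
    fix k assume "k \<in> {k. \<exists>Z. (\<forall>i\<le>k. irreducible_closed X (Z i) \<and> Z i \<subseteq> C) \<and> (\<forall>i<k. Z i \<subset> Z (Suc i))}"
    then obtain Z where "\<forall>i\<le>k. irreducible_closed X (Z i) \<and> Z i \<subseteq> C" "\<forall>i<k. Z i \<subset> Z (Suc i)" by blast
    then have "k \<le> m" by (intro up[of k Z]) auto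
    then show "ereal (real k) \<le> ereal (real m)" by simp
  qed
  show "ereal (real m) \<le> (SUP k\<in>{k. \<exists>Z. (\<forall>i\<le>k. irreducible_closed X (Z i) \<and> Z i \<subseteq> C) \<and> (\<forall>i<k. Z i \<subset> Z (Suc i))}. ereal (real k))"
    by (rule SUP_upper) (use assms(2-4) in blast)
qed

section \<open>Tangent vectors of a parametrization and transversal slices\<close>

context grass_param
begin

text \<open>The directions of the \<open>GL\<^sub>r\<close>-action and the partial derivatives of
  \<open>\<Psi>\<close> form one family, so that an independent subfamily containing all of the
  former can be chosen. Its remaining members are the coordinates of a transversal slice.\<close>

definition tangent :: "('v \<Rightarrow> complex) \<Rightarrow> (nat \<times> nat) + 'v \<Rightarrow> nat \<times> 'i \<Rightarrow> complex" where
  "tangent y k = (case k of Inl (a, b) \<Rightarrow> row_shift a b (\<Psi> y)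
     | Inr v \<Rightarrow> (\<lambda>c. dird (unit_at v) (\<lambda>y. \<Psi> y c) y))"

abbreviation gl_idx :: "((nat \<times> nat) + 'v) set" where
  "gl_idx \<equiv> Inl ` ({..<r} \<times> {..<r})"

abbreviation idx :: "((nat \<times> nat) + 'v) set" where
  "idx \<equiv> gl_idx \<union> Inr ` V"

lemma tangent_simps [simp]:
  "tangent y (Inl (a, b)) = row_shift a b (\<Psi> y)"
  "tangent y (Inr v) = (\<lambda>c. dird (unit_at v) (\<lambda>y. \<Psi> y c) y)"
  by (simp_all add: tangent_def)

lemma finite_idx: "finite idx" using finV by simp

lemma poly_fun_tangent: "poly_fun V (\<lambda>y. tangent y k c)"
proof (cases k)
  case (Inl ab)
  obtain a b where "ab = (a, b)" by fastforce
  then show ?thesis using Inl \<Psi>_poly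
    by (cases c) (auto simp: row_shift_def intro!: poly_fun_if poly_fun.const)
next
  case (Inr v)
  then show ?thesis using poly_fun_dird[OF \<Psi>_poly] by simp
qed

text \<open>Row \<open>a\<close> of a relation between these directions is a relation between the
  \<open>r\<close> vectors of the tuple, which are independent.\<close>

lemma gl_indep:
  assumes "nondeg y"
  shows "fam_indep gl_idx (tangent y)"
  unfolding fam_indep_def
proof (intro allI impI ballI)
  fix c k assume c: "\<forall>x. (\<Sum>k\<in>gl_idx. c k * tangent y k x) = 0" and "k \<in> gl_idx"
  then obtain a b where k: "k = Inl (a, b)" "a < r" "b < r" by auto
  obtain I where "pl r (\<Psi> y) I \<noteq> 0" using assms by (auto simp: nondeg_def)
  then have ind: "fam_indep {..<r} (\<lambda>b m. \<Psi> y (b, m))"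
    unfolding pl_def by (rule fam_indep_if_minor)
  have "(\<Sum>b<r. c (Inl (a, b)) * \<Psi> y (b, m)) = 0" for m
  proof -
    have "0 = (\<Sum>k\<in>gl_idx. c k * tangent y k (a, m))" using c by simp
    also have "\<dots> = (\<Sum>(a', b)\<in>{..<r} \<times> {..<r}. c (Inl (a', b)) * row_shift a' b (\<Psi> y) (a, m))"
      by (subst sum.reindex) (auto intro!: sum.cong)
    also have "\<dots> = (\<Sum>a'<r. if a' = a then \<Sum>b<r. c (Inl (a', b)) * \<Psi> y (b, m) else 0)"
      unfolding sum.cartesian_product[symmetric] by (rule sum.cong) (auto simp: row_shift_def)
    finally show ?thesis using k(2) by simp
  qed
  from fam_indepD[OF ind this, of b] k show "c k = 0" by simp
qed

lemma dird_form: "dird (unit_at v) (\<lambda>y. eval_poly F (pl r (\<Psi> y))) y =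
    dird (tangent y (Inr v)) (\<lambda>z. eval_poly F (pl r z)) (\<Psi> y)"
  using dird_chain[OF poly_fun_form_UNIV[of F r] \<Psi>_poly] by simp

lemma dird_pl: "dird (unit_at v) (\<lambda>y. pl r (\<Psi> y) I) y = dird (tangent y (Inr v)) (\<lambda>z. pl r z I) (\<Psi> y)"
  using dird_chain[OF poly_fun_pl_UNIV[of r I] \<Psi>_poly] by simp

text \<open>At maximal rank each partial derivative of \<open>\<Psi>\<close> is a combination of
  \<open>GL\<^sub>r\<close>-directions, along which the derivative of the form is a multiple of the
  form, and of the derivatives along \<open>V0\<close>. Applied to the form, this is the
  differential equation that \<open>vanishing_on_transversal_slice\<close> asks for.\<close>

lemma form_vanishes_if_on_transversal_slice:
  assumes V0: "V0 \<subseteq> V" "fam_indep (gl_idx \<union> Inr ` V0) (tangent y0)"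
    and max: "\<And>y K1. K1 \<subseteq> idx \<Longrightarrow> fam_indep K1 (tangent y) \<Longrightarrow> card K1 \<le> card (gl_idx \<union> Inr ` V0)"
    and F: "F \<in> pforms r e" "\<And>y. y \<in> slice V0 y0 \<Longrightarrow> eval_poly F (pl r (\<Psi> y)) = 0"
  shows "eval_poly F (pl r (\<Psi> y)) = 0"
proof -
  let ?K0 = "gl_idx \<union> Inr ` V0"
  let ?F = "\<lambda>z. eval_poly F (pl r z)"
  have finV0: "finite V0" using V0 finV finite_subset by blast
  have sub: "?K0 \<subseteq> idx" using V0(1) by auto
  obtain \<delta> N where \<delta>: "poly_fun V \<delta>" "\<delta> y0 \<noteq> 0"
    and N: "\<And>k \<kappa>. k \<in> idx \<Longrightarrow> \<kappa> \<in> ?K0 \<Longrightarrow> poly_fun V (N k \<kappa>)"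
    and eq: "\<And>y k c. k \<in> idx \<Longrightarrow> \<delta> y * tangent y k c = (\<Sum>\<kappa>\<in>?K0. N k \<kappa> y * tangent y \<kappa> c)"
    by (rule generic_expansion[where T = tangent and V = V, OF finite_idx sub V0(2) poly_fun_tangent max])
      (assumption, assumption, rule that)
  show ?thesis
  proof (rule vanishing_on_transversal_slice[OF poly_fun_form finV \<delta>, of V0])
    show "eval_poly F (pl r (\<Psi> y)) = 0" if "y \<in> slice V0 y0" for y by (rule F(2)[OF that])
    fix v assume "v \<in> V"
    then have v: "Inr v \<in> idx" by simp
    \<comment> \<open>\<open>e\<close> times the trace of the matrix of coefficients at the
      \<open>GL\<^sub>r\<close>-directions.\<close>
    define b where "b = (\<lambda>y. \<Sum>(a, b)\<in>{..<r} \<times> {..<r}. N (Inr v) (Inl (a, b)) y * (if a = b then of_nat e else 0))"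
    have pb: "poly_fun V b" unfolding b_def case_prod_unfold
      by (intro poly_fun_sum poly_fun.mult poly_fun.const N[OF v]) auto
    have "\<delta> y * dird (unit_at v) (\<lambda>y. ?F (\<Psi> y)) y =
        (\<Sum>w\<in>V0. N (Inr v) (Inr w) y * dird (unit_at w) (\<lambda>y. ?F (\<Psi> y)) y) + b y * ?F (\<Psi> y)" for y
    proof -
      \<comment> \<open>The sum over one element puts a scalar multiple of a direction into the
        shape of \<open>dird_linear\<close>.\<close>
      have "\<delta> y * dird (unit_at v) (\<lambda>y. ?F (\<Psi> y)) y = dird (\<lambda>c. \<Sum>k\<in>{()}. \<delta> y * tangent y (Inr v) c) ?F (\<Psi> y)"
        unfolding dird_form by (subst dird_linear[OF poly_fun_form_UNIV]) simp
      also have "(\<lambda>c. \<Sum>k\<in>{()}. \<delta> y * tangent y (Inr v) c) = (\<lambda>c. \<Sum>\<kappa>\<in>?K0. N (Inr v) \<kappa> y * tangent y \<kappa> c)"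
        using eq[OF v] by simp
      also have "dird \<dots> ?F (\<Psi> y) = (\<Sum>\<kappa>\<in>?K0. N (Inr v) \<kappa> y * dird (tangent y \<kappa>) ?F (\<Psi> y))"
        by (rule dird_linear[OF poly_fun_form_UNIV])
      also have "\<dots> = (\<Sum>\<kappa>\<in>gl_idx. N (Inr v) \<kappa> y * dird (tangent y \<kappa>) ?F (\<Psi> y)) +
          (\<Sum>\<kappa>\<in>Inr ` V0. N (Inr v) \<kappa> y * dird (tangent y \<kappa>) ?F (\<Psi> y))"
        by (rule sum.union_disjoint) (use finV0 in auto)
      also have "(\<Sum>\<kappa>\<in>Inr ` V0. N (Inr v) \<kappa> y * dird (tangent y \<kappa>) ?F (\<Psi> y)) =
          (\<Sum>w\<in>V0. N (Inr v) (Inr w) y * dird (unit_at w) (\<lambda>y. ?F (\<Psi> y)) y)"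
        unfolding dird_form by (simp add: sum.reindex)
      also have "(\<Sum>\<kappa>\<in>gl_idx. N (Inr v) \<kappa> y * dird (tangent y \<kappa>) ?F (\<Psi> y)) =
          (\<Sum>p\<in>{..<r} \<times> {..<r}. N (Inr v) (Inl p) y * dird (tangent y (Inl p)) ?F (\<Psi> y))"
        by (simp add: sum.reindex)
      also have "\<dots> = (\<Sum>(a, b)\<in>{..<r} \<times> {..<r}. N (Inr v) (Inl (a, b)) y * (if a = b then of_nat e else 0) * ?F (\<Psi> y))"
        by (rule sum.cong) (use F(1) in \<open>auto simp: dird_row_shift pforms_def mult_ac\<close>)
      also have "\<dots> = b y * ?F (\<Psi> y)" by (simp add: b_def sum_distrib_right case_prod_unfold)
      finally show ?thesis by simp
    qed
    then show "\<exists>a b. (\<forall>w\<in>V0. poly_fun V (a w)) \<and> poly_fun V b \<and>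
      (\<forall>y. \<delta> y * dird (unit_at v) (\<lambda>y. ?F (\<Psi> y)) y =
        (\<Sum>w\<in>V0. a w y * dird (unit_at w) (\<lambda>y. ?F (\<Psi> y)) y) + b y * ?F (\<Psi> y))"
      using pb N[OF v] by (intro exI[of _ "\<lambda>w. N (Inr v) (Inr w)"] exI[of _ b]) auto
  qed
qed

text \<open>The values of the Plucker coordinates at \<open>y0\<close> and their derivatives along
  \<open>V1\<close> are independent as rows over all coordinates. Otherwise a combination of
  derivatives of \<open>\<Psi>\<close> would lie in the kernel of the projective Plucker
  differential, hence among the \<open>GL\<^sub>r\<close>-directions, which the assumed independence
  excludes. A nonzero minor then selects the coordinates.\<close>

lemma hom_indep_plucker_on_slice:
  assumes "nondeg y0" "finite V1" "fam_indep (gl_idx \<union> Inr ` V1) (tangent y0)"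
  obtains J where "\<And>i. length (J i) = r" "hom_indep (slice V1 y0) (card V1) (\<lambda>i y. pl r (\<Psi> y) (J i))"
proof -
  let ?m = "card V1"
  obtain h where h: "bij_betw h {..<?m} V1"
    using ex_bij_betw_nat_finite[OF assms(2)] by (auto simp: atLeast0LessThan)
  \<comment> \<open>Row 0 of the Jacobian holds the values, so the variables start at row 1.\<close>
  define w where "w = (\<lambda>j. h (j - 1))"
  have w: "w j \<in> V1" if "0 < j" "j \<le> ?m" for j using h that by (auto simp: w_def bij_betw_def)
  \<comment> \<open>The minor takes its columns from a whole type; functions read as lists of length
    \<open>r\<close> keep it to valid Plucker indices.\<close>
  define L where "L = (\<lambda>f :: nat \<Rightarrow> 'i. map f [0..<r])"
  define G where "G = (\<lambda>j f. if j = 0 then pl r (\<Psi> y0) (L f) else dird (unit_at (w j)) (\<lambda>y. pl r (\<Psi> y) (L f)) y0)"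
  obtain I where I: "length I = r" "pl r (\<Psi> y0) I \<noteq> 0" using assms(1) by (auto simp: nondeg_def)
  have L: "\<exists>f. J = L f" if "length J = r" for J
    using that by (intro exI[of _ "(!) J"]) (auto simp: L_def intro: nth_equalityI)
  have "fam_indep {..<Suc ?m} G"
    unfolding fam_indep_def
  proof (intro allI impI)
    fix c assume "\<forall>f. (\<Sum>j<Suc ?m. c j * G j f) = 0"
    then have c: "c 0 * pl r (\<Psi> y0) J + (\<Sum>j<?m. c (Suc j) * dird (unit_at (h j)) (\<lambda>y. pl r (\<Psi> y) J) y0) = 0"
      if "length J = r" for J
      using L[OF that] unfolding sum.lessThan_Suc_shift by (auto simp: G_def w_def)
    define X where "X = (\<lambda>x. \<Sum>j<?m. c (Suc j) * tangent y0 (Inr (h j)) x)"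
    have "dird X (\<lambda>z. pl r z J) (\<Psi> y0) = - c 0 * pl r (\<Psi> y0) J" if "length J = r" for J
    proof -
      have "dird X (\<lambda>z. pl r z J) (\<Psi> y0) = (\<Sum>j<?m. c (Suc j) * dird (tangent y0 (Inr (h j))) (\<lambda>z. pl r z J) (\<Psi> y0))"
        unfolding X_def by (rule dird_linear[OF poly_fun_pl_UNIV])
      then show ?thesis using c[OF that] unfolding dird_pl by (simp add: add_eq_0_iff2)
    qed
    from plucker_differential_kernel[OF I this]
    obtain Y where Y: "\<And>a m. a < r \<Longrightarrow> X (a, m) = (\<Sum>b<r. Y a b * \<Psi> y0 (b, m))" by blast
    define c' where "c' = (\<lambda>k. case k of Inl (a, b) \<Rightarrow> - Y a b | Inr v \<Rightarrow> c (Suc (the_inv_into {..<?m} h v)))"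
    have "(\<Sum>k\<in>gl_idx \<union> Inr ` V1. c' k * tangent y0 k (a, m)) = 0" for a m
    proof -
      have "(\<Sum>k\<in>gl_idx \<union> Inr ` V1. c' k * tangent y0 k (a, m)) =
          (\<Sum>k\<in>gl_idx. c' k * tangent y0 k (a, m)) + (\<Sum>k\<in>Inr ` V1. c' k * tangent y0 k (a, m))"
        by (rule sum.union_disjoint) (use assms in auto)
      also have "(\<Sum>k\<in>Inr ` V1. c' k * tangent y0 k (a, m)) = (\<Sum>v\<in>V1. c' (Inr v) * tangent y0 (Inr v) (a, m))"
        by (simp add: sum.reindex)
      also have "\<dots> = (\<Sum>j<?m. c' (Inr (h j)) * tangent y0 (Inr (h j)) (a, m))"
        by (rule sum.reindex_bij_betw[OF h, symmetric])
      also have "\<dots> = X (a, m)" unfolding X_def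
        by (rule sum.cong) (use h in \<open>auto simp: c'_def bij_betw_def the_inv_into_f_f\<close>)
      also have "(\<Sum>k\<in>gl_idx. c' k * tangent y0 k (a, m)) =
          (\<Sum>(a', b)\<in>{..<r} \<times> {..<r}. - Y a' b * row_shift a' b (\<Psi> y0) (a, m))"
        by (subst sum.reindex) (auto simp: c'_def intro!: sum.cong)
      also have "\<dots> = (\<Sum>a'<r. if a' = a then - (\<Sum>b<r. Y a' b * \<Psi> y0 (b, m)) else 0)"
        unfolding sum.cartesian_product[symmetric]
        by (rule sum.cong) (auto simp: row_shift_def sum_negf)
      also have "\<dots> = - X (a, m)"
      proof (cases "a < r")
        case False
        have "\<Psi> y (a, m) = 0" for y using \<Psi>_supp False by simp
        then have "X (a, m) = 0" by (simp add: X_def)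
        then show ?thesis using False by simp
      qed (simp add: Y)
      finally show ?thesis by simp
    qed
    then have "c' k = 0" if "k \<in> gl_idx \<union> Inr ` V1" for k
      using fam_indepD[OF assms(3) _ that, of c'] by auto
    moreover have "Inr (h j) \<in> gl_idx \<union> Inr ` V1" if "j < ?m" for j using h that by (auto simp: bij_betw_def)
    ultimately have "c' (Inr (h j)) = 0" if "j < ?m" for j using that by blast
    then have cS: "c (Suc j) = 0" if "j < ?m" for j
      using that h by (auto simp: c'_def bij_betw_def the_inv_into_f_f)
    then have "c 0 * pl r (\<Psi> y0) I = 0" using c[OF I(1)] by simp
    then have "c 0 = 0" using I by simp
    then show "\<forall>j\<in>{..<Suc ?m}. c j = 0" using cS by (auto simp: less_Suc_eq_0_disj)
  qed
  then obtain Js where Js: "Determinant.det (Matrix.mat (Suc ?m) (Suc ?m) (\<lambda>(i, j). G i (Js ! j))) \<noteq> 0"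
    using ex_minor_if_fam_indep by blast
  show ?thesis
  proof (rule that)
    show "length (L (Js ! i)) = r" for i by (simp add: L_def)
    show "hom_indep (slice V1 y0) ?m (\<lambda>i y. pl r (\<Psi> y) (L (Js ! i)))"
      by (rule hom_indep_if_jacobian[OF poly_fun_pl, of _ w]) (use w Js in \<open>auto simp: G_def\<close>)
  qed
qed

text \<open>The upper bound compares a chain with the polynomials on a slice on which the parametrization is
  immersive; the lower bound takes the closures of the images of a flag of such slices.\<close>

theorem krull_dim_closure_image:
  assumes nd: "\<exists>y. nondeg y"
    and max: "\<And>y K1. K1 \<subseteq> idx \<Longrightarrow> fam_indep K1 (tangent y) \<Longrightarrow> card K1 \<le> \<rho>"
    and att: "\<exists>y K1. K1 \<subseteq> idx \<and> fam_indep K1 (tangent y) \<and> card K1 = \<rho>"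
  shows "r * r \<le> \<rho>" "krull_dim (subtopology X (X closure_of (image UNIV))) = ereal (real (\<rho> - r * r))"
proof -
  obtain y1 K1 where K1: "K1 \<subseteq> idx" "fam_indep K1 (tangent y1)" "card K1 = \<rho>" using att by blast
  have finK1: "finite K1" using K1(1) finite_idx finite_subset by blast
  obtain \<delta> where \<delta>: "poly_fun V \<delta>" "\<delta> y1 \<noteq> 0" "\<And>y. \<delta> y \<noteq> 0 \<Longrightarrow> fam_indep K1 (tangent y)"
    by (rule generic_minor[where T = tangent and V = V, OF finK1 K1(2) poly_fun_tangent]) (rule that)
  obtain y2 I where I: "length I = r" "pl r (\<Psi> y2) I \<noteq> 0" using nd by (auto simp: nondeg_def)
  \<comment> \<open>A point at which the rank is maximal and the tuple is nondegenerate.\<close>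
  obtain y0 where y0: "\<delta> y0 \<noteq> 0" "pl r (\<Psi> y0) I \<noteq> 0"
    using poly_fun_slice_nonzero2[of V \<delta> "\<lambda>y. pl r (\<Psi> y) I" y1 UNIV y1 y2] \<delta> I poly_fun_pl by auto
  have nd0: "nondeg y0" using y0 I by (auto simp: nondeg_def)
  \<comment> \<open>\<open>K1\<close> attains the maximal rank but need not contain the
    \<open>GL\<^sub>r\<close>-directions. At \<open>y0\<close> they are independent and are extended
    to a spanning subfamily, which again has \<rho> members.\<close>
  obtain K0 where K0: "gl_idx \<subseteq> K0" "K0 \<subseteq> idx" "fam_indep K0 (tangent y0)"
    "\<forall>k\<in>idx. tangent y0 k \<in> fam_span K0 (tangent y0)"
    using fam_indep_extend[OF finite_idx _ gl_indep[OF nd0]] by blast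
  have finK0: "finite K0" using K0(2) finite_idx finite_subset by blast
  have "card K1 \<le> card K0"
    by (rule fam_indep_card_le[OF finK0 finK1 \<delta>(3)[OF y0(1)]]) (use K0(4) K1(1) in blast)
  then have cK0: "card K0 = \<rho>" using K1(3) max[OF K0(2,3)] by simp
  define V0 where "V0 = {v \<in> V. Inr v \<in> K0}"
  have K0V0: "K0 = gl_idx \<union> Inr ` V0" using K0(1,2) by (auto simp: V0_def)
  have V0: "V0 \<subseteq> V" "finite V0" using finV by (auto simp: V0_def)
  have "card K0 = card gl_idx + card (Inr ` V0 :: ((nat \<times> nat) + 'v) set)"
    unfolding K0V0 by (rule card_Un_disjoint) (use V0 in auto)
  then have card: "\<rho> = r * r + card V0"
    unfolding cK0 by (simp add: card_image card_cartesian_product)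
  show "r * r \<le> \<rho>" using card by simp
  have top: "topspace X = grass r W" by (rule topspace_zariski_grass[OF r])
  define C where "C = X closure_of (image UNIV)"
  have transversal: "eval_poly F (pl r (\<Psi> y)) = 0"
    if "F \<in> pforms r e" "\<And>y. y \<in> slice V0 y0 \<Longrightarrow> eval_poly F (pl r (\<Psi> y)) = 0" for F e y
    by (rule form_vanishes_if_on_transversal_slice[OF V0(1) K0(3)[unfolded K0V0] _ that])
      (use max cK0 K0V0 in auto)
  obtain h where h: "bij_betw h {..<card V0} V0"
    using ex_bij_betw_nat_finite[OF V0(2)] by (auto simp: atLeast0LessThan)
  define Vi where "Vi = (\<lambda>i. h ` {..<i})"
  define Z where "Z = (\<lambda>i. X closure_of (image (slice (Vi i) y0)))"
  have "krull_dim (subtopology X C) = ereal (real (card V0))"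
  proof (rule krull_dim_eqI)
    show "closedin X C" by (simp add: C_def)
    show "irreducible_closed X (Z i)" for i unfolding Z_def by (rule irreducible_closure_image[OF nd0])
    show "Z i \<subseteq> C" for i unfolding Z_def C_def by (rule closure_of_mono) (auto simp: image_def)
    show "Z i \<subset> Z (Suc i)" if i: "i < card V0" for i
    proof
      have "Vi i \<subseteq> Vi (Suc i)" by (auto simp: Vi_def)
      from slice_mono[OF this, of y0] show "Z i \<subseteq> Z (Suc i)"
        unfolding Z_def by (intro closure_of_mono) (auto simp: image_def)
      have sub: "Vi j \<subseteq> V0" "card (Vi j) = j" "finite (Vi j)" if "j \<le> card V0" for j
        using h that inj_on_subset[of h "{..<card V0}" "{..<j}"]
        by (auto simp: Vi_def bij_betw_def card_image)
      have "fam_indep (gl_idx \<union> Inr ` Vi (Suc i)) (tangent y0)"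
        by (rule fam_indep_mono[OF K0(3)]) (use sub(1)[of "Suc i"] i finK0 in \<open>auto simp: K0V0\<close>)
      from hom_indep_plucker_on_slice[OF nd0 sub(3)[of "Suc i"] this] i
      obtain J where J: "\<And>j. length (J j) = r"
        "hom_indep (slice (Vi (Suc i)) y0) (Suc i) (\<lambda>j y. pl r (\<Psi> y) (J j))"
        using sub(2)[of "Suc i"] by (metis Suc_leI)
      show "Z i \<noteq> Z (Suc i)"
      proof
        assume eq: "Z i = Z (Suc i)"
        \<comment> \<open>A relation that holds on the smaller slice gives a form vanishing on
          \<open>Z i\<close>. By the supposed equality it vanishes on the image of the larger slice,
          where the coordinates have no relation.\<close>
        have "hom_indep (slice (Vi i) y0) (Suc i) (\<lambda>j y. pl r (\<Psi> y) (J j))"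
          unfolding hom_indep_def
        proof (intro allI impI)
          fix k P assume P: "homogeneous k P" "vars P \<subseteq> {..Suc i}"
            "\<forall>y\<in>slice (Vi i) y0. eval_poly P (\<lambda>j. pl r (\<Psi> y) (J j)) = 0"
          define F where "F = poly_subst P (\<lambda>j. single (single (J j) 1) 1)"
          have F: "F \<in> pforms r (k * 1)"
            unfolding F_def by (rule pforms_subst[OF P(1) pforms_coordinate[OF J(1)]])
          have ev: "eval_poly F (pl r z) = eval_poly P (\<lambda>j. pl r z (J j))" for z
            by (simp add: F_def eval_poly_subst)
          have nonvanishing: "\<not> nonvanishing r F \<Lambda>" if "\<Lambda> \<in> image (slice (Vi i) y0)" for \<Lambda>
            using that P(3) nonvanishing_pt[OF _ F] ev by (auto simp: image_def)
          have "\<not> nonvanishing r F \<Lambda>" if "\<Lambda> \<in> Z (Suc i)" for \<Lambda>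
            using closure_vanishing[OF F nonvanishing] that[folded eq] by (simp add: Z_def)
          moreover have "image (slice (Vi (Suc i)) y0) \<subseteq> Z (Suc i)"
            unfolding Z_def using closure_of_subset[of _ X] image_grass top by metis
          ultimately have "eval_poly F (pl r (\<Psi> y)) = 0" if "y \<in> slice (Vi (Suc i)) y0" for y
            using form_vanishes_on_slice[OF slice_base nd0 F] that by blast
          then show "P = 0" using ev by (intro hom_indepD[OF J(2) P(1,2)]) auto
        qed
        from hom_indep_slice_le_card[OF _ poly_fun_pl this] show False using sub[of i] i by simp
      qed
    qed
    fix l Z' assume Z': "\<And>i. i \<le> l \<Longrightarrow> irreducible_closed X (Z' i)" "\<And>i. i < l \<Longrightarrow> Z' i \<subset> Z' (Suc i)" "Z' l \<subseteq> C"
    obtain e F where F: "\<And>i. i \<le> l \<Longrightarrow> F i \<in> pforms r e"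
      "\<And>k P. homogeneous k P \<Longrightarrow> vars P \<subseteq> {..l} \<Longrightarrow> (\<And>\<Lambda>. \<Lambda> \<in> Z' l \<Longrightarrow> \<not> nonvanishing r (poly_subst P F) \<Lambda>) \<Longrightarrow> P = 0"
      using hom_indep_forms_of_chain[where W = W and Z = Z' and l = l, OF r Z'(1,2)] by blast
    have "hom_indep (slice V0 y0) l (\<lambda>i y. eval_poly (F i) (pl r (\<Psi> y)))"
      unfolding hom_indep_def
    proof (intro allI impI)
      fix k P assume P: "homogeneous k P" "vars P \<subseteq> {..l}"
        "\<forall>y\<in>slice V0 y0. eval_poly P (\<lambda>i. eval_poly (F i) (pl r (\<Psi> y))) = 0"
      have S: "poly_subst P F \<in> pforms r (k * e)" by (rule pforms_subst[OF P(1)]) (use F(1) P(2) in auto)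
      have "eval_poly (poly_subst P F) (pl r (\<Psi> y)) = 0" for y
        by (rule transversal[OF S]) (use P(3) in \<open>simp add: eval_poly_subst\<close>)
      then have nonvanishing: "\<not> nonvanishing r (poly_subst P F) \<Lambda>" if "\<Lambda> \<in> image UNIV" for \<Lambda>
        using that nonvanishing_pt[OF _ S] by (auto simp: image_def)
      have "\<not> nonvanishing r (poly_subst P F) \<Lambda>" if "\<Lambda> \<in> Z' l" for \<Lambda>
        using closure_vanishing[OF S nonvanishing] that Z'(3) unfolding C_def by blast
      then show "P = 0" by (rule F(2)[OF P(1,2)])
    qed
    from hom_indep_slice_le_card[OF V0(2) poly_fun_form this] show "l \<le> card V0" by simp
  qed
  then show "krull_dim (subtopology X (X closure_of (image UNIV))) = ereal (real (\<rho> - r * r))"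
    using card by (simp add: C_def)
qed

end

section \<open>The Grassmannian and powers of linear forms\<close>

text \<open>If the inclusion were proper, \<open>C'\<close> would prolong a longest chain in
  \<open>C\<close>.\<close>

lemma krull_dim_eq_imp_eq:
  assumes C: "closedin X C" "irreducible_closed X C'" "C \<subseteq> C'"
    and dim: "krull_dim (subtopology X C) = ereal (real k)" "krull_dim (subtopology X C') = ereal (real k)"
  shows "C = C'"
proof (rule ccontr)
  assume "C \<noteq> C'"
  define S where "S = {k. \<exists>Z. (\<forall>i\<le>k. irreducible_closed X (Z i) \<and> Z i \<subseteq> C) \<and> (\<forall>i<k. Z i \<subset> Z (Suc i))}"
  have SUP: "(SUP k\<in>S. ereal (real k)) = ereal (real k)"
    using dim(1) unfolding krull_dim_def irreducible_closed_subtopology[OF C(1)] S_def .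
  have "\<exists>l\<in>S. k \<le> l"
  proof (rule ccontr)
    assume *: "\<not> (\<exists>l\<in>S. k \<le> l)"
    \<comment> \<open>The supremum is finite and has to be attained. Subtraction in the reals also
      covers \<open>k = 0\<close>, where \<open>S\<close> would be empty.\<close>
    have "(SUP k\<in>S. ereal (real k)) \<le> ereal (real k - 1)"
    proof (rule SUP_least)
      fix l assume "l \<in> S"
      then have "Suc l \<le> k" using * by (simp add: not_le Suc_leI)
      then show "ereal (real l) \<le> ereal (real k - 1)" by (simp add: of_nat_diff flip: of_nat_Suc)
    qed
    then show False unfolding SUP by simp
  qed
  then obtain l Z where l: "k \<le> l" and Z: "\<forall>i\<le>l. irreducible_closed X (Z i) \<and> Z i \<subseteq> C" "\<forall>i<l. Z i \<subset> Z (Suc i)"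
    unfolding S_def by blast
  define Z' where "Z' = (\<lambda>i. if i \<le> l then Z i else C')"
  have "(\<forall>i\<le>Suc l. irreducible_closed X (Z' i) \<and> Z' i \<subseteq> C') \<and> (\<forall>i<Suc l. Z' i \<subset> Z' (Suc i))"
  proof (intro conjI allI impI)
    fix i assume "i < Suc l"
    show "Z' i \<subset> Z' (Suc i)"
    proof (cases "i = l")
      case True
      then show ?thesis using Z(1) C(3) \<open>C \<noteq> C'\<close> by (auto simp: Z'_def)
    qed (use Z(2) \<open>i < Suc l\<close> in \<open>auto simp: Z'_def\<close>)
  qed (use Z(1) C in \<open>auto simp: Z'_def\<close>)
  then have "Suc l \<in> {k. \<exists>Z. (\<forall>i\<le>k. irreducible_closed X (Z i) \<and> Z i \<subseteq> C') \<and> (\<forall>i<k. Z i \<subset> Z (Suc i))}"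
    by blast
  moreover have "closedin X C'" using C(2) by (simp add: irreducible_closed_def)
  ultimately have "ereal (real (Suc l)) \<le> krull_dim (subtopology X C')"
    unfolding krull_dim_def using irreducible_closed_subtopology[of X C'] by (intro SUP_upper) simp
  then show False using l unfolding dim(2) by simp
qed

text \<open>The \<open>b e\<close> form the basis dual to the coordinates in \<open>E\<close>. The
  general \<open>vector_space\<close> setting serves both scalar multiplications: the one for forms
  and the one for tuples of forms.\<close>

lemma (in vector_space) dim_eq_card_coordinates:
  assumes E: "finite E" and K: "subspace K"
    and x: "\<And>u v e. x (u + v) e = x u e + x v e" "\<And>a u e. x (scale a u) e = a * x u e"
    and inj: "\<And>u. u \<in> K \<Longrightarrow> (\<And>e. e \<in> E \<Longrightarrow> x u e = 0) \<Longrightarrow> u = 0"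
    and ex: "\<And>e. e \<in> E \<Longrightarrow> \<exists>u\<in>K. \<forall>e'\<in>E. x u e' = (if e' = e then 1 else 0)"
  shows "dim K = card E"
proof -
  obtain b where b: "\<And>e. e \<in> E \<Longrightarrow> b e \<in> K" "\<And>e e'. e \<in> E \<Longrightarrow> e' \<in> E \<Longrightarrow> x (b e) e' = (if e' = e then 1 else 0)"
    using ex by metis
  have x0: "x 0 e = 0" for e using x(2)[of 0 0 e] by simp
  have xsum: "x (\<Sum>i\<in>I. f i) e = (\<Sum>i\<in>I. x (f i) e)" for I e and f :: "'z \<Rightarrow> 'b"
    by (induction I rule: infinite_finite_induct) (auto simp: x x0)
  have coord: "x (\<Sum>e\<in>E. scale (c e) (b e)) e' = c e'" if "e' \<in> E" for c e'
  proof -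
    have "x (\<Sum>e\<in>E. scale (c e) (b e)) e' = (\<Sum>e\<in>E. if e = e' then c e else 0)"
      unfolding xsum x by (rule sum.cong) (use b(2) that in auto)
    then show ?thesis using E that by simp
  qed
  have injb: "inj_on b E"
    by (rule inj_onI) (metis b(2) zero_neq_one)
  have "independent (b ` E)"
  proof (rule independent_if_scalars_zero)
    fix f v assume "(\<Sum>v\<in>b ` E. scale (f v) v) = 0" and "v \<in> b ` E"
    then obtain e where e: "e \<in> E" "v = b e" "(\<Sum>e\<in>E. scale (f (b e)) (b e)) = 0"
      by (auto simp: sum.reindex[OF injb])
    then show "f v = 0" using coord[OF e(1), of "\<lambda>e. f (b e)"] x0 by simp
  qed (use E in simp)
  moreover have "K = span (b ` E)"
  proof
    show "span (b ` E) \<subseteq> K" by (rule span_minimal) (use b K in auto)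
    show "K \<subseteq> span (b ` E)"
    proof
      fix u assume u: "u \<in> K"
      let ?w = "\<Sum>e\<in>E. scale (x u e) (b e)"
      have "u + scale (- 1) ?w = 0"
      proof (rule inj)
        show "u + scale (- 1) ?w \<in> K"
          by (intro subspace_add[OF K] subspace_scale[OF K] subspace_sum[OF K] u b)
        show "x (u + scale (- 1) ?w) e = 0" if "e \<in> E" for e unfolding x coord[OF that] by simp
      qed
      then have "u = ?w" by simp
      also have "?w \<in> span (b ` E)" by (intro span_sum span_scale span_base) auto
      finally show "u \<in> span (b ` E)" .
    qed
  qed
  ultimately have "dim K = card (b ` E)" by (simp add: dim_eq_card_independent)
  then show ?thesis by (simp add: card_image[OF injb])
qed

lemma dim_keys:
  assumes "finite B"
  shows "cvs.dim {f. keys f \<subseteq> B} = card B"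
proof (rule cvs.dim_eq_card_coordinates[OF assms subspace_keys, of lookup])
  fix u :: "'a \<Rightarrow>\<^sub>0 complex" assume u: "u \<in> {f. keys f \<subseteq> B}" "\<And>m. m \<in> B \<Longrightarrow> lookup u m = 0"
  show "u = 0"
  proof (rule poly_mapping_eqI)
    fix m show "lookup u m = lookup 0 m" using u by (cases "m \<in> B") (auto simp: in_keys_iff)
  qed
next
  fix m assume "m \<in> B"
  then show "\<exists>u\<in>{f. keys f \<subseteq> B}. \<forall>m'\<in>B. lookup u m' = (if m' = m then 1 else (0 :: complex))"
    by (intro bexI[of _ "single m 1"]) (auto simp: lookup_single when_def)
qed (simp_all add: lookup_add)

text \<open>The tautological parametrization; entries outside the finite index set are replaced by 0
  to meet the support condition of \<open>grass_param\<close>.\<close>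

definition all_tuples :: "nat \<Rightarrow> 'i set \<Rightarrow> (nat \<times> 'i \<Rightarrow> complex) \<Rightarrow> nat \<times> 'i \<Rightarrow> complex" where
  "all_tuples r B y c = (if c \<in> {..<r} \<times> B then y c else 0)"

text \<open>The partial derivatives of the tautological parametrization are the unit vectors, so its
  rank is \<open>r * card B\<close>, and every point of the Grassmannian is in its image.\<close>

lemma grassmannian_dim:
  assumes r: "r > 0" and B: "finite B" "r \<le> card B"
  shows "krull_dim (zariski_grass r {f :: 'i \<Rightarrow>\<^sub>0 complex. keys f \<subseteq> B}) = ereal (real (r * card B - r * r))"
    and "irreducible_closed (zariski_grass r {f :: 'i \<Rightarrow>\<^sub>0 complex. keys f \<subseteq> B}) (grass r {f. keys f \<subseteq> B})"
proof -
  let ?V = "{..<r} \<times> B"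
  interpret grass_param r B ?V "all_tuples r B"
    by unfold_locales (use r B in \<open>auto simp: all_tuples_def intro!: poly_fun_if poly_fun.intros\<close>)
  have tangent: "tangent y (Inr v) = unit_at v" if "v \<in> ?V" for y v
  proof
    fix c
    show "tangent y (Inr v) c = unit_at v c"
      unfolding tangent_simps using that by (cases "c \<in> ?V") (auto simp: all_tuples_def)
  qed
  have image: "image UNIV = grass r W"
  proof
    show "grass r W \<subseteq> image UNIV"
    proof
      fix \<Lambda> assume \<Lambda>: "\<Lambda> \<in> grass r W"
      obtain vs where vs: "is_basis vs \<Lambda>" using ex_basis_grass[OF \<Lambda> r] by blast
      have len: "length vs = r" by (rule is_basis_length[OF vs \<Lambda>])
      define y where "y = (\<lambda>(i, m). lookup (vs ! i) m)"
      have vsW: "vs ! i \<in> W" if "i < r" for i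
        using vs \<Lambda> len that cvs.span_base[of "vs ! i" "set vs"] unfolding is_basis_def grass_def by auto
      have "lookup (vs ! i) m = 0" if "i < r" "m \<notin> B" for i m
        using vsW[OF that(1)] that(2) by (auto simp: in_keys_iff)
      then have y: "all_tuples r B y (i, m) = lookup (vs ! i) m" if "i < r" for i m
        using that by (auto simp: all_tuples_def y_def)
      have len': "length (vecs y) = r" by (simp add: vecs_def)
      have "vecs y = vs"
      proof (rule nth_equalityI)
        fix i assume "i < length (vecs y)"
        then show "vecs y ! i = vs ! i" by (intro poly_mapping_eqI) (simp add: len' lookup_vecs y)
      qed (simp add: len len')
      then have "pt y = \<Lambda>" using vs by (simp add: pt_def is_basis_def)
      moreover have "nondeg y"
        using plucker_nonzero_if_basis[OF vs \<Lambda>] \<open>vecs y = vs\<close> unfolding nondeg_def plucker_vecs[symmetric] by simp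
      ultimately show "\<Lambda> \<in> image UNIV" unfolding image_def by blast
    qed
  qed (rule image_grass)
  have top: "topspace X = grass r W" by (rule topspace_zariski_grass[OF r])
  have cl: "X closure_of (image UNIV) = grass r W"
    unfolding image using closure_of_topspace[of X] top by simp
  obtain Bs where Bs: "set Bs = B" "distinct Bs" using finite_distinct_list[OF B(1)] by blast
  \<comment> \<open>The tuple of the first \<open>r\<close> unit vectors in an enumeration of
    \<open>B\<close>; one of its minors is the determinant of the identity matrix.\<close>
  have nd: "nondeg (\<lambda>(i, m). if m = Bs ! i then 1 else 0)"
    unfolding nondeg_def
  proof (intro exI conjI)
    show "length (take r Bs) = r" using B Bs distinct_card[of Bs] by auto
    have "Matrix.mat r r (\<lambda>(i, j). all_tuples r B (\<lambda>(i, m). if m = Bs ! i then 1 else 0) (i, take r Bs ! j)) = 1\<^sub>m r"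
      using B Bs distinct_card[of Bs] nth_eq_iff_index_eq[of Bs] nth_mem[of _ Bs]
      by (intro eq_matI) (auto simp: all_tuples_def)
    then show "pl r (all_tuples r B (\<lambda>(i, m). if m = Bs ! i then 1 else 0)) (take r Bs) \<noteq> 0"
      by (simp add: pl_def)
  qed
  have max: "card K1 \<le> r * card B" if K1: "K1 \<subseteq> idx" "fam_indep K1 (tangent y)" for y K1
  proof -
    have "card K1 \<le> card ?V"
    proof (rule fam_indep_card_le[OF finV _ K1(2), of unit_at])
      show "finite K1" using K1(1) finite_idx finite_subset by blast
      fix k assume k: "k \<in> K1"
      show "tangent y k \<in> fam_span ?V unit_at"
      proof (cases k)
        case (Inl p)
        then obtain a b where ab: "k = Inl (a, b)" "a < r" using k K1(1) by (cases p) auto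
        show ?thesis
        proof (rule fam_spanI)
          fix x :: "nat \<times> 'i"
          show "tangent y k x = (\<Sum>v\<in>?V. tangent y k v * unit_at v x)"
          proof (cases "x \<in> ?V")
            case True
            then show ?thesis using finV by (simp add: if_distrib[of "\<lambda>c. _ * c"] cong: if_cong)
          next
            case False
            obtain i m where x: "x = (i, m)" by fastforce
            have "tangent y k x = 0" using False ab by (auto simp: x row_shift_def all_tuples_def)
            moreover have "(\<Sum>v\<in>?V. tangent y k v * unit_at v x) = 0"
              by (rule sum.neutral) (use False in auto)
            ultimately show ?thesis by simp
          qed
        qed
      next
        case (Inr v)
        then have v: "v \<in> ?V" using k K1(1) by auto
        show ?thesis unfolding Inr tangent[OF v] by (rule fam_span_base[OF finV v])
      qed
    qed
    then show ?thesis by (simp add: card_cartesian_product)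
  qed
  have att: "fam_indep (Inr ` ?V) (tangent y)" for y
    unfolding fam_indep_def
  proof (intro allI impI ballI)
    fix c and k :: "(nat \<times> nat) + (nat \<times> 'i)"
    assume c: "\<forall>x. (\<Sum>k\<in>Inr ` ?V. c k * tangent y k x) = 0" and "k \<in> Inr ` ?V"
    then obtain v where v: "k = Inr v" "v \<in> ?V" by blast
    have "(\<Sum>k\<in>Inr ` ?V. c k * tangent y k v) = (\<Sum>w\<in>?V. c (Inr w) * tangent y (Inr w) v)"
      by (subst sum.reindex) auto
    also have "\<dots> = (\<Sum>w\<in>?V. if w = v then c (Inr w) else 0)"
      by (rule sum.cong) (use tangent in auto)
    finally show "c k = 0" using c v finV by simp
  qed
  have ex: "\<exists>y K1. K1 \<subseteq> idx \<and> fam_indep K1 (tangent y) \<and> card K1 = r * card B"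
    by (rule exI[of _ undefined], rule exI[of _ "Inr ` ?V"])
      (use att in \<open>simp add: card_image card_cartesian_product\<close>)
  have "subtopology X (grass r W) = X" using subtopology_topspace[of X] top by simp
  moreover have "krull_dim (subtopology X (X closure_of (image UNIV))) = ereal (real (r * card B - r * r))"
  proof (rule krull_dim_closure_image(2))
    show "\<exists>y. nondeg y" using nd by blast
    show "card K1 \<le> r * card B" if "K1 \<subseteq> idx" "fam_indep K1 (tangent y)" for y K1 by (rule max[OF that])
  qed (rule ex)
  ultimately show "krull_dim X = ereal (real (r * card B - r * r))" unfolding cl by simp
  show "irreducible_closed X (grass r W)" using irreducible_closure_image[OF nd, of UNIV] cl by simp
qed

section \<open>Monomial coordinates of forms and the multinomial theorem\<close>

definition mons :: "nat \<Rightarrow> nat \<Rightarrow> (nat \<Rightarrow>\<^sub>0 nat) set" where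
  "mons n d = {m. keys m \<subseteq> {..n} \<and> mdeg UNIV m = d}"

lemma forms_eq: "forms n d = {F. keys F \<subseteq> mons n d}"
  by (auto simp: forms_def mons_def homogeneous_on_alt vars_def)

lemma finite_mons: "finite (mons n d)"
proof (rule finite_subset[OF _ finite_box(1)[of "{..n}" d]])
  show "mons n d \<subseteq> {m. keys m \<subseteq> {..n} \<and> (\<forall>v. lookup m v \<le> d)}"
  proof
    fix m assume m: "m \<in> mons n d"
    have "lookup m v \<le> d" for v
    proof (cases "v \<in> keys m")
      case True
      then have "lookup m v \<le> mdeg UNIV m" unfolding mdeg_def by (intro member_le_sum) auto
      then show ?thesis using m by (simp add: mons_def)
    qed (simp add: in_keys_iff)
    then show "m \<in> {m. keys m \<subseteq> {..n} \<and> (\<forall>v. lookup m v \<le> d)}" using m by (simp add: mons_def)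
  qed
qed simp

lemma dim_forms: "cvs.dim (forms n d) = card (mons n d)"
  unfolding forms_eq by (rule dim_keys[OF finite_mons])

definition mfact :: "(nat \<Rightarrow>\<^sub>0 nat) \<Rightarrow> complex" where
  "mfact m = (\<Prod>v\<in>keys m. fact (lookup m v))"

text \<open>The multinomial coefficient of \<open>m\<close>. That it is nonzero makes the apolarity
  pairing perfect.\<close>

definition mcoef :: "(nat \<Rightarrow>\<^sub>0 nat) \<Rightarrow> complex" where
  "mcoef m = fact (mdeg UNIV m) / mfact m"

lemma mfact_nonzero: "mfact m \<noteq> 0" by (simp add: mfact_def)

lemma mcoef_nonzero: "mcoef m \<noteq> 0" by (simp add: mcoef_def mfact_nonzero)

lemma lookup_single_mult:
  fixes F :: "'v cpoly"
  shows "lookup (single (single v 1) c * F) m = (if lookup m v = 0 then 0 else c * lookup F (m - single v 1))"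
proof -
  have "single (single v 1) c * F = (\<Sum>b\<in>keys F. single (single v 1 + b) (c * lookup F b))"
    by (subst poly_mapping_expansion[of F]) (simp add: sum_distrib_left mult_single)
  then have eq: "lookup (single (single v 1) c * F) m =
      (\<Sum>b\<in>keys F. if single v 1 + b = m then c * lookup F b else 0)"
    by (simp add: lookup_sum lookup_single when_def)
  show ?thesis
  proof (cases "lookup m v = 0")
    case True
    then have "single v 1 + b \<noteq> m" for b by (auto simp: lookup_add)
    then show ?thesis unfolding eq using True by simp
  next
    case False
    then have "single v 1 + b = m \<longleftrightarrow> b = m - single v 1" for b
      by (auto simp: lookup_add lookup_minus lookup_single when_def intro!: poly_mapping_eqI)
    then show ?thesis unfolding eq using False by (simp add: in_keys_iff)
  qed
qed

lemma linear_form_expansion: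
  assumes "q \<in> forms n 1"
  shows "q = (\<Sum>v\<le>n. single (single v 1) (coords q v))"
proof (rule poly_mapping_eqI)
  fix m :: "nat \<Rightarrow>\<^sub>0 nat"
  have sum: "lookup (\<Sum>v\<le>n. single (single v 1) (coords q v)) m = (\<Sum>v\<le>n. if m = single v 1 then coords q v else 0)"
    by (simp add: lookup_sum lookup_single when_def eq_commute)
  show "lookup q m = lookup (\<Sum>v\<le>n. single (single v 1) (coords q v)) m"
  proof (cases "m \<in> mons n 1")
    case True
    then have "m \<noteq> 0" by (auto simp: mons_def)
    then obtain v where v: "lookup m v \<noteq> 0" by (metis poly_mapping_eqI lookup_zero)
    then have eq: "m = single v 1 + (m - single v 1)"
      by (auto simp: lookup_add lookup_minus lookup_single when_def intro!: poly_mapping_eqI)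
    then have "mdeg UNIV m = 1 + mdeg UNIV (m - single v 1)" by (metis mdeg_add mdeg_single UNIV_I)
    then have "m - single v 1 = 0" using True by (simp add: mons_def mdeg_UNIV_eq_0_iff)
    then have m: "m = single v 1" using eq by simp
    have "v \<in> keys m" using v by (simp add: in_keys_iff)
    then have "v \<le> n" using True by (auto simp: mons_def)
    moreover have "m = single w 1 \<longleftrightarrow> w = v" for w unfolding m by (metis lookup_single_eq lookup_single_not_eq zero_neq_one)
    ultimately show ?thesis unfolding sum by (simp add: coords_def m)
  next
    case False
    then have "lookup q m = 0" using assms by (auto simp: forms_eq in_keys_iff)
    moreover have "m \<noteq> single v 1" if "v \<le> n" for v using False that by (auto simp: mons_def mdeg_single)
    ultimately show ?thesis unfolding sum by (simp add: sum.neutral)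
  qed
qed

text \<open>Multiplying by \<open>q\<close> reaches \<open>m\<close> from every
  \<open>m - single v 1\<close>, with contributions proportional to the exponent of
  \<open>v\<close>. For degree k + 1 the exponents add up to k + 1, which turns k! into (k +
  1)!.\<close>

lemma multinomial:
  assumes "q \<in> forms n 1"
  shows "lookup (q ^ k) m = (if mdeg UNIV m = k then mcoef m * mon_eval m (coords q) else 0)"
proof (induction k arbitrary: m)
  case 0
  show ?case by (auto simp: mdeg_UNIV_eq_0_iff lookup_one mcoef_def mfact_def)
next
  case (Suc k)
  have coords0: "coords q v = 0" if "v > n" for v
    using assms that by (force simp: coords_def forms_eq mons_def in_keys_iff)
  have expand: "q ^ Suc k = (\<Sum>v\<le>n. single (single v 1) (coords q v) * q ^ k)"
    by (subst power_Suc, subst (1) linear_form_expansion[OF assms]) (simp add: sum_distrib_right)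
  have "lookup (q ^ Suc k) m =
      (\<Sum>v\<le>n. if lookup m v = 0 then 0 else coords q v * lookup (q ^ k) (m - single v 1))"
    unfolding expand lookup_sum lookup_single_mult ..
  also have "\<dots> = (\<Sum>v\<le>n. if mdeg UNIV m = Suc k then of_nat (lookup m v) * (fact k / mfact m * mon_eval m (coords q)) else 0)"
  proof (rule sum.cong[OF refl])
    fix v
    show "(if lookup m v = 0 then 0 else coords q v * lookup (q ^ k) (m - single v 1)) =
        (if mdeg UNIV m = Suc k then of_nat (lookup m v) * (fact k / mfact m * mon_eval m (coords q)) else 0)"
    proof (cases "lookup m v = 0")
      case False
      define m' where "m' = m - single v 1"
      have m: "m = single v 1 + m'"
        using False by (auto simp: m'_def lookup_add lookup_minus lookup_single when_def intro!: poly_mapping_eqI)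
      have deg: "mdeg UNIV m = Suc (mdeg UNIV m')" unfolding m by (simp add: mdeg_add mdeg_single)
      have ev: "mon_eval m (coords q) = coords q v * mon_eval m' (coords q)" unfolding m by (simp add: mon_eval_add)
      have "mfact m = of_nat (lookup m v) * mfact m'"
      proof -
        have "mfact m' = (\<Prod>w\<in>insert v (keys m - {v}). fact (lookup m' w))"
          unfolding mfact_def by (rule prod.mono_neutral_left) (auto simp: m'_def in_keys_iff lookup_minus)
        also have "\<dots> = fact (lookup m' v) * (\<Prod>w\<in>keys m - {v}. fact (lookup m' w))" by (rule prod.insert) auto
        also have "(\<Prod>w\<in>keys m - {v}. fact (lookup m' w)) = (\<Prod>w\<in>keys m - {v}. (fact (lookup m w) :: complex))"
          by (rule prod.cong) (auto simp: m'_def lookup_minus lookup_single when_def)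
        finally have 1: "mfact m' = fact (lookup m' v) * (\<Prod>w\<in>keys m - {v}. fact (lookup m w))" .
        have "mfact m = fact (lookup m v) * (\<Prod>w\<in>keys m - {v}. fact (lookup m w))"
          unfolding mfact_def by (rule prod.remove) (use False in \<open>auto simp: in_keys_iff\<close>)
        moreover have "lookup m v = Suc (lookup m' v)" unfolding m by (simp add: lookup_add)
        ultimately show ?thesis unfolding 1 by (simp add: mult.assoc)
      qed
      moreover have "of_nat (lookup m v) \<noteq> (0 :: complex)" using False by simp
      ultimately show ?thesis using False Suc.IH[of m'] mfact_nonzero[of m']
        unfolding m'_def[symmetric] by (simp add: deg ev mcoef_def)
    qed simp
  qed
  also have "\<dots> = (if mdeg UNIV m = Suc k then (\<Sum>v\<le>n. of_nat (lookup m v)) * (fact k / mfact m * mon_eval m (coords q)) else 0)"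
    by (simp add: sum_distrib_right del: times_divide_eq_left times_divide_eq_right)
  also have "\<dots> = (if mdeg UNIV m = Suc k then mcoef m * mon_eval m (coords q) else 0)"
  proof (cases "keys m \<subseteq> {..n}")
    case True
    have "(\<Sum>v\<le>n. of_nat (lookup m v)) = (of_nat (mdeg UNIV m) :: complex)"
      using mdeg_supset[of "{..n}" m UNIV] True by simp
    then show ?thesis by (simp add: mcoef_def)
  next
    case False
    then obtain v where v: "v \<in> keys m" "v > n" by (meson atMost_iff not_le subsetI)
    have "mon_eval m (coords q) = 0" unfolding mon_eval_def
      by (rule prod_zero) (use v coords0 in \<open>auto simp: in_keys_iff intro!: bexI[of _ v]\<close>)
    then show ?thesis by simp
  qed
  finally show ?case .
qed

lemma lookup_power_linear_form:
  assumes "q \<in> forms n 1"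
  shows "lookup (q ^ d) m = (if m \<in> mons n d then mcoef m * mon_eval m (coords q) else 0)"
proof (cases "keys m \<subseteq> {..n}")
  case False
  then obtain v where v: "v \<in> keys m" "v > n" by (meson atMost_iff not_le subsetI)
  have "coords q v = 0" using assms v by (force simp: coords_def forms_eq mons_def in_keys_iff)
  then have "mon_eval m (coords q) = 0" unfolding mon_eval_def
    by (intro prod_zero) (use v in \<open>auto simp: in_keys_iff intro!: bexI[of _ v]\<close>)
  then show ?thesis using False by (simp add: multinomial[OF assms] mons_def)
qed (simp add: multinomial[OF assms] mons_def)

section \<open>The parametrization of \<open>\<Sigma>\<close>\<close>

text \<open>\<open>Inl (i, j)\<close> is the matrix entry \<alpha>_ij and
  \<open>Inr (i, single v 1)\<close> the v-th coordinate of Q_i. The latter is indexed by a monomial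
  because the point is a linear form with these coefficients.\<close>

type_synonym pvar = "(nat \<times> nat) + (nat \<times> (nat \<Rightarrow>\<^sub>0 nat))"

definition point_coord :: "(pvar \<Rightarrow> complex) \<Rightarrow> nat \<Rightarrow> nat \<Rightarrow> complex" where
  "point_coord y i v = y (Inr (i, single v 1))"

definition term_exponent :: "nat \<Rightarrow> nat \<Rightarrow> (nat \<Rightarrow>\<^sub>0 nat) \<Rightarrow> pvar \<Rightarrow>\<^sub>0 nat" where
  "term_exponent i j m = single (Inl (i, j)) 1 + (\<Sum>v\<in>keys m. single (Inr (i, single v 1)) (lookup m v))"

text \<open>The coefficient at \<open>m\<close> of the sum of the \<alpha>_ij Q_i^d, as a formal
  polynomial: the open set of the theorem has to be given by a multihomogeneous polynomial and not
  just by a function.\<close>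

definition tuple_poly :: "nat \<Rightarrow> nat \<Rightarrow> nat \<Rightarrow> nat \<Rightarrow> nat \<times> (nat \<Rightarrow>\<^sub>0 nat) \<Rightarrow> pvar cpoly" where
  "tuple_poly n d r s = (\<lambda>(j, m). if j < r \<and> m \<in> mons n d then \<Sum>i<s. single (term_exponent i j m) (mcoef m) else 0)"

text \<open>The variables are named as in \<^const>\<open>zariski_points\<close>; only finitely many of them occur.\<close>

definition param_vars :: "nat \<Rightarrow> nat \<Rightarrow> nat \<Rightarrow> pvar set" where
  "param_vars n r s = ({..<s} \<times> {..<r}) <+> ({..<s} \<times> (\<lambda>v. single v 1) ` {..n})"

lemma finite_param_vars: "finite (param_vars n r s)"
  by (auto simp: param_vars_def intro!: finite_Plus)

lemma mon_eval_term_exponent: "mon_eval (term_exponent i j m) y = y (Inl (i, j)) * mon_eval m (point_coord y i)"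
  by (simp add: term_exponent_def mon_eval_add mon_eval_sum mon_eval_def[of m] point_coord_def)

lemma eval_tuple_poly: "eval_poly (tuple_poly n d r s (j, m)) y =
    (if j < r \<and> m \<in> mons n d then \<Sum>i<s. y (Inl (i, j)) * (mcoef m * mon_eval m (point_coord y i)) else 0)"
  by (simp add: tuple_poly_def eval_poly_sum mon_eval_term_exponent mult_ac)

lemma keys_term_exponent: "keys (term_exponent i j m) \<subseteq> insert (Inl (i, j)) ((\<lambda>v. Inr (i, single v 1)) ` keys m)"
proof
  fix k assume "k \<in> keys (term_exponent i j m)"
  then consider "k = Inl (i, j)"
    | "(\<Sum>v\<in>keys m. lookup (single (Inr (i, single v 1)) (lookup m v)) k) \<noteq> 0"
    by (auto simp: term_exponent_def keys_add_nat in_keys_iff lookup_sum split: if_splits)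
  then show "k \<in> insert (Inl (i, j)) ((\<lambda>v. Inr (i, single v 1)) ` keys m)"
  proof cases
    case 2
    then obtain v where "v \<in> keys m" "lookup (single (Inr (i, single v 1)) (lookup m v)) k \<noteq> 0"
      by (meson sum.not_neutral_contains_not_neutral)
    then show ?thesis by (auto simp: lookup_single when_def split: if_splits)
  qed simp
qed

lemma keys_tuple_poly: "k \<in> keys (tuple_poly n d r s (j, m)) \<Longrightarrow> j < r \<and> m \<in> mons n d \<and> (\<exists>i<s. k = term_exponent i j m)"
proof -
  assume k: "k \<in> keys (tuple_poly n d r s (j, m))"
  then have *: "j < r" "m \<in> mons n d" by (auto simp: tuple_poly_def split: if_splits)
  then have "(\<Sum>i<s. lookup (single (term_exponent i j m) (mcoef m)) k) \<noteq> 0"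
    using k by (simp add: tuple_poly_def in_keys_iff lookup_sum)
  then obtain i where "i < s" "lookup (single (term_exponent i j m) (mcoef m)) k \<noteq> 0"
    by (meson lessThan_iff sum.not_neutral_contains_not_neutral)
  then show ?thesis using * by (auto simp: lookup_single when_def split: if_splits)
qed

lemma vars_tuple_poly: "vars (tuple_poly n d r s c) \<subseteq> param_vars n r s"
proof
  fix v assume "v \<in> vars (tuple_poly n d r s c)"
  then obtain k where k: "k \<in> keys (tuple_poly n d r s (fst c, snd c))" "v \<in> keys k" by (auto simp: vars_def)
  obtain i where i: "fst c < r" "snd c \<in> mons n d" "i < s" "k = term_exponent i (fst c) (snd c)"
    using keys_tuple_poly[OF k(1)] by blast
  then have "v \<in> insert (Inl (i, fst c)) ((\<lambda>v. Inr (i, single v 1)) ` keys (snd c))"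
    using k(2) keys_term_exponent by blast
  moreover have "(\<lambda>v. single v 1) ` keys (snd c) \<subseteq> (\<lambda>v. single v 1) ` {..n}"
    using i(2) by (intro image_mono) (simp add: mons_def)
  ultimately show "v \<in> param_vars n r s" using i unfolding param_vars_def by blast
qed

lemma vanishes_at_line:
  assumes "homogeneous k F" "b \<noteq> 0"
  shows "vanishes_at F (cvs.span {b}) \<longleftrightarrow> eval_poly F (coords b) = 0"
proof -
  have "coords (cscale c b) = (\<lambda>v. c * coords b v)" for c by (simp add: coords_def fun_eq_iff)
  then have "eval_poly F (coords (cscale c b)) = c ^ k * eval_poly F (coords b)" for c
    using eval_poly_scale[OF assms(1)] by simp
  then show ?thesis
    using assms(2) cvs.span_base[of b "{b}"] by (auto simp: vanishes_at_def cvs.span_singleton)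
qed

lemma forms_expansion:
  assumes "F \<in> forms n d"
  shows "eval_poly F = (\<lambda>q. \<Sum>m\<in>mons n d. lookup F m * mon_eval m q)"
  using eval_poly_supset[OF finite_mons, of F n d] assms by (auto simp: forms_eq mon_eval_def)

lemma partial_deriv_forms_expansion:
  assumes "F \<in> forms n d"
  shows "eval_poly (partial_deriv v F) q = (\<Sum>m\<in>mons n d. lookup F m * dird (unit_at v) (mon_eval m) q)"
proof -
  have pf: "poly_fun UNIV (mon_eval m)" for m :: "nat \<Rightarrow>\<^sub>0 nat" by (rule poly_fun_mon_eval) simp
  have "dird (unit_at v) (eval_poly F) q = (\<Sum>m\<in>mons n d. dird (unit_at v) (\<lambda>q. lookup F m * mon_eval m q) q)"
    unfolding forms_expansion[OF assms] by (rule dird_sum[of _ UNIV]) (intro poly_fun.mult poly_fun.const pf)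
  then show ?thesis unfolding eval_partial_deriv dird_cmult[OF pf] .
qed

lemma eval_partial_deriv_comb:
  "eval_poly (partial_deriv v (comb r u X)) q = (\<Sum>j<r. lookup X j * eval_poly (partial_deriv v (lookup u j)) q)"
proof -
  have pf: "poly_fun UNIV (eval_poly F)" for F :: "nat cpoly" by (rule poly_fun_eval_poly) simp
  have "eval_poly (comb r u X) = (\<lambda>q. \<Sum>j<r. lookup X j * eval_poly (lookup u j) q)"
    by (simp add: fun_eq_iff comb_def eval_poly_sum eval_poly_cscale)
  then have "dird (unit_at v) (eval_poly (comb r u X)) q =
      (\<Sum>j<r. dird (unit_at v) (\<lambda>q. lookup X j * eval_poly (lookup u j) q) q)"
    using dird_sum[of "{..<r}" UNIV "\<lambda>j q. lookup X j * eval_poly (lookup u j) q"]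
    by (simp add: poly_fun.mult poly_fun.const pf)
  then show ?thesis unfolding eval_partial_deriv dird_cmult[OF pf] .
qed

text \<open>A determinant with two equal columns or with a zero column vanishes. This places the
  columns of a maximal minor among the actual unknowns, without repetition.\<close>

lemma minor_columns:
  assumes "Determinant.det (Matrix.mat k k (\<lambda>(i, j). v i (I ! j))) \<noteq> (0 :: complex)" "length I = k"
  shows "distinct I" "\<And>c. c \<in> set I \<Longrightarrow> \<exists>i<k. v i c \<noteq> 0"
proof -
  let ?A = "Matrix.mat k k (\<lambda>(i, j). v i (I ! j))"
  show "distinct I"
  proof (rule ccontr)
    assume "\<not> distinct I"
    then obtain i j where ij: "i < k" "j < k" "i \<noteq> j" "I ! i = I ! j" using assms(2) by (auto simp: distinct_conv_nth)
    then have "col ?A i = col ?A j" by (intro eq_vecI) auto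
    then show False using det_identical_columns[of ?A k i j] ij assms(1) by simp
  qed
  fix c assume "c \<in> set I"
  then obtain j where j: "j < k" "c = I ! j" using assms(2) by (auto simp: in_set_conv_nth)
  have "Determinant.det ?A = (\<Sum>i<k. ?A $$ (i, j) * cofactor ?A i j)"
    by (rule laplace_expansion_column) (use j in auto)
  also have "\<dots> = (\<Sum>i<k. v i c * cofactor ?A i j)" by (rule sum.cong) (use j in auto)
  finally show "\<exists>i<k. v i c \<noteq> 0" using assms(1) by (metis (no_types, lifting) lessThan_iff mult_zero_left sum.neutral)
qed

section \<open>The rank of the differential and the dimension of K\<close>

locale power_sums =
  fixes n d r s :: nat
  assumes pos: "0 < n" "0 < d" "0 < r" "0 < s" and rs: "r \<le> s" and sN: "s \<le> card (mons n d)"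
begin

definition Psi :: "(pvar \<Rightarrow> complex) \<Rightarrow> nat \<times> (nat \<Rightarrow>\<^sub>0 nat) \<Rightarrow> complex" where
  "Psi y c = eval_poly (tuple_poly n d r s c) y"

sublocale grass_param r "mons n d" "param_vars n r s" Psi
proof
  show "poly_fun (param_vars n r s) (\<lambda>y. Psi y c)" for c
    unfolding Psi_def by (rule poly_fun_eval_poly[OF vars_tuple_poly])
  show "Psi y c = 0" if "c \<notin> {..<r} \<times> mons n d" for c y
    using that by (cases c) (auto simp: Psi_def eval_tuple_poly)
qed (use pos finite_mons finite_param_vars in auto)

lemma Psi_eq: "Psi y (j, m) =
    (if j < r \<and> m \<in> mons n d then \<Sum>i<s. y (Inl (i, j)) * (mcoef m * mon_eval m (point_coord y i)) else 0)"
  by (simp add: Psi_def eval_tuple_poly)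

lemma tangent_matrix:
  assumes "i < s" "j' < r"
  shows "tangent y (Inr (Inl (i, j'))) (j, m) = (if j = j' \<and> m \<in> mons n d then mcoef m * mon_eval m (point_coord y i) else 0)"
  unfolding tangent_simps
proof (rule dirdI)
  let ?e = "\<lambda>t w. y w + t * unit_at (Inl (i, j')) w"
  have point_coord: "point_coord (?e t) i' = point_coord y i'" for t i' by (simp add: point_coord_def fun_eq_iff)
  have "Psi (?e t) (j, m) = Psi y (j, m) + t * (if j = j' \<and> m \<in> mons n d then mcoef m * mon_eval m (point_coord y i) else 0)" for t
  proof (cases "j < r \<and> m \<in> mons n d")
    case True
    have "Psi (?e t) (j, m) = (\<Sum>i'<s. y (Inl (i', j)) * (mcoef m * mon_eval m (point_coord y i')) +
        (if i' = i then t * (if j = j' then mcoef m * mon_eval m (point_coord y i) else 0) else 0))"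
      unfolding Psi_eq point_coord using True by (auto intro!: sum.cong simp: ring_distribs)
    then show ?thesis using True assms by (simp add: Psi_eq sum.distrib)
  qed (use assms in \<open>auto simp: Psi_eq\<close>)
  then show "((\<lambda>t. Psi (?e t) (j, m)) has_field_derivative
      (if j = j' \<and> m \<in> mons n d then mcoef m * mon_eval m (point_coord y i) else 0)) (at 0)"
    by (auto intro!: derivative_eq_intros)
qed

lemma tangent_point:
  assumes "i < s"
  shows "tangent y (Inr (Inr (i, single v 1))) (j, m) =
    (if j < r \<and> m \<in> mons n d then y (Inl (i, j)) * (mcoef m * dird (unit_at v) (mon_eval m) (point_coord y i)) else 0)"
  unfolding tangent_simps
proof (rule dirdI)
  let ?e = "\<lambda>t w. y w + t * unit_at (Inr (i, single v 1)) w"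
  have point_coord: "point_coord (?e t) i' = (if i' = i then \<lambda>w. point_coord y i w + t * unit_at v w else point_coord y i')" for t i'
  proof -
    have "single w 1 = single v (1 :: nat) \<longleftrightarrow> w = v" for w
      by (metis lookup_single_eq lookup_single_not_eq zero_neq_one)
    then show ?thesis by (auto simp: point_coord_def fun_eq_iff)
  qed
  show "((\<lambda>t. Psi (?e t) (j, m)) has_field_derivative (if j < r \<and> m \<in> mons n d
      then y (Inl (i, j)) * (mcoef m * dird (unit_at v) (mon_eval m) (point_coord y i)) else 0)) (at 0)"
  proof (cases "j < r \<and> m \<in> mons n d")
    case True
    have "Psi (?e t) (j, m) = y (Inl (i, j)) * (mcoef m * mon_eval m (\<lambda>w. point_coord y i w + t * unit_at v w)) +
        (\<Sum>i'\<in>{..<s} - {i}. y (Inl (i', j)) * (mcoef m * mon_eval m (point_coord y i')))" for t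
      unfolding Psi_eq point_coord using True assms
      by (subst sum.remove[of _ i]) (auto intro!: sum.cong)
    then show ?thesis using True
      by (auto intro!: derivative_eq_intros has_dird[OF poly_fun_mon_eval[of m UNIV]])
  next
    case False
    then have "Psi y (j, m) = 0" for y by (auto simp: Psi_eq)
    then show ?thesis using False by auto
  qed
qed

text \<open>The tuple depends linearly on the matrix \<open>A\<close>, so a change of basis of the
  tuple can be carried out on the columns of \<open>A\<close>: entry \<open>b\<close> put in slot
  \<open>a\<close> is the combination with coefficients \<alpha>_ib of the derivatives by
  \<alpha>_ia.\<close>

lemma tangent_gl_in_span:
  assumes "a < r" "b < r"
  shows "tangent y (Inl (a, b)) \<in> fam_span (Inr ` param_vars n r s) (tangent y)"
proof (rule fam_span_trans)
  show "finite {..<s}" by simp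
  show "tangent y (Inr (Inl (i, a))) \<in> fam_span (Inr ` param_vars n r s) (tangent y)" if "i \<in> {..<s}" for i
    by (rule fam_span_base) (use that assms finite_param_vars in \<open>auto simp: param_vars_def\<close>)
  show "tangent y (Inl (a, b)) \<in> fam_span {..<s} (\<lambda>i. tangent y (Inr (Inl (i, a))))"
  proof (rule fam_spanI)
    fix x :: "nat \<times> (nat \<Rightarrow>\<^sub>0 nat)"
    obtain j m where x: "x = (j, m)" by fastforce
    show "tangent y (Inl (a, b)) x = (\<Sum>i<s. y (Inl (i, b)) * tangent y (Inr (Inl (i, a))) x)"
      unfolding x using assms
      by (simp add: tangent_matrix del: tangent_simps(2)) (auto simp: row_shift_def Psi_eq)
  qed
qed

text \<open>The generic rank of the differential, here the greatest rank at any point; the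
  \<open>GL\<^sub>r\<close>-directions are left out of the count.\<close>

definition rho :: nat where
  "rho = (GREATEST k. \<exists>y K. K \<subseteq> Inr ` param_vars n r s \<and> fam_indep K (tangent y) \<and> card K = k)"

lemma rho:
  shows "\<exists>y K. K \<subseteq> Inr ` param_vars n r s \<and> fam_indep K (tangent y) \<and> card K = rho"
    and "K \<subseteq> Inr ` param_vars n r s \<Longrightarrow> fam_indep K (tangent y) \<Longrightarrow> card K \<le> rho"
proof -
  let ?P = "\<lambda>k. \<exists>y K. K \<subseteq> Inr ` param_vars n r s \<and> fam_indep K (tangent y) \<and> card K = k"
  have P0: "?P 0" by (intro exI[of _ undefined] exI[of _ "{}"]) (simp add: fam_indep_def)
  have bound: "\<forall>k. ?P k \<longrightarrow> k \<le> card (param_vars n r s)"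
    using card_mono[of "Inr ` param_vars n r s"] finite_param_vars by (auto simp: card_image)
  show "?P rho" unfolding rho_def by (rule GreatestI_nat[of ?P, OF P0]) (use bound in blast)
  show "card K \<le> rho" if "K \<subseteq> Inr ` param_vars n r s" "fam_indep K (tangent y)"
    unfolding rho_def by (rule Greatest_le_nat[of ?P]) (use bound that in blast)+
qed

text \<open>Including the \<open>GL\<^sub>r\<close>-directions does not raise the rank, since they
  lie in the span of the partial derivatives. This is the maximality that the dimension theorem
  needs.\<close>

lemma rho_max:
  assumes "K1 \<subseteq> idx" "fam_indep K1 (tangent y)"
  shows "card K1 \<le> rho"
proof -
  obtain K0 where K0: "K0 \<subseteq> Inr ` param_vars n r s" "fam_indep K0 (tangent y)"
    "\<forall>k\<in>Inr ` param_vars n r s. tangent y k \<in> fam_span K0 (tangent y)"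
    using fam_indep_extend[of "Inr ` param_vars n r s" "{}" "tangent y"] finite_param_vars by (auto simp: fam_indep_def)
  have fin: "finite (Inr ` param_vars n r s)" "finite K0" "finite K1"
    using finite_param_vars K0(1) assms(1) finite_idx finite_subset by blast+
  have "tangent y k \<in> fam_span K0 (tangent y)" if "k \<in> K1" for k
  proof -
    have "tangent y k \<in> fam_span (Inr ` param_vars n r s) (tangent y)"
      using that assms(1) tangent_gl_in_span fam_span_base[OF fin(1)] by blast
    then show ?thesis by (rule fam_span_trans[OF fin(1), rotated]) (use K0(3) in blast)
  qed
  from fam_indep_card_le[OF fin(2,3) assms(2) this] have "card K1 \<le> card K0" .
  also have "\<dots> \<le> rho" by (rule rho(2)[OF K0(1,2)])
  finally show ?thesis .
qed

text \<open>With the multinomial coefficients divided out, pairing with \<open>q\<^sup>d\<close> is evaluation at \<open>q\<close>.\<close>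

definition dual_coord :: "(nat \<Rightarrow>\<^sub>0 nat cpoly) \<Rightarrow> nat \<times> (nat \<Rightarrow>\<^sub>0 nat) \<Rightarrow> complex" where
  "dual_coord u = (\<lambda>(j, m). lookup (lookup u j) m / mcoef m)"

definition pairing :: "(pvar \<Rightarrow> complex) \<Rightarrow> (nat \<Rightarrow>\<^sub>0 nat cpoly) \<Rightarrow> (nat \<times> nat) + pvar \<Rightarrow> complex" where
  "pairing y u k = (\<Sum>c\<in>{..<r} \<times> mons n d. dual_coord u c * tangent y k c)"

lemma pairing_matrix:
  assumes "i < s" "j' < r" "lookup u j' \<in> forms n d"
  shows "pairing y u (Inr (Inl (i, j'))) = eval_poly (lookup u j') (point_coord y i)"
proof -
  have "pairing y u (Inr (Inl (i, j'))) = (\<Sum>j<r. \<Sum>m\<in>mons n d. dual_coord u (j, m) *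
      (if j = j' \<and> m \<in> mons n d then mcoef m * mon_eval m (point_coord y i) else 0))"
    unfolding pairing_def sum.cartesian_product by (auto intro!: sum.cong simp: tangent_matrix[OF assms(1,2)] simp del: tangent_simps)
  also have "\<dots> = (\<Sum>j<r. if j = j' then \<Sum>m\<in>mons n d. lookup (lookup u j) m * mon_eval m (point_coord y i) else 0)"
    by (rule sum.cong) (auto simp: dual_coord_def mcoef_nonzero intro!: sum.cong)
  also have "\<dots> = eval_poly (lookup u j') (point_coord y i)"
    using assms(2) forms_expansion[OF assms(3)] by simp
  finally show ?thesis .
qed

lemma pairing_point:
  assumes "i < s" "\<And>j. j < r \<Longrightarrow> lookup u j \<in> forms n d" "\<And>j. j < r \<Longrightarrow> y (Inl (i, j)) = lookup a j"
  shows "pairing y u (Inr (Inr (i, single v 1))) = eval_poly (partial_deriv v (comb r u a)) (point_coord y i)"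
proof -
  have "pairing y u (Inr (Inr (i, single v 1))) = (\<Sum>j<r. \<Sum>m\<in>mons n d. dual_coord u (j, m) *
      (y (Inl (i, j)) * (mcoef m * dird (unit_at v) (mon_eval m) (point_coord y i))))"
    unfolding pairing_def sum.cartesian_product by (auto intro!: sum.cong simp: tangent_point[OF assms(1), of y v, unfolded One_nat_def] simp del: tangent_simps)
  also have "\<dots> = (\<Sum>j<r. lookup a j * (\<Sum>m\<in>mons n d. lookup (lookup u j) m * dird (unit_at v) (mon_eval m) (point_coord y i)))"
    by (rule sum.cong) (auto simp: dual_coord_def mcoef_nonzero assms(3) sum_distrib_left mult_ac intro!: sum.cong)
  also have "\<dots> = (\<Sum>j<r. lookup a j * eval_poly (partial_deriv v (lookup u j)) (point_coord y i))"
    by (rule sum.cong) (auto simp: partial_deriv_forms_expansion[OF assms(2)])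
  finally show ?thesis by (simp add: eval_partial_deriv_comb)
qed

text \<open>Vanishing to order two also asks the combination itself to vanish at the point, which
  follows from the vanishing of the individual forms. Its derivatives by variables beyond
  \<open>n\<close> are zero.\<close>

lemma Kspace_iff:
  assumes A: "\<And>i j. i < s \<Longrightarrow> j < r \<Longrightarrow> y (Inl (i, j)) = lookup (A i) j"
    and b: "\<And>i. i < s \<Longrightarrow> b i \<noteq> 0 \<and> Q i = cvs.span {b i} \<and> point_coord y i = coords (b i)"
  shows "u \<in> Kspace n d r s A Q \<longleftrightarrow> keys u \<subseteq> {..<r} \<and> (\<forall>j<r. lookup u j \<in> forms n d) \<and>
    (\<forall>k\<in>Inr ` param_vars n r s. pairing y u k = 0)"
proof (cases "keys u \<subseteq> {..<r} \<and> (\<forall>j<r. lookup u j \<in> forms n d)")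
  case True
  then have F: "lookup u j \<in> forms n d" if "j < r" for j using that by blast
  have hom: "homogeneous d (lookup u j)" if "j < r" for j using F[OF that] by (simp add: forms_def)
  have comb: "comb r u X \<in> forms n d" for X unfolding comb_def
    by (intro cvs.subspace_sum[OF subspace_forms] cvs.subspace_scale[OF subspace_forms] F) simp
  obtain d' where d': "d = Suc d'" using pos by (cases d) auto
  have homc: "homogeneous d (comb r u X)" "homogeneous d' (partial_deriv v (comb r u X))" for X v
    using comb[of X] homogeneous_partial_deriv[of d' "comb r u X" v] by (auto simp: forms_def d')
  have van: "vanishes_at (lookup u j) (Q i) \<longleftrightarrow> pairing y u (Inr (Inl (i, j))) = 0" if "i < s" "j < r" for i j
    using vanishes_at_line[OF hom[OF that(2)]] b[OF that(1)] pairing_matrix[OF that F[OF that(2)]] by simp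
  have van2: "vanishes_at (partial_deriv v (comb r u (A i))) (Q i) \<longleftrightarrow> pairing y u (Inr (Inr (i, single v 1))) = 0"
    if "i < s" for i v
    using vanishes_at_line[OF homc(2)] b[OF that] pairing_point[OF that F A[OF that]] by simp
  have van3: "vanishes_at (comb r u (A i)) (Q i)" if "i < s" "\<forall>j<r. vanishes_at (lookup u j) (Q i)" for i
  proof -
    have "\<forall>j<r. eval_poly (lookup u j) (coords (b i)) = 0"
      using that vanishes_at_line[OF hom] b[OF that(1)] by auto
    then have "eval_poly (comb r u (A i)) (coords (b i)) = 0"
      by (simp add: comb_def eval_poly_sum eval_poly_cscale)
    then show ?thesis using vanishes_at_line[OF homc(1)] b[OF that(1)] by auto
  qed
  have big: "vanishes_at (partial_deriv v (comb r u (A i))) (Q i)" if "v > n" for v i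
  proof -
    have "partial_deriv v (comb r u (A i)) = 0"
      by (rule partial_deriv_eq_0) (use comb[of "A i"] that in \<open>auto simp: forms_def\<close>)
    then show ?thesis by (simp add: vanishes_at_def)
  qed
  have "u \<in> Kspace n d r s A Q \<longleftrightarrow>
      (\<forall>i<s. \<forall>j<r. vanishes_at (lookup u j) (Q i)) \<and> (\<forall>i<s. \<forall>v\<le>n. vanishes_at (partial_deriv v (comb r u (A i))) (Q i))"
    (is "_ \<longleftrightarrow> ?R")
  proof
    assume ?R
    then have "vanishes_at (partial_deriv v (comb r u (A i))) (Q i)" if "i < s" for i v
      using that big by (cases "v \<le> n") auto
    then show "u \<in> Kspace n d r s A Q"
      using \<open>?R\<close> True van3 by (simp add: Kspace_def vanishes_twice_at_def)
  qed (simp add: Kspace_def vanishes_twice_at_def)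
  also have "\<dots> \<longleftrightarrow> (\<forall>i<s. \<forall>j<r. pairing y u (Inr (Inl (i, j))) = 0) \<and>
      (\<forall>i<s. \<forall>v\<le>n. pairing y u (Inr (Inr (i, single v 1))) = 0)"
    using van van2 by auto
  also have "\<dots> \<longleftrightarrow> (\<forall>k\<in>Inr ` param_vars n r s. pairing y u k = 0)"
    by (auto simp: param_vars_def)
  finally show ?thesis using True by simp
qed (auto simp: Kspace_def)

text \<open>\<open>K\<close> is given by linear equations of rank \<open>rho\<close> in
  \<open>r * card (mons n d)\<close> unknowns. With a nonzero maximal minor in the columns
  \<open>I\<close>, the unknowns outside \<open>I\<close> are free and determine the others.
  Triviality of \<open>K\<close> is stated separately because a dimension of type \<open>nat\<close>
  is 0 for an infinite basis too.\<close>

lemma dim_Kspace: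
  assumes A: "\<And>i j. i < s \<Longrightarrow> j < r \<Longrightarrow> y (Inl (i, j)) = lookup (A i) j"
    and b: "\<And>i. i < s \<Longrightarrow> b i \<noteq> 0 \<and> Q i = cvs.span {b i} \<and> point_coord y i = coords (b i)"
    and K1: "K1 \<subseteq> Inr ` param_vars n r s" "fam_indep K1 (tangent y)" "card K1 = rho"
  shows "rho \<le> r * card (mons n d)" "tvs.dim (Kspace n d r s A Q) = r * card (mons n d) - rho"
    and "Kspace n d r s A Q \<subseteq> {0} \<longleftrightarrow> rho = r * card (mons n d)"
proof -
  let ?C = "{..<r} \<times> mons n d"
  let ?K = "Kspace n d r s A Q"
  have finC: "finite ?C" using finite_mons by simp
  have finK1: "finite K1" using K1(1) finite_param_vars finite_subset by blast
  obtain h where h: "bij_betw h {..<rho} K1"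
    using ex_bij_betw_nat_finite[OF finK1] K1(3) by (auto simp: atLeast0LessThan)
  have hk: "h i \<in> Inr ` param_vars n r s" if "i < rho" for i using h that K1(1) by (auto simp: bij_betw_def)
  obtain I where I: "length I = rho" "Determinant.det (Matrix.mat rho rho (\<lambda>(i, j). tangent y (h i) (I ! j))) \<noteq> 0"
    using ex_minor_if_fam_indep[of rho "\<lambda>i. tangent y (h i)"] fam_indep_reindex[OF h, of "tangent y"] K1(2) by blast
  let ?D = "Determinant.det (Matrix.mat rho rho (\<lambda>(i, j). tangent y (h i) (I ! j)))"
  let ?cof = "\<lambda>k j. cofactor (Matrix.mat rho rho (\<lambda>(i, j). tangent y (h i) (I ! j))) k j"
  have supp: "tangent y k c = 0" if "k \<in> Inr ` param_vars n r s" "c \<notin> ?C" for k c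
  proof -
    have "(\<lambda>y. Psi y c) = (\<lambda>_. 0)" using \<Psi>_supp[OF that(2)] by simp
    then show ?thesis using that(1) by auto
  qed
  have dI: "distinct I" and setI: "set I \<subseteq> ?C"
    using minor_columns[where v = "\<lambda>i. tangent y (h i)" and k = rho and I = I] I supp hk by blast+
  have cardI: "card (set I) = rho" using dI I(1) by (simp add: distinct_card)
  define E where "E = ?C - set I"
  have cardC: "card ?C = r * card (mons n d)" by (simp add: card_cartesian_product)
  show le: "rho \<le> r * card (mons n d)" using card_mono[OF finC setI] cardI cardC by simp
  have cardE: "card E = r * card (mons n d) - rho"
    unfolding E_def using card_Diff_subset[OF _ setI] cardI cardC by simp
  have finE: "finite E" using finC by (simp add: E_def)
  have K: "u \<in> ?K \<longleftrightarrow> keys u \<subseteq> {..<r} \<and> (\<forall>j<r. lookup u j \<in> forms n d) \<and>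
      (\<forall>k\<in>Inr ` param_vars n r s. pairing y u k = 0)" for u
    by (rule Kspace_iff[OF A b])
  have dual_coord: "dual_coord (u + v) c = dual_coord u c + dual_coord v c" "dual_coord (tscale a u) c = a * dual_coord u c" for u v a c
    by (auto simp: dual_coord_def lookup_add add_divide_distrib split: prod.split)
  have pair: "pairing y (u + v) k = pairing y u k + pairing y v k" "pairing y (tscale a u) k = a * pairing y u k" for u v a k
    by (simp_all add: pairing_def dual_coord ring_distribs sum.distrib sum_distrib_left mult_ac)
  have sub: "tvs.subspace ?K"
    unfolding tvs.subspace_def
  proof (intro conjI allI impI ballI)
    have "pairing y 0 k = 0" for k by (simp add: pairing_def dual_coord_def case_prod_unfold)
    then show "0 \<in> ?K" using K[of 0] cvs.subspace_0[OF subspace_forms, of n d] by simp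
    show "u + v \<in> ?K" if "u \<in> ?K" "v \<in> ?K" for u v
      using that keys_add[of u v] unfolding K
      by (auto simp: pair lookup_add intro!: cvs.subspace_add[OF subspace_forms])
    show "tscale a u \<in> ?K" if "u \<in> ?K" for a u
    proof -
      have "keys (tscale a u) \<subseteq> keys u" by (auto simp: in_keys_iff)
      then show ?thesis using that unfolding K by (auto simp: pair intro!: cvs.subspace_scale[OF subspace_forms])
    qed
  qed
  have inj: "u = 0" if u: "u \<in> ?K" "\<And>c. c \<in> E \<Longrightarrow> dual_coord u c = 0" for u
  proof -
    have "(\<Sum>j<rho. tangent y (h i) (I ! j) * dual_coord u (I ! j)) = 0" if i: "i < rho" for i
    proof -
      have "0 = pairing y u (h i)" using u(1) hk[OF i] unfolding K by fastforce
      also have "\<dots> = (\<Sum>c\<in>set I. dual_coord u c * tangent y (h i) c)"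
        unfolding pairing_def by (rule sum.mono_neutral_right) (use finC setI u(2) in \<open>auto simp: E_def\<close>)
      also have "\<dots> = (\<Sum>j<rho. dual_coord u (I ! j) * tangent y (h i) (I ! j))"
        using sum.reindex_bij_betw[OF bij_betw_nth[OF dI], of "{..<rho}" "set I" "\<lambda>c. dual_coord u c * tangent y (h i) c"] I(1)
        by simp
      finally show ?thesis by (simp add: mult.commute)
    qed
    then have "Matrix.mat rho rho (\<lambda>(i, j). tangent y (h i) (I ! j)) *\<^sub>v vec rho (\<lambda>j. dual_coord u (I ! j)) = 0\<^sub>v rho"
      by (intro eq_vecI) (auto simp: scalar_prod_def atLeast0LessThan)
    then have "vec rho (\<lambda>j. dual_coord u (I ! j)) = 0\<^sub>v rho"
      using det_0_iff_vec_prod_zero[of "Matrix.mat rho rho (\<lambda>(i, j). tangent y (h i) (I ! j))" rho] I(2)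
        vec_carrier[of rho "\<lambda>j. dual_coord u (I ! j)"] by (metis mat_carrier)
    then have "dual_coord u (I ! j) = 0" if "j < rho" for j using that by (metis index_vec index_zero_vec(1))
    then have "dual_coord u c = 0" if "c \<in> set I" for c using that I(1) by (auto simp: in_set_conv_nth)
    then have "dual_coord u c = 0" if "c \<in> ?C" for c using that u(2) by (cases "c \<in> set I") (auto simp: E_def)
    then have z: "lookup (lookup u j) m = 0" if "j < r" "m \<in> mons n d" for j m
      using that mcoef_nonzero by (force simp: dual_coord_def)
    have "lookup u j = 0" for j
    proof (cases "j < r")
      case True
      then have "lookup u j \<in> forms n d" using u(1) unfolding K by blast
      then show ?thesis using z[OF True] by (intro poly_mapping_eqI) (auto simp: forms_eq in_keys_iff)
    qed (use u(1) in \<open>auto simp: K in_keys_iff\<close>)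
    then show ?thesis by (intro poly_mapping_eqI) simp
  qed
  have ex: "\<exists>u\<in>?K. \<forall>c'\<in>E. dual_coord u c' = (if c' = c then 1 else 0)" if c: "c \<in> E" for c
  proof -
    \<comment> \<open>Cramer's solution for the unknowns in \<open>I\<close> when the free unknown
      \<open>c\<close> is 1 and the other free unknowns are 0.\<close>
    define w where "w = (\<lambda>j. - (\<Sum>k<rho. ?cof k j * tangent y (h k) c) / ?D)"
    define z where "z = (\<lambda>c'. (if c' = c then 1 else 0) + (\<Sum>j<rho. if I ! j = c' then w j else 0))"
    define u where "u = (\<Sum>j<r. single j (\<Sum>m\<in>mons n d. single m (mcoef m * z (j, m))))"
    have lu: "lookup (lookup u j) m = (if j < r \<and> m \<in> mons n d then mcoef m * z (j, m) else 0)" for j m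
      by (auto simp: u_def lookup_sum lookup_single when_def finite_mons)
    have uz: "dual_coord u c' = z c'" if "c' \<in> ?C" for c' using that mcoef_nonzero by (auto simp: dual_coord_def lu)
    have sumz: "(\<Sum>c'\<in>?C. z c' * T c') = T c + (\<Sum>j<rho. w j * T (I ! j))" for T
    proof -
      have cC: "c \<in> ?C" using c by (simp add: E_def)
      have "(\<Sum>c'\<in>?C. z c' * T c') = (\<Sum>c'\<in>?C. if c' = c then T c' else 0) +
          (\<Sum>c'\<in>?C. \<Sum>j<rho. if I ! j = c' then w j * T c' else 0)"
        by (auto simp: z_def ring_distribs sum.distrib[symmetric] sum_distrib_right if_distrib[of "\<lambda>x. x * _"] intro!: sum.cong)
      also have "(\<Sum>c'\<in>?C. \<Sum>j<rho. if I ! j = c' then w j * T c' else 0) =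
          (\<Sum>j<rho. \<Sum>c'\<in>?C. if I ! j = c' then w j * T c' else 0)" by (rule sum.swap)
      also have "\<dots> = (\<Sum>j<rho. w j * T (I ! j))"
      proof (rule sum.cong[OF refl])
        fix j assume "j \<in> {..<rho}"
        then have "I ! j \<in> ?C" using setI I(1) nth_mem[of j I] by auto
        then show "(\<Sum>c'\<in>?C. if I ! j = c' then w j * T c' else 0) = w j * T (I ! j)" using finC by simp
      qed
      finally show ?thesis using finC cC by simp
    qed
    have pu: "pairing y u k = tangent y k c + (\<Sum>j<rho. w j * tangent y k (I ! j))" for k
    proof -
      have "pairing y u k = (\<Sum>c'\<in>?C. z c' * tangent y k c')" unfolding pairing_def by (rule sum.cong) (simp_all add: uz)
      then show ?thesis by (simp only: sumz)
    qed
    have p0: "pairing y u (h i) = 0" if i: "i < rho" for i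
    proof -
      have "(\<Sum>j<rho. w j * tangent y (h i) (I ! j)) =
          (\<Sum>j<rho. \<Sum>k<rho. - (tangent y (h i) (I ! j) * ?cof k j) * tangent y (h k) c / ?D)"
        by (rule sum.cong) (simp_all add: w_def sum_distrib_left sum_distrib_right sum_divide_distrib sum_negf mult_ac)
      also have "\<dots> = (\<Sum>k<rho. - (\<Sum>j<rho. tangent y (h i) (I ! j) * ?cof k j) * tangent y (h k) c / ?D)"
        by (subst sum.swap) (simp add: sum_distrib_right sum_divide_distrib sum_negf)
      also have "\<dots> = (\<Sum>k<rho. if k = i then - tangent y (h k) c else 0)"
        by (rule sum.cong) (use mat_adjugate[of i rho _ "\<lambda>i j. tangent y (h i) (I ! j)"] I(2) i in auto)
      finally show ?thesis unfolding pu using i by simp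
    qed
    \<comment> \<open>The remaining equations follow from those in \<open>K1\<close>: as
      \<open>rho\<close> is maximal, \<open>K1\<close> spans all partial derivatives.\<close>
    have "pairing y u k = 0" if k: "k \<in> Inr ` param_vars n r s" for k
    proof -
      have "tangent y k \<in> fam_span K1 (tangent y)"
      proof (rule ccontr)
        assume *: "tangent y k \<notin> fam_span K1 (tangent y)"
        then have "k \<notin> K1" using fam_span_base[OF finK1] by blast
        moreover have "card (insert k K1) \<le> rho"
          by (rule rho(2)[OF _ fam_indep_insert[OF finK1 K1(2) *]]) (use k K1 in auto)
        ultimately show False using finK1 K1(3) by simp
      qed
      then obtain a where a: "\<And>x. tangent y k x = (\<Sum>\<kappa>\<in>K1. a \<kappa> * tangent y \<kappa> x)" unfolding fam_span_def by blast
      have "pairing y u k = (\<Sum>c\<in>?C. \<Sum>\<kappa>\<in>K1. a \<kappa> * (dual_coord u c * tangent y \<kappa> c))"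
        unfolding pairing_def a by (simp add: sum_distrib_left mult_ac)
      also have "\<dots> = (\<Sum>\<kappa>\<in>K1. a \<kappa> * pairing y u \<kappa>)"
        unfolding pairing_def by (subst sum.swap) (simp add: sum_distrib_left)
      also have "\<dots> = 0" using p0 h by (intro sum.neutral) (auto simp: bij_betw_def)
      finally show ?thesis .
    qed
    moreover have "keys u \<subseteq> {..<r}"
    proof
      fix j assume "j \<in> keys u"
      then obtain m where "lookup (lookup u j) m \<noteq> 0" unfolding in_keys_iff by (metis poly_mapping_eqI lookup_zero)
      then show "j \<in> {..<r}" unfolding lu by (auto split: if_splits)
    qed
    moreover have "lookup u j \<in> forms n d" for j by (auto simp: forms_eq in_keys_iff lu split: if_splits)
    ultimately have "u \<in> ?K" unfolding K by simp
    moreover have "dual_coord u c' = (if c' = c then 1 else 0)" if "c' \<in> E" for c'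
    proof -
      have "I ! j \<noteq> c'" if "j < rho" for j using \<open>c' \<in> E\<close> that I(1) by (metis DiffD2 E_def nth_mem)
      then have "z c' = (if c' = c then 1 else 0)" by (simp add: z_def)
      then show ?thesis using uz[of c'] that by (simp add: E_def)
    qed
    ultimately show ?thesis by blast
  qed
  show "tvs.dim ?K = r * card (mons n d) - rho"
    using tvs.dim_eq_card_coordinates[OF finE sub, of dual_coord] dual_coord inj ex cardE by auto
  show "?K \<subseteq> {0} \<longleftrightarrow> rho = r * card (mons n d)"
  proof
    assume K0: "?K \<subseteq> {0}"
    have "E = {}"
    proof (rule ccontr)
      assume "E \<noteq> {}"
      then obtain c where "c \<in> E" by blast
      obtain u where u: "u \<in> ?K" "\<forall>c'\<in>E. dual_coord u c' = (if c' = c then 1 else 0)"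
        using ex[OF \<open>c \<in> E\<close>] by blast
      then have "dual_coord u c = 1" using \<open>c \<in> E\<close> by simp
      then have "dual_coord 0 c = 1" using K0 u(1) by auto
      then show False by (simp add: dual_coord_def case_prod_unfold)
    qed
    then show "rho = r * card (mons n d)" using cardE le by simp
  next
    assume "rho = r * card (mons n d)"
    then have "E = {}" using cardE finE by simp
    then show "?K \<subseteq> {0}" using inj by blast
  qed
qed

end

section \<open>Representatives of points and multihomogeneity of minors\<close>

lemma proj_line:
  assumes "l \<in> proj V" "a \<in> l - {0}"
  shows "l = cvs.span {a}" "a \<in> V"
proof -
  obtain vs where vs: "is_basis vs l" using ex_basis_grass[OF assms(1)] by auto
  then have "length vs = 1" using is_basis_length assms(1) by blast
  then obtain x where "vs = [x]" by (auto simp: length_Suc_conv)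
  then have l: "l = cvs.span {x}" using vs by (simp add: is_basis_def)
  then obtain c where c: "a = cscale c x" "c \<noteq> 0" using assms(2) by (auto simp: cvs.span_singleton)
  then have "x = cscale (1 / c) a" by simp
  then have "x \<in> cvs.span {a}" by (metis cvs.span_scale cvs.span_base insertI1)
  moreover have "a \<in> cvs.span {x}" unfolding c(1) by (rule cvs.span_scale, rule cvs.span_base) simp
  ultimately show "l = cvs.span {a}" unfolding l by (intro cvs.span_eq[THEN iffD2] conjI) simp_all
  show "a \<in> V" using assms by (auto simp: grass_def)
qed

lemma line_in_proj:
  assumes "a \<in> V" "a \<noteq> 0" "cvs.subspace V"
  shows "cvs.span {a} \<in> proj V"
proof -
  have "cvs.independent {a}" using assms(2) by simp
  then have "cvs.dim (cvs.span {a}) = 1" by (simp add: cvs.dim_eq_card_independent)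
  then show ?thesis using cvs.span_minimal[of "{a}" V] assms by (simp add: grass_def)
qed

lemma eval_poly_signof: "eval_poly (signof p) y = signof p"
proof -
  have "eval_poly (- 1) y = - 1" using eval_poly_add[of "-1" 1 y] by (simp add: eq_neg_iff_add_eq_0)
  then show ?thesis by (simp add: sign_def)
qed

lemma eval_poly_det:
  fixes G :: "nat \<Rightarrow> nat \<Rightarrow> 'v cpoly"
  shows "eval_poly (Determinant.det (Matrix.mat k k (\<lambda>(i, j). G i j))) y =
    Determinant.det (Matrix.mat k k (\<lambda>(i, j). eval_poly (G i j) y))"
  unfolding det_def'[OF mat_carrier]
  by (auto simp: eval_poly_sum eval_poly_mult eval_poly_prod eval_poly_signof permutes_in_image intro!: sum.cong prod.cong)

lemma signof_cases: "signof p = (1 :: 'a :: ring_1) \<or> signof p = (- 1 :: 'a)"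
  by (simp add: sign_def)

text \<open>Every term of the determinant takes one factor from each row, so degrees that are
  constant along the rows add up.\<close>

lemma homogeneous_on_det:
  fixes G :: "nat \<Rightarrow> nat \<Rightarrow> 'v cpoly"
  assumes "\<And>i j. i < k \<Longrightarrow> j < k \<Longrightarrow> homogeneous_on B (\<kappa> i) (G i j)"
  shows "homogeneous_on B (\<Sum>i = 0..<k. \<kappa> i) (Determinant.det (Matrix.mat k k (\<lambda>(i, j). G i j)))"
  unfolding det_def'[OF mat_carrier]
proof (rule homogeneous_on_sum)
  fix p assume p: "p \<in> {p. p permutes {0..<k}}"
  have "homogeneous_on B (\<Sum>i = 0..<k. \<kappa> i) (\<Prod>i = 0..<k. Matrix.mat k k (\<lambda>(i, j). G i j) $$ (i, p i))"
    using p by (intro homogeneous_on_prod) (auto simp: permutes_in_image intro!: assms)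
  moreover have "homogeneous_on B 0 (signof p :: 'v cpoly)"
    using signof_cases[of p, where 'a = "'v cpoly"] homogeneous_on_1[of B]
    by (auto simp: homogeneous_on_def)
  ultimately show "homogeneous_on B (\<Sum>i = 0..<k. \<kappa> i)
      (signof p * (\<Prod>i = 0..<k. Matrix.mat k k (\<lambda>(i, j). G i j) $$ (i, p i)))"
    using homogeneous_on_mult by fastforce
qed

lemma vars_det:
  fixes G :: "nat \<Rightarrow> nat \<Rightarrow> 'v cpoly"
  assumes "\<And>i j. i < k \<Longrightarrow> j < k \<Longrightarrow> vars (G i j) \<subseteq> A"
  shows "vars (Determinant.det (Matrix.mat k k (\<lambda>(i, j). G i j))) \<subseteq> A"
  unfolding det_def'[OF mat_carrier]
proof (rule order_trans[OF vars_sum], rule UN_least)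
  fix p assume p: "p \<in> {p. p permutes {0..<k}}"
  have "vars (\<Prod>i = 0..<k. Matrix.mat k k (\<lambda>(i, j). G i j) $$ (i, p i)) \<subseteq> A"
    using p by (intro order_trans[OF vars_prod] UN_least) (auto simp: permutes_in_image dest!: subsetD[OF assms, rotated 2])
  moreover have "vars (signof p :: 'v cpoly) = {}"
    using signof_cases[of p, where 'a = "'v cpoly"] by (auto simp: vars_def)
  ultimately show "vars (signof p * (\<Prod>i = 0..<k. Matrix.mat k k (\<lambda>(i, j). G i j) $$ (i, p i))) \<subseteq> A"
    using vars_mult[of "signof p" "\<Prod>i = 0..<k. Matrix.mat k k (\<lambda>(i, j). G i j) $$ (i, p i)"] by blast
qed

definition pidx :: "pvar \<Rightarrow> nat" where
  "pidx v = (case v of Inl (i, _) \<Rightarrow> i | Inr (i, _) \<Rightarrow> i)"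

text \<open>Differentiation by \<open>v\<close> leaves only the summand of the point to which
  \<open>v\<close> belongs, and the degrees of its monomials in the coordinates of each point are
  known.\<close>

lemma keys_partial_deriv_tuple_poly:
  assumes "k \<in> keys (partial_deriv v (tuple_poly n d r s c))"
  shows "\<exists>j. \<exists>m\<in>mons n d. k + single v 1 = term_exponent (pidx v) j m"
proof -
  obtain j m where c: "c = (j, m)" by fastforce
  have "k + single v 1 \<in> keys (tuple_poly n d r s (j, m))"
    using assms by (simp add: c in_keys_iff lookup_partial_deriv)
  then obtain i where i: "m \<in> mons n d" "k + single v 1 = term_exponent i j m" using keys_tuple_poly by blast
  have "v \<in> keys (k + single v 1)" by (simp add: keys_add_nat)
  then have "pidx v = i" unfolding i(2) using keys_term_exponent[of i j m] by (auto simp: pidx_def)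
  then show ?thesis using i by blast
qed

lemma homogeneous_on_partial_deriv_tuple_poly:
  assumes "\<And>j m. m \<in> mons n d \<Longrightarrow> mdeg B (term_exponent (pidx v) j m) = e"
  shows "homogeneous_on B (e - mdeg B (single v 1)) (partial_deriv v (tuple_poly n d r s c))"
  unfolding homogeneous_on_alt
proof
  fix k assume "k \<in> keys (partial_deriv v (tuple_poly n d r s c))"
  then obtain j m where "m \<in> mons n d" "k + single v 1 = term_exponent (pidx v) j m"
    using keys_partial_deriv_tuple_poly by blast
  then have "mdeg B (k + single v 1) = e" using assms by simp
  then show "mdeg B k = e - mdeg B (single v 1)" by (simp add: mdeg_add)
qed

lemma mdeg_term_exponent_Inl: "mdeg (range (\<lambda>j. Inl (i, j))) (term_exponent i0 j m) = (if i0 = i then 1 else 0)"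
  by (auto simp: term_exponent_def mdeg_add mdeg_sum mdeg_single)

lemma mdeg_term_exponent_Inr:
  assumes "m \<in> mons n d"
  shows "mdeg (range (\<lambda>j. Inr (i, j))) (term_exponent i0 j m) = (if i0 = i then d else 0)"
proof -
  have "(\<Sum>v\<in>keys m. lookup m v) = d" using assms by (simp add: mons_def mdeg_def)
  then show ?thesis by (auto simp: term_exponent_def mdeg_add mdeg_sum mdeg_single image_iff)
qed

section \<open>The set \<Sigma> as a parametrized set\<close>

context power_sums
begin

definition power_coeff :: "(pvar \<Rightarrow> complex) \<Rightarrow> nat \<Rightarrow> (nat \<Rightarrow>\<^sub>0 nat) \<Rightarrow> complex" where
  "power_coeff y i m = (if m \<in> mons n d then mcoef m * mon_eval m (point_coord y i) else 0)"

lemma Psi_power_coeff: "j < r \<Longrightarrow> Psi y (j, m) = (\<Sum>i<s. y (Inl (i, j)) * power_coeff y i m)"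
  by (simp add: Psi_eq power_coeff_def)

definition linear_form :: "(pvar \<Rightarrow> complex) \<Rightarrow> nat \<Rightarrow> nat cpoly" where
  "linear_form y i = (\<Sum>v\<le>n. single (single v 1) (point_coord y i v))"

lemma linear_form_in_forms: "linear_form y i \<in> forms n 1"
  unfolding linear_form_def
proof (rule cvs.subspace_sum[OF subspace_forms])
  fix v assume "v \<in> {..n}"
  then show "single (single v 1) (point_coord y i v) \<in> forms n 1"
    by (auto simp: forms_eq mons_def mdeg_single)
qed

lemma coords_linear_form: "v \<le> n \<Longrightarrow> coords (linear_form y i) v = point_coord y i v"
proof -
  assume v: "v \<le> n"
  have "single w 1 = single v (1 :: nat) \<longleftrightarrow> w = v" for w
    by (metis lookup_single_eq lookup_single_not_eq zero_neq_one)
  then show ?thesis using v by (simp add: coords_def linear_form_def lookup_sum lookup_single when_def del: One_nat_def)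
qed

lemma lookup_linear_form_power: "lookup (linear_form y i ^ d) = power_coeff y i"
proof
  fix m
  have "mon_eval m (coords (linear_form y i)) = mon_eval m (point_coord y i)" if "m \<in> mons n d"
    using that unfolding mon_eval_def by (intro prod.cong) (auto simp: mons_def coords_linear_form subset_iff)
  then show "lookup (linear_form y i ^ d) m = power_coeff y i m"
    by (simp add: lookup_power_linear_form[OF linear_form_in_forms] power_coeff_def)
qed

lemma W_eq_forms: "W = forms n d"
  by (simp add: forms_eq)

lemma in_span_list:
  assumes "distinct ps" "f \<in> cvs.span (set ps)"
  shows "\<exists>c. f = (\<Sum>i<length ps. cscale (c i) (ps ! i))"
proof -
  obtain u where u: "f = (\<Sum>v\<in>set ps. cscale (u v) v)" using assms(2) cvs.span_finite[of "set ps"] by auto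
  have "(\<Sum>v\<in>set ps. cscale (u v) v) = (\<Sum>i<length ps. cscale (u (ps ! i)) (ps ! i))"
    using sum.reindex_bij_betw[OF bij_betw_nth[OF assms(1) refl refl], of "\<lambda>v. cscale (u v) v"] by simp
  then show ?thesis using u by (intro exI[of _ "\<lambda>i. u (ps ! i)"]) simp
qed

text \<open>Expanding a basis of \<Lambda> in the powers gives the matrix entries, and the chosen
  linear forms give the remaining coordinates of the parameter.\<close>

lemma Sigma_set_subset_image: "Sigma_set n d r s \<subseteq> image UNIV"
proof
  fix \<Lambda> assume "\<Lambda> \<in> Sigma_set n d r s"
  then obtain qs where \<Lambda>: "\<Lambda> \<in> grass r (forms n d)" and qs: "length qs = s" "set qs \<subseteq> forms n 1 - {0}"
      "distinct (map (\<lambda>q. q ^ d) qs)"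
    and sub: "\<Lambda> \<subseteq> cvs.span (\<Union>Q\<in>(\<lambda>q. cvs.span {q}) ` set qs. (\<lambda>q. q ^ d) ` Q)"
    by (auto simp: Sigma_set_def Uset_def)
  define ps where "ps = map (\<lambda>q. q ^ d) qs"
  \<comment> \<open>All representatives of a point have proportional powers, (c q)^d = c^d q^d, so
    one power for each point spans.\<close>
  have "(\<Union>Q\<in>(\<lambda>q. cvs.span {q}) ` set qs. (\<lambda>q. q ^ d) ` Q) \<subseteq> cvs.span (set ps)"
  proof
    fix f assume "f \<in> (\<Union>Q\<in>(\<lambda>q. cvs.span {q}) ` set qs. (\<lambda>q. q ^ d) ` Q)"
    then obtain q c where q: "q \<in> set qs" "f = (cscale c q) ^ d" by (auto simp: cvs.span_singleton)
    have "cscale c q = single 0 c * q" for c and q :: "nat cpoly"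
      unfolding cscale_def by (rule mult_map_scale_conv_mult)
    then have "f = (single 0 c) ^ d * q ^ d" unfolding q(2) by (simp only: power_mult_distrib)
    moreover have "(single 0 c :: nat cpoly) ^ k = single 0 (c ^ k)" for k
      by (induction k) (simp_all add: mult_single)
    ultimately have "f = cscale (c ^ d) (q ^ d)"
      using \<open>\<And>c q. cscale c q = single 0 c * q\<close> by simp
    moreover have "q ^ d \<in> set ps" using q(1) by (simp add: ps_def)
    ultimately show "f \<in> cvs.span (set ps)" by (simp add: cvs.span_scale cvs.span_base)
  qed
  from order_trans[OF sub cvs.span_minimal[OF this cvs.subspace_span]]
  have span: "\<Lambda> \<subseteq> cvs.span (set ps)" .
  obtain vs where vs: "is_basis vs \<Lambda>" using ex_basis_grass[OF \<Lambda> r] by blast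
  have len: "length vs = r" by (rule is_basis_length[OF vs \<Lambda>])
  have vs\<Lambda>: "vs ! j \<in> \<Lambda>" if "j < r" for j
    using vs that len cvs.span_base[of "vs ! j" "set vs"] unfolding is_basis_def by auto
  have "\<exists>c. j < r \<longrightarrow> vs ! j = (\<Sum>i<s. cscale (c i) (qs ! i ^ d))" for j
  proof (cases "j < r")
    case True
    then have "vs ! j \<in> cvs.span (set ps)" using vs\<Lambda> span by blast
    from in_span_list[OF _ this] qs(1,3) show ?thesis by (auto simp: ps_def)
  qed simp
  then obtain c where c: "\<And>j. j < r \<Longrightarrow> vs ! j = (\<Sum>i<s. cscale (c j i) (qs ! i ^ d))" by metis
  define y :: "pvar \<Rightarrow> complex" where "y = case_sum (\<lambda>(i, j). c j i) (\<lambda>(i, e). lookup (qs ! i) e)"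
  have point_coord: "point_coord y i = coords (qs ! i)" for i by (simp add: point_coord_def y_def coords_def fun_eq_iff)
  have power_coeff: "lookup (qs ! i ^ d) m = power_coeff y i m" if "i < s" for i m
  proof -
    have "qs ! i \<in> forms n 1" using qs(1,2) \<open>i < s\<close> nth_mem[of i qs] by blast
    then show ?thesis by (simp add: lookup_power_linear_form power_coeff_def point_coord del: One_nat_def)
  qed
  have len': "length (vecs y) = r" by (simp add: vecs_def)
  have "vecs y = vs"
  proof (rule nth_equalityI)
    fix j assume "j < length (vecs y)"
    then have j: "j < r" by (simp add: len')
    show "vecs y ! j = vs ! j"
      by (rule poly_mapping_eqI) (simp add: lookup_vecs[OF j] Psi_power_coeff[OF j] c[OF j] lookup_sum power_coeff, simp add: y_def)
  qed (simp add: len len')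
  then have "pt y = \<Lambda>" "nondeg y"
    using vs plucker_nonzero_if_basis[OF vs \<Lambda>] unfolding pt_def nondeg_def plucker_vecs[symmetric] is_basis_def by auto
  then show "\<Lambda> \<in> image UNIV" unfolding image_def by blast
qed

lemma image_subset_Sigma_set:
  assumes "\<And>y. \<eta> y \<noteq> 0 \<Longrightarrow> fam_indep {..<s} (power_coeff y)"
  shows "image {y. \<eta> y \<noteq> 0} \<subseteq> Sigma_set n d r s"
proof
  fix \<Lambda> assume "\<Lambda> \<in> image {y. \<eta> y \<noteq> 0}"
  then obtain y where y: "nondeg y" "\<Lambda> = pt y" "fam_indep {..<s} (power_coeff y)" using assms by (auto simp: image_def)
  define qs where "qs = map (linear_form y) [0..<s]"
  define ps where "ps = map (\<lambda>q. q ^ d) qs"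
  have "lookup (ps ! i) = power_coeff y i" if "i < s" for i using that by (simp add: ps_def qs_def lookup_linear_form_power)
  then have "fam_indep {..<s} (\<lambda>i. lookup (ps ! i))"
    using y(3) fam_indep_cong[of "{..<s}" "\<lambda>i. lookup (ps ! i)" "power_coeff y"] by simp
  then have ps: "distinct ps" "cvs.independent (set ps)" using fam_indep_list[of ps] by (simp_all add: ps_def qs_def)
  have nonvanishing: "q \<noteq> 0" if "q \<in> set qs" for q
  proof
    assume "q = 0"
    then have "0 \<in> set ps" using that pos(2) by (force simp: ps_def)
    then show False using ps(2) cvs.dependent_zero by blast
  qed
  define M where "M = mset (map (\<lambda>q. cvs.span {q}) qs)"
  have "M \<in> Uset n d s"
    unfolding Uset_def M_def
    by (intro CollectI exI[of _ qs] conjI refl) (use ps nonvanishing linear_form_in_forms in \<open>auto simp: ps_def qs_def\<close>)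
  moreover have "pt y \<subseteq> cvs.span (\<Union>Q\<in>set_mset M. (\<lambda>q. q ^ d) ` Q)"
    unfolding pt_def
  proof (rule cvs.span_minimal[OF _ cvs.subspace_span], rule subsetI)
    fix f assume "f \<in> set (vecs y)"
    then obtain j where j: "j < r" "f = vecs y ! j" by (auto simp: in_set_conv_nth vecs_def)
    have f: "f = (\<Sum>i<s. cscale (y (Inl (i, j))) (linear_form y i ^ d))"
      unfolding j(2) by (rule poly_mapping_eqI) (simp add: lookup_vecs[OF j(1)] Psi_power_coeff[OF j(1)] lookup_sum lookup_linear_form_power)
    have mem: "linear_form y i ^ d \<in> (\<Union>Q\<in>set_mset M. (\<lambda>q. q ^ d) ` Q)" if "i < s" for i
      using that by (auto simp: M_def qs_def intro!: bexI[of _ i] imageI cvs.span_base)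
    show "f \<in> cvs.span (\<Union>Q\<in>set_mset M. (\<lambda>q. q ^ d) ` Q)"
      unfolding f by (rule cvs.span_sum, rule cvs.span_scale, rule cvs.span_base, rule mem) simp
  qed
  moreover have "pt y \<in> grass r (forms n d)" using pt_basis(2)[OF y(1)] W_eq_forms by simp
  ultimately show "\<Lambda> \<in> Sigma_set n d r s" unfolding Sigma_set_def y(2) by blast
qed

text \<open>The powers of linear forms span, since no nonzero form vanishes at all points.\<close>

lemma ex_independent_powers: "\<exists>y. fam_indep {..<s} (power_coeff y)"
proof -
  let ?N = "card (mons n d)"
  obtain h where h: "bij_betw h {..<?N} (mons n d)"
    using ex_bij_betw_nat_finite[OF finite_mons] by (auto simp: atLeast0LessThan)
  define v where "v = (\<lambda>i q. mcoef (h i) * mon_eval (h i) q)"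
  have hm: "h i \<in> mons n d" if "i < ?N" for i using h that by (auto simp: bij_betw_def)
  have "fam_indep {..<?N} v"
    unfolding fam_indep_def
  proof (intro allI impI ballI)
    fix c i assume c: "\<forall>q. (\<Sum>k<?N. c k * v k q) = 0" and i: "i \<in> {..<?N}"
    define F where "F = (\<Sum>k<?N. single (h k) (c k * mcoef (h k)))"
    have "F = 0"
    proof (rule homogeneous_eval_eq_0)
      show "homogeneous d F" unfolding F_def
        by (intro homogeneous_on_sum homogeneous_on_single) (use hm in \<open>auto simp: mons_def\<close>)
      show "eval_poly F q = 0" for q using c by (simp add: F_def eval_poly_sum v_def mult.assoc)
    qed
    moreover have "lookup F (h i) = (\<Sum>k<?N. if k = i then c k * mcoef (h k) else 0)"
      unfolding F_def lookup_sum lookup_single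
      by (rule sum.cong) (use h i in \<open>auto simp: bij_betw_def inj_on_def when_def\<close>)
    ultimately show "c i = 0" using i mcoef_nonzero by simp
  qed
  \<comment> \<open>The columns \<open>I\<close> are points; the transpose of the minor is the
    coefficient matrix of the d-th powers of the corresponding linear forms.\<close>
  then obtain I where I: "Determinant.det (Matrix.mat ?N ?N (\<lambda>(i, j). v i (I ! j))) \<noteq> 0"
    using ex_minor_if_fam_indep by blast
  \<comment> \<open>\<open>THE\<close> recovers the variable \<open>w\<close> from the monomial
    \<open>single w 1\<close>.\<close>
  define y :: "pvar \<Rightarrow> complex" where "y = case_sum (\<lambda>_. 0) (\<lambda>(i, e). (I ! i) (THE w. e = single w 1))"
  have inj: "single w 1 = single u (1 :: nat) \<longleftrightarrow> w = u" for w u :: nat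
    by (metis lookup_single_eq lookup_single_not_eq zero_neq_one)
  have "point_coord y j u = (I ! j) u" for j u
    unfolding point_coord_def y_def by (simp only: sum.case prod.case inj the_sym_eq_trivial)
  then have point_coord: "point_coord y j = I ! j" for j by (simp add: fun_eq_iff)
  have "Matrix.mat ?N ?N (\<lambda>(j, i). power_coeff y j (h i)) = transpose_mat (Matrix.mat ?N ?N (\<lambda>(i, j). v i (I ! j)))"
    by (rule eq_matI) (auto simp: power_coeff_def point_coord v_def hm)
  then have "Determinant.det (Matrix.mat ?N ?N (\<lambda>(j, i). power_coeff y j (h i))) \<noteq> 0"
    using I det_transpose[of "Matrix.mat ?N ?N (\<lambda>(i, j). v i (I ! j))" ?N] by simp
  then have "fam_indep {..<?N} (power_coeff y)" by (rule fam_indep_if_minor[of ?N "power_coeff y" h])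
  then show ?thesis using sN by (intro exI[of _ y]) (auto elim!: fam_indep_mono)
qed

lemma ex_nondeg: "\<exists>y. nondeg y"
proof -
  obtain y0 where y0: "fam_indep {..<s} (power_coeff y0)" using ex_independent_powers by blast
  \<comment> \<open>The matrix with ones on the diagonal and zeros elsewhere, so that entry
    \<open>j\<close> of the tuple is the single power Q_j^d.\<close>
  define y :: "pvar \<Rightarrow> complex" where "y = case_sum (\<lambda>(i, j). if i = j then 1 else 0) (\<lambda>x. y0 (Inr x))"
  have "power_coeff y i m = power_coeff y0 i m" for i m by (simp add: power_coeff_def point_coord_def[abs_def] y_def)
  then have "Psi y (j, m) = power_coeff y0 j m" if "j < r" for j m
  proof -
    have "Psi y (j, m) = (\<Sum>i<s. if i = j then power_coeff y0 i m else 0)"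
      unfolding Psi_power_coeff[OF that] by (rule sum.cong) (auto simp: y_def power_coeff_def point_coord_def[abs_def])
    then show ?thesis using that rs by simp
  qed
  moreover have "fam_indep {..<r} (power_coeff y0)" by (rule fam_indep_mono[OF y0]) (use rs in auto)
  ultimately have "fam_indep {..<r} (\<lambda>j m. Psi y (j, m))"
    using fam_indep_cong[of "{..<r}" "\<lambda>j m. Psi y (j, m)" "power_coeff y0"] by auto
  from ex_minor_if_fam_indep[OF this] show ?thesis unfolding nondeg_def pl_def by blast
qed

text \<open>\<Sigma> lies between the image of a nonempty open set of parameters and the whole
  image, and these two have the same closure.\<close>

lemma closure_Sigma_set: "X closure_of (Sigma_set n d r s) = X closure_of (image UNIV)"
proof
  show "X closure_of (Sigma_set n d r s) \<subseteq> X closure_of (image UNIV)"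
    by (rule closure_of_mono[OF Sigma_set_subset_image])
  obtain y0 where y0: "fam_indep {..<s} (power_coeff y0)" using ex_independent_powers by blast
  have "poly_fun (param_vars n r s) (\<lambda>y. power_coeff y i m)" if "i \<in> {..<s}" for i m
  proof (cases "m \<in> mons n d")
    case True
    have "poly_fun (param_vars n r s) (\<lambda>y. mon_eval m (point_coord y i))"
      unfolding mon_eval_def point_coord_def
      by (intro poly_fun_prod poly_fun_power poly_fun.var) (use True that in \<open>auto simp: param_vars_def mons_def\<close>)
    then show ?thesis using True by (simp add: power_coeff_def poly_fun.mult poly_fun.const)
  qed (simp add: power_coeff_def poly_fun.const)
  then obtain \<eta> where \<eta>: "poly_fun (param_vars n r s) \<eta>" "\<eta> y0 \<noteq> 0" "\<And>y. \<eta> y \<noteq> 0 \<Longrightarrow> fam_indep {..<s} (power_coeff y)"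
    using generic_minor[where T = power_coeff and K = "{..<s}" and ?y0.0 = y0 and V = "param_vars n r s"] y0 by auto
  have "image UNIV \<subseteq> X closure_of (image {y. \<eta> y \<noteq> 0})"
    by (rule image_subset_closure_generic[OF \<eta>(1,2)])
  also have "\<dots> \<subseteq> X closure_of (Sigma_set n d r s)"
    by (rule closure_of_mono[OF image_subset_Sigma_set[OF \<eta>(3)]])
  finally show "X closure_of (image UNIV) \<subseteq> X closure_of (Sigma_set n d r s)"
    by (rule closure_of_minimal) simp
qed

lemma krull_dim_closure_Sigma_set:
  shows "r * r \<le> rho"
    and "krull_dim (subtopology X (X closure_of (Sigma_set n d r s))) = ereal (real (rho - r * r))"
proof -
  have att: "\<exists>y K1. K1 \<subseteq> idx \<and> fam_indep K1 (tangent y) \<and> card K1 = rho"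
    using rho(1) by blast
  show "r * r \<le> rho" by (rule krull_dim_closure_image(1)[OF ex_nondeg rho_max att])
  show "krull_dim (subtopology X (X closure_of (Sigma_set n d r s))) = ereal (real (rho - r * r))"
    unfolding closure_Sigma_set by (rule krull_dim_closure_image(2)[OF ex_nondeg rho_max att])
qed

text \<open>\<open>F\<close> is a maximal minor of the differential that is not identically zero.
  Each of its rows consists of derivatives by one variable and has constant degree in the
  coordinates of each point, which makes it multihomogeneous.\<close>

lemma ex_rank_form:
  "\<exists>F. multihomogeneous s F \<and> (\<exists>y. eval_poly F y \<noteq> 0) \<and> vars F \<subseteq> param_vars n r s \<and>
    (\<forall>y. eval_poly F y \<noteq> 0 \<longrightarrow> (\<exists>K1\<subseteq>Inr ` param_vars n r s. fam_indep K1 (tangent y) \<and> card K1 = rho))"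
proof -
  obtain y0 K1 where K1: "K1 \<subseteq> Inr ` param_vars n r s" "fam_indep K1 (tangent y0)" "card K1 = rho"
    using rho(1) by blast
  have finK1: "finite K1" using K1(1) finite_param_vars finite_subset by blast
  obtain h where h: "bij_betw h {..<rho} K1"
    using ex_bij_betw_nat_finite[OF finK1] K1(3) by (auto simp: atLeast0LessThan)
  have "\<exists>v\<in>param_vars n r s. i < rho \<longrightarrow> h i = Inr v" for i
  proof (cases "i < rho")
    case True
    then have "h i \<in> Inr ` param_vars n r s" using h K1(1) by (auto simp: bij_betw_def)
    then show ?thesis by blast
  next
    case False
    \<comment> \<open>A default variable, so that \<open>w\<close> is a total function into
      \<open>param_vars n r s\<close>.\<close>
    have "Inl (0, 0) \<in> param_vars n r s" using pos unfolding param_vars_def by (intro InlI SigmaI) simp_all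
    then show ?thesis using False by blast
  qed
  then obtain w where w: "\<And>i. w i \<in> param_vars n r s" "\<And>i. i < rho \<Longrightarrow> h i = Inr (w i)" by metis
  obtain I where I: "Determinant.det (Matrix.mat rho rho (\<lambda>(i, j). tangent y0 (h i) (I ! j))) \<noteq> 0"
    using ex_minor_if_fam_indep[of rho "\<lambda>i. tangent y0 (h i)"] fam_indep_reindex[OF h, of "tangent y0"] K1(2) by blast
  define F where "F = Determinant.det (Matrix.mat rho rho (\<lambda>(i, j). partial_deriv (w i) (tuple_poly n d r s (I ! j))))"
  have ev: "eval_poly F y = Determinant.det (Matrix.mat rho rho (\<lambda>(i, j). tangent y (h i) (I ! j)))" for y
    unfolding F_def eval_poly_det
    by (rule arg_cong[of _ _ Determinant.det], rule eq_matI) (simp_all add: w(2) eval_partial_deriv Psi_def)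
  have vars: "vars F \<subseteq> param_vars n r s"
    unfolding F_def by (rule vars_det) (rule order_trans[OF vars_partial_deriv vars_tuple_poly])
  have "homogeneous_on (range (\<lambda>j. Inl (i, j))) (\<Sum>a = 0..<rho. (if pidx (w a) = i then 1 else 0) -
      mdeg (range (\<lambda>j. Inl (i, j))) (single (w a) 1)) F" for i
    unfolding F_def by (intro homogeneous_on_det homogeneous_on_partial_deriv_tuple_poly mdeg_term_exponent_Inl)
  moreover have "homogeneous_on (range (\<lambda>j. Inr (i, j))) (\<Sum>a = 0..<rho. (if pidx (w a) = i then d else 0) -
      mdeg (range (\<lambda>j. Inr (i, j))) (single (w a) 1)) F" for i
    unfolding F_def by (intro homogeneous_on_det homogeneous_on_partial_deriv_tuple_poly mdeg_term_exponent_Inr)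
  moreover have "param_vars n r s \<subseteq> {..<s} \<times> UNIV <+> {..<s} \<times> UNIV" by (auto simp: param_vars_def)
  ultimately have "multihomogeneous s F" using vars unfolding multihomogeneous_def by blast
  moreover have "fam_indep K1 (tangent y)" if "eval_poly F y \<noteq> 0" for y
    using fam_indep_if_minor[of rho "\<lambda>i. tangent y (h i)" "(!) I"] that fam_indep_reindex[OF h, of "tangent y"]
    unfolding ev by blast
  ultimately show ?thesis using K1 I vars unfolding ev[symmetric] by blast
qed

end

section \<open>Codimension, density and groves on the open set of maximal rank\<close>

theorem theorem2p6:
  fixes n d r s :: nat
  assumes "0 < n" "0 < d" "0 < r" "0 < s"
    and "r \<le> s" "s \<le> cvs.dim (forms n d)"
  shows "\<exists>W. openin (zariski_points s (row_vecs r) (forms n 1)) W \<and> W \<noteq> {} \<and>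
    (\<forall>(p, Q) \<in> W.
       (\<forall>c :: nat. codim (zariski_grass r (forms n d)) (Sigma_set n d r s) = ereal (real c) \<longleftrightarrow>
          grove_dim n d r s p Q = int c - 1) \<and>
       (dense_in (zariski_grass r (forms n d)) (Sigma_set n d r s) \<longleftrightarrow>
          Grove n d r s p Q = {}))"
proof -
  interpret power_sums n d r s
    using assms by unfold_locales (simp_all add: dim_forms)
  let ?N = "card (mons n d)"
  let ?X = "zariski_grass r (forms n d)"
  have X: "X = ?X" by (simp add: W_eq_forms)
  note rr = krull_dim_closure_Sigma_set(1)
  note dimS = krull_dim_closure_Sigma_set(2)[unfolded X]
  have rN: "r \<le> ?N" using rs sN by simp
  have dimG: "krull_dim ?X = ereal (real (r * ?N - r * r))" "irreducible_closed ?X (grass r (forms n d))"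
    using grassmannian_dim[OF r finite_mons rN] unfolding forms_eq[symmetric] by simp_all
  have top: "topspace ?X = grass r (forms n d)" by (rule topspace_zariski_grass[OF r])
  obtain F where F: "multihomogeneous s F" "\<exists>y. eval_poly F y \<noteq> 0" "vars F \<subseteq> param_vars n r s"
    and Frank: "\<And>y. eval_poly F y \<noteq> 0 \<Longrightarrow> \<exists>K1\<subseteq>Inr ` param_vars n r s. fam_indep K1 (tangent y) \<and> card K1 = rho"
    using ex_rank_form by blast
  define Y where "Y = (\<lambda>a b. case_sum (\<lambda>(i :: nat, j :: nat). lookup (a i) j) (\<lambda>(i :: nat, e :: nat \<Rightarrow>\<^sub>0 nat). lookup (b i) e :: complex))"
  define U where "U = {(p, Q) \<in> point_tuples s (row_vecs r) (forms n 1).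
         \<exists>a b. (\<forall>i<s. a i \<in> p i - {0} \<and> b i \<in> Q i - {0}) \<and> eval_poly F (Y a b) \<noteq> 0}"
  have "openin (zariski_points s (row_vecs r) (forms n 1)) U"
    unfolding zariski_points_def U_def Y_def
    by (rule topology_generated_by_Basis) (use F(1) in blast)
  moreover have "U \<noteq> {}"
  proof -
    \<comment> \<open>Where \<eta> is nonzero, each row of the matrix and each linear form is
      nonzero and represents a point.\<close>
    define \<eta> where "\<eta> = (\<lambda>y :: pvar \<Rightarrow> complex. \<Prod>i<s. y (Inl (i, 0)) * y (Inr (i, single 0 1)))"
    have "poly_fun UNIV \<eta>" unfolding \<eta>_def by (intro poly_fun_prod poly_fun.mult poly_fun.var) auto
    moreover have "\<eta> (\<lambda>_. 1) \<noteq> 0" by (simp add: \<eta>_def)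
    moreover have "poly_fun UNIV (eval_poly F)" by (rule poly_fun_eval_poly) simp
    moreover obtain y1 where "eval_poly F y1 \<noteq> 0" using F(2) by blast
    ultimately obtain y where y: "eval_poly F y \<noteq> 0" "\<eta> y \<noteq> 0"
      using poly_fun_slice_nonzero2[of UNIV "eval_poly F" \<eta> y1 UNIV y1 "\<lambda>_. 1"] by auto
    have y0: "y (Inl (i, 0)) \<noteq> 0" "y (Inr (i, single 0 1)) \<noteq> 0" if "i < s" for i
      using y(2) that unfolding \<eta>_def by auto
    define a where "a = (\<lambda>i. \<Sum>j<r. single j (y (Inl (i, j))))"
    define b where "b = linear_form y"
    have la: "lookup (a i) j = (if j < r then y (Inl (i, j)) else 0)" for i j
      by (simp add: a_def lookup_sum lookup_single when_def)
    have lb: "lookup (b i) (single v 1) = y (Inr (i, single v 1))" if "v \<le> n" for i v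
      using coords_linear_form[OF that, of y i] by (simp add: coords_def b_def point_coord_def)
    have ab: "a i \<in> row_vecs r" "a i \<noteq> 0" "b i \<in> forms n 1" "b i \<noteq> 0" if "i < s" for i
    proof -
      show "a i \<in> row_vecs r" by (auto simp: row_vecs_def in_keys_iff la split: if_splits)
      show "a i \<noteq> 0" using la[of i 0] y0(1)[OF that] r by auto
      show "b i \<in> forms n 1" unfolding b_def by (rule linear_form_in_forms)
      show "b i \<noteq> 0" using lb[of 0 i] y0(2)[OF that] by auto
    qed
    \<comment> \<open>\<open>Y a b\<close> agrees with \<open>y\<close> on the variables of
      \<open>F\<close>, which suffices for equal values.\<close>
    have "eval_poly F (Y a b) = eval_poly F y"
    proof (rule poly_fun_cong[OF poly_fun_eval_poly[OF F(3)]])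
      show "Y a b v = y v" if "v \<in> param_vars n r s" for v
        using that lb by (auto simp: param_vars_def Y_def la)
    qed
    then have "(restrict (\<lambda>i. cvs.span {a i}) {..<s}, restrict (\<lambda>i. cvs.span {b i}) {..<s}) \<in> U"
      using y(1) ab unfolding U_def point_tuples_def
      by (auto simp del: One_nat_def intro!: line_in_proj subspace_row_vecs subspace_forms exI[of _ a] exI[of _ b] cvs.span_base)
    then show ?thesis by blast
  qed
  moreover have "(\<forall>c :: nat. codim ?X (Sigma_set n d r s) = ereal (real c) \<longleftrightarrow> grove_dim n d r s p Q = int c - 1) \<and>
      (dense_in ?X (Sigma_set n d r s) \<longleftrightarrow> Grove n d r s p Q = {})" if pQU: "(p, Q) \<in> U" for p Q
  proof -
    obtain a b where pQ: "(p, Q) \<in> point_tuples s (row_vecs r) (forms n 1)"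
      and ab: "\<And>i. i < s \<Longrightarrow> a i \<in> p i - {0} \<and> b i \<in> Q i - {0}" and Fy: "eval_poly F (Y a b) \<noteq> 0"
      using pQU unfolding U_def by blast
    have "p i \<in> proj (row_vecs r)" "Q i \<in> proj (forms n 1)" if "i < s" for i
      using pQ that unfolding point_tuples_def by auto
    then have lines: "p i = cvs.span {a i}" "a i \<in> row_vecs r" "Q i = cvs.span {b i}" if "i < s" for i
      using proj_line[of "p i" "row_vecs r" "a i"] proj_line[of "Q i" "forms n 1" "b i"] ab[OF that] that by blast+
    have A: "is_matrix_of r s p a" using lines ab by (simp add: is_matrix_of_def)
    obtain K1 where K1: "K1 \<subseteq> Inr ` param_vars n r s" "fam_indep K1 (tangent (Y a b))" "card K1 = rho"
      using Frank[OF Fy] by blast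
    have b: "b i \<noteq> 0 \<and> Q i = cvs.span {b i} \<and> point_coord (Y a b) i = coords (b i)" if "i < s" for i
      using ab[OF that] lines(3)[OF that] by (simp add: point_coord_def Y_def coords_def fun_eq_iff)
    have K: "rho \<le> r * ?N" "tvs.dim (Kspace n d r s a Q) = r * ?N - rho"
      "Kspace n d r s a Q \<subseteq> {0} \<longleftrightarrow> rho = r * ?N"
      by (rule dim_Kspace[OF _ b K1]; simp add: Y_def)+
    have "grove_dim n d r s p Q = int (r * ?N - rho) - 1" by (simp only: grove_dim_eq[OF A] K(2))
    \<comment> \<open>Natural subtraction is truncated: both \<open>r * r \<le> rho\<close> and
      \<open>rho \<le> r * ?N\<close> enter.\<close>
    moreover have "r * ?N - r * r = (rho - r * r) + (r * ?N - rho)" using rr K(1) by arith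
    then have "real (r * ?N - r * r) - real (rho - r * r) = real (r * ?N - rho)" by (simp only: of_nat_add)
    then have "codim ?X (Sigma_set n d r s) = ereal (real (r * ?N - rho))"
      by (simp only: codim_def dimG(1) dimS ereal_minus)
    moreover have "Grove n d r s p Q = {} \<longleftrightarrow> rho = r * ?N"
      unfolding grove_of_image[OF A, symmetric] K(3)[symmetric] by auto
    moreover have "dense_in ?X (Sigma_set n d r s) \<longleftrightarrow> rho = r * ?N"
    proof
      assume "dense_in ?X (Sigma_set n d r s)"
      then have "subtopology ?X (?X closure_of (Sigma_set n d r s)) = ?X"
        by (simp add: dense_in_def subtopology_topspace)
      then have "rho - r * r = r * ?N - r * r" using dimS dimG(1) by simp
      then show "rho = r * ?N" using rr K(1) by simp
    next
      assume "rho = r * ?N"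
      then have "krull_dim (subtopology ?X (?X closure_of (Sigma_set n d r s))) = ereal (real (r * ?N - r * r))"
        using dimS by simp
      moreover have "subtopology ?X (grass r (forms n d)) = ?X" using subtopology_topspace[of ?X] top by simp
      moreover have "?X closure_of (Sigma_set n d r s) \<subseteq> grass r (forms n d)"
        using closure_of_subset_topspace[of ?X] top by simp
      \<comment> \<open>The Grassmannian is irreducible, so a closed subset of the same dimension is
        all of it.\<close>
      ultimately have "?X closure_of (Sigma_set n d r s) = grass r (forms n d)"
        using krull_dim_eq_imp_eq[OF closedin_closure_of dimG(2), of "Sigma_set n d r s"] dimG(1) by simp
      then show "dense_in ?X (Sigma_set n d r s)" by (simp add: dense_in_def top)
    qed
    ultimately show ?thesis by (simp del: of_nat_diff of_nat_mult)
  qed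
  ultimately show ?thesis by blast
qed

end
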